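(* For every integer $k\ge 3$, every tournament $T$ on $k$ vertices and every real $\varepsilon>0$ there exists $n_0\in\mathbb{N}$ such that the following holds for all $n>n_0$ with $k\mid n$. Let $m=\frac{n}{k}\binom{k}{2}$ and let $\mathbf{D}=\{D_1,\ldots,D_m\}$ be a collection of digraphs on the same $n$-vertex set such that $\delta^0(D_i)\ge(1-\frac{1}{k}+\varepsilon)n$ for every $i\in[m]$. Then $\mathbf{D}$ admits a rainbow $T$-factor.
   Context: Digraphs have no loops and at most one arc in each direction between any two vertices. The minimum semi-degree $\delta^0(D)$ is the minimum of the minimum out-degree $\delta^+(D)$ and the minimum in-degree $\delta^-(D)$. A $T$-factor is a collection of vertex-disjoint copies of $T$ covering all vertices. A subdigraph is rainbow (with respect to $\mathbf{D}$) if its arcs can be assigned pairwise distinct indices $i$ such that each arc assigned index $i$ is an arc of $D_i$; in particular a rainbow $T$-factor uses exactly one arc from each $D_i$. *)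

theory Defs
  imports Complex_Main "Graph_Theory.Pair_Digraph" "Graph_Theory.Digraph_Isomorphism"
begin

text \<open>
  Digraphs are finite \<open>pair_digraph\<close>s: no loops, and, as arcs are ordered pairs of
  vertices, at most one arc in each direction between two vertices.
\<close>

text \<open>The three minimum degrees are only meaningful for finite digraphs with at least one vertex.\<close>

definition min_out_degree :: "('a, 'b) pre_digraph \<Rightarrow> nat" where
  "min_out_degree G = Min (out_degree G ` verts G)"

definition min_in_degree :: "('a, 'b) pre_digraph \<Rightarrow> nat" where
  "min_in_degree G = Min (in_degree G ` verts G)"

definition min_semi_degree :: "('a, 'b) pre_digraph \<Rightarrow> nat" where
  "min_semi_degree G = min (min_out_degree G) (min_in_degree G)"

definition tournament :: "'a pair_pre_digraph \<Rightarrow> bool" where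
  "tournament T \<longleftrightarrow> pair_digraph T \<and>
     (\<forall>u\<in>pverts T. \<forall>v\<in>pverts T. u \<noteq> v \<longrightarrow> ((u, v) \<in> parcs T \<longleftrightarrow> (v, u) \<notin> parcs T))"

definition copy_of :: "'a pair_pre_digraph \<Rightarrow> 'b pair_pre_digraph \<Rightarrow> bool" where
  "copy_of T H \<longleftrightarrow> digraph_iso (with_proj T) (with_proj H)"

text \<open>
  No host digraph is mentioned here: which arcs the copies may use is part of \<open>rainbow\<close>.
\<close>

definition factor :: "'a pair_pre_digraph \<Rightarrow> 'b set \<Rightarrow> 'b pair_pre_digraph set \<Rightarrow> bool" where
  "factor T V \<F> \<longleftrightarrow> (\<forall>H\<in>\<F>. copy_of T H) \<and>
     pairwise (\<lambda>G H. disjnt (pverts G) (pverts H)) \<F> \<and>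
     (\<Union>H\<in>\<F>. pverts H) = V"

definition digraph_Union :: "'a pair_pre_digraph set \<Rightarrow> 'a pair_pre_digraph" where
  "digraph_Union \<F> = \<lparr> pverts = (\<Union>H\<in>\<F>. pverts H), parcs = (\<Union>H\<in>\<F>. parcs H) \<rparr>"

definition rainbow ::
  "'i set \<Rightarrow> ('i \<Rightarrow> 'a pair_pre_digraph) \<Rightarrow> 'a pair_pre_digraph \<Rightarrow> bool" where
  "rainbow I D H \<longleftrightarrow>
     (\<exists>c. inj_on c (parcs H) \<and> (\<forall>e\<in>parcs H. c e \<in> I \<and> e \<in> parcs (D (c e))))"

definition rainbow_factor ::
  "'a pair_pre_digraph \<Rightarrow> 'b set \<Rightarrow> 'i set \<Rightarrow> ('i \<Rightarrow> 'b pair_pre_digraph) \<Rightarrow>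
     'b pair_pre_digraph set \<Rightarrow> bool" where
  "rainbow_factor T V I D \<F> \<longleftrightarrow> factor T V \<F> \<and> rainbow I D (digraph_Union \<F>)"

end

theory Submission
  imports Defs "HOL-Library.FuncSet" "HOL-Real_Asymp.Real_Asymp"
begin

text \<open>
  Split vertices and colours into \<open>N = n / k\<close> units of \<open>k\<close> vertices and \<open>k choose 2\<close> colours, as many
  of them as possible being rainbow copies of the pattern. If some unit is not a copy, then boundedly
  many other units can be found whose union with it decomposes into rainbow copies, contradicting
  maximality; so neither the regularity lemma nor a separate absorption step is needed.

  A Chernoff bound shows that most tuples of \<open>2 * s\<close> units, \<open>s\<close> a large constant, inherit the degree
  condition. By pigeonhole a positive proportion of them, together with the exceptional unit, induce
  the same arcs, and such a dense set of tuples contains a box: the common structure occurs blown up.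
  In the structure itself every copy lies in a uniform fractional tiling. By Farkas' lemma this
  amounts to finding, for any weighting, a copy of at least average weight. One takes the heaviest
  colour and then greedily the heaviest admissible vertices: the \<open>j\<close>-th choice excludes less than a
  fraction \<open>j / k\<close> of the vertices, so it weighs at least the average of the \<open>j\<close>-th of \<open>k\<close> blocks of
  the vertices in decreasing order. Clearing denominators gives integral tilings of a blow-up.

  The exceptional unit is absorbed by local changes. A vertex can be exchanged for any other one in a
  copy adapted to both, since the last vertex chosen still has to avoid only \<open>k\<close> non-neighbourhoods
  of density less than \<open>1 / k\<close>; the same works for colours.
\<close>

section \<open>Linear inequalities over ordered fields\<close>

text \<open>In a fixed colour and direction a vertex misses, on average, fewer than one vertex per
  unit. A random set of \<open>s\<close> units therefore contains fewer than \<open>s\<close> misses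
  among its \<open>s * k\<close> vertices, and this is what all greedy choices of \<open>k\<close>
  vertices live on.

  What could spoil them is that a copy needs many colours at once. This obstacle disappears in a
  blow-up: one colour of the sampled structure stands for a whole class of colours, so a copy may
  use that single class on all its arcs. The colour can then be fixed before the vertices, and what
  remains is to embed the pattern for one fixed colour.

  The other obstacle is exactness, because the extra unit must be used exactly once. A chosen copy
  is therefore forced into a uniform tiling of the other units and altered by one exchange. The
  exchanges for all vertices and colours of the extra unit are arranged so that together they give
  up exactly what one further copy consumes, and that copy is added back.\<close>

lemma farkas:
  fixes a :: "'e \<Rightarrow> 'z \<Rightarrow> 'q::linordered_field"
  assumes "finite E" "finite Z"
    and "\<And>y. (\<forall>e\<in>E. (\<Sum>z\<in>Z. y z * a e z) \<le> 0) \<Longrightarrow> (\<Sum>z\<in>Z. y z * b z) \<le> 0"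
  shows "\<exists>x. (\<forall>e\<in>E. 0 \<le> x e) \<and> (\<forall>z\<in>Z. b z = (\<Sum>e\<in>E. x e * a e z))"
  using assms(1,3)
proof (induction E arbitrary: a b rule: finite_induct)
  case empty
  have *: "(\<Sum>z\<in>Z. y z * b z) \<le> 0" for y using empty by blast
  have "b z = 0" if "z \<in> Z" for z
  proof -
    have "(\<Sum>u\<in>Z. (if u = z then c else 0) * b u) = c * b z" for c
      using \<open>finite Z\<close> that by (simp add: if_distrib[of "\<lambda>t. t * _"] cong: if_cong)
    with *[of "\<lambda>u. if u = z then 1 else 0"] *[of "\<lambda>u. if u = z then -1 else 0"] show ?thesis
      by (simp only:)
  qed
  then show ?case by auto
next
  case (insert n E)
  define L where "L = (\<lambda>v y. \<Sum>z\<in>Z. y z * v z :: 'q)"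
  have L_add: "L v (\<lambda>z. y z - c * w z) = L v y - c * L v w" for v y c w
    by (simp add: L_def sum_subtractf sum_distrib_left algebra_simps)
  have L_vec: "L (\<lambda>z. v z - c * w z) y = L v y - c * L w y" for v y c w
    by (simp add: L_def sum_subtractf sum_distrib_left algebra_simps)
  have prem: "L b y \<le> 0" if "\<forall>e\<in>insert n E. L (a e) y \<le> 0" for y
    using insert.prems that unfolding L_def by blast
  show ?case
  proof (cases "\<forall>y. (\<forall>e\<in>E. L (a e) y \<le> 0) \<longrightarrow> L b y \<le> 0")
    case True
    then obtain x where x: "\<forall>e\<in>E. 0 \<le> x e" "\<forall>z\<in>Z. b z = (\<Sum>e\<in>E. x e * a e z)"
      using insert.IH[of a b] unfolding L_def by metis
    have "(\<Sum>e\<in>insert n E. (x(n := 0)) e * a e z) = (\<Sum>e\<in>E. x e * a e z)" for z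
      using insert.hyps by (simp add: fun_upd_def) (intro sum.cong, auto)
    then show ?thesis using x insert.hyps
      by (intro exI[of _ "x(n := 0)"]) (auto simp del: fun_upd_apply, auto)
  next
    case False
    then obtain y0 where y0: "\<forall>e\<in>E. L (a e) y0 \<le> 0" "L b y0 > 0" by force
    then have pos: "L (a n) y0 > 0" using prem[of y0] by force
    \<comment> \<open>\<open>w\<close> is positive on \<open>b\<close> and on \<open>a n\<close>,
      but nonpositive on all other generators. Everything is projected along \<open>a n\<close> onto
      the kernel of \<open>w\<close>; on the dual side this turns \<open>y\<close> into
      \<open>y'\<close>. The signs of \<open>w\<close> make the final coefficient \<open>c\<close>
      of \<open>a n\<close> nonnegative.\<close>
    define w where "w = (\<lambda>z. y0 z / L (a n) y0)"
    have Lw: "L v w = L v y0 / L (a n) y0" for v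
      by (simp add: L_def w_def sum_divide_distrib)
    have w: "L (a n) w = 1" "\<forall>e\<in>E. L (a e) w \<le> 0" "L b w > 0"
      using pos y0 by (auto simp: Lw divide_nonpos_pos)
    define a' where "a' = (\<lambda>e z. a e z - L (a e) w * a n z)"
    define b' where "b' = (\<lambda>z. b z - L b w * a n z)"
    have "L b' y \<le> 0" if "\<forall>e\<in>E. L (a' e) y \<le> 0" for y
    proof -
      define y' where "y' = (\<lambda>z. y z - L (a n) y * w z)"
      have "L (a e) y' = L (a' e) y" for e
        by (simp add: y'_def a'_def L_add L_vec)
      moreover have "L (a n) y' = 0" using w by (simp add: y'_def L_add)
      moreover have "L b y' = L b' y" by (simp add: y'_def b'_def L_add L_vec)
      ultimately show ?thesis using prem[of y'] that by simp
    qed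
    then obtain x where x: "\<forall>e\<in>E. 0 \<le> x e" "\<forall>z\<in>Z. b' z = (\<Sum>e\<in>E. x e * a' e z)"
      using insert.IH[of a' b'] unfolding L_def by metis
    define c where "c = L b w - (\<Sum>e\<in>E. x e * L (a e) w)"
    have "(\<Sum>e\<in>E. x e * L (a e) w) \<le> 0"
      using x w by (intro sum_nonpos) (simp add: mult_nonneg_nonpos)
    then have c: "c \<ge> 0" using w by (simp add: c_def)
    have "b z = (\<Sum>e\<in>insert n E. (x(n := c)) e * a e z)" if "z \<in> Z" for z
    proof -
      have "(\<Sum>e\<in>insert n E. (x(n := c)) e * a e z) = c * a n z + (\<Sum>e\<in>E. x e * a e z)"
        using insert.hyps by (simp add: fun_upd_def) (intro sum.cong, auto)
      also have "\<dots> = L b w * a n z + (\<Sum>e\<in>E. x e * a' e z)"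
        by (simp add: c_def a'_def algebra_simps sum_subtractf sum_distrib_left sum_distrib_right)
      also have "\<dots> = b z"
        by (simp only: x(2)[rule_format, OF that, symmetric]) (simp add: b'_def)
      finally show ?thesis by simp
    qed
    then show ?thesis using x c insert.hyps by (intro exI[of _ "x(n := c)"]) auto
  qed
qed

section \<open>From rational weights to lists of copies\<close>

lemma clear_denominators:
  fixes x :: "'e \<Rightarrow> rat"
  assumes "finite E" "\<forall>e\<in>E. 0 \<le> x e"
  shows "\<exists>p m. p > 0 \<and> (\<forall>e\<in>E. of_nat p * x e = of_nat (m e))"
  using assms
proof (induction E rule: finite_induct)
  case empty then show ?case by auto
next
  case (insert n E)
  then obtain p m where p: "p > 0" "\<forall>e\<in>E. of_nat p * x e = of_nat (m e)" by auto
  obtain u v where uv: "x n = Fract u v" "v > 0" by (metis Rat_cases)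
  have "u \<ge> 0" using insert.prems uv by (simp add: zero_le_Fract_iff)
  then obtain u' v' where u'v': "u = int u'" "v = int v'" "v' > 0"
    using uv(2) by (metis nonneg_int_cases of_nat_0_less_iff order_less_imp_le)
  have xn: "of_nat v' * x n = of_nat u'"
    using u'v' uv by (simp add: Fract_of_int_quotient)
  define m' where "m' = (\<lambda>e. if e = n then p * u' else v' * m e)"
  have "of_nat (p * v') * x e = of_nat (m' e)" if "e \<in> insert n E" for e
  proof (cases "e = n")
    case True
    then show ?thesis using xn by (simp add: m'_def)
  next
    case False
    then have "of_nat p * x e = of_nat (m e)" using p that by auto
    then have "of_nat v' * (of_nat p * x e) = of_nat v' * of_nat (m e)" by simp
    then show ?thesis using False unfolding m'_def of_nat_mult by (simp only: ac_simps if_False) simp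
  qed
  then show ?case using p u'v' by (intro exI[of _ "p * v'"] exI[of _ m']) auto
qed

lemma list_with_multiplicities:
  assumes "finite E"
  shows "\<exists>es. set es \<subseteq> E \<and> (\<forall>f::'e \<Rightarrow> nat. sum_list (map f es) = (\<Sum>e\<in>E. m e * f e))"
  using assms
proof (induction E rule: finite_induct)
  case empty then show ?case by (intro exI[of _ "[]"]) auto
next
  case (insert n E)
  then obtain es where es: "set es \<subseteq> E" "\<And>f::'e \<Rightarrow> nat. sum_list (map f es) = (\<Sum>e\<in>E. m e * f e)"
    by auto
  show ?case
    by (rule exI[of _ "replicate (m n) n @ es"])
      (use es insert.hyps in \<open>auto simp: sum_list_replicate map_replicate\<close>)
qed

section \<open>Tuples of units\<close>

text \<open>This is the factorisation of a moment generating function. As \<open>f\<close> reads the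
  tuple only at positions in \<open>J\<close>, the positions in \<open>H\<close> are independent
  once those are fixed, and they can be summed out one by one at a cost of
  \<open>\<rho> * card U\<close> each.\<close>

lemma sum_PiE_prod_le:
  fixes f :: "('i \<Rightarrow> 'a) \<Rightarrow> 'a \<Rightarrow> real" and \<rho> :: real
  assumes "finite H" "finite J" "finite U" "H \<inter> J = {}"
    and "\<And>w u. 0 \<le> f w u"
    and "\<And>w l v. l \<notin> J \<Longrightarrow> f (w(l := v)) = f w"
    and "\<And>w. w \<in> J \<rightarrow> U \<Longrightarrow> (\<Sum>u\<in>U. f w u) \<le> \<rho> * card U"
    and "0 \<le> \<rho>"
  shows "(\<Sum>w\<in>PiE (J \<union> H) (\<lambda>_. U). \<Prod>l\<in>H. f w (w l)) \<le> \<rho> ^ card H * real (card U) ^ card (J \<union> H)"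
  using assms(1,4)
proof (induction H rule: finite_induct)
  case empty
  then show ?case using assms(2) by (simp add: card_PiE)
next
  case (insert x H)
  let ?P = "PiE (J \<union> H) (\<lambda>_. U)"
  have x: "x \<notin> J" "x \<notin> H" "x \<notin> J \<union> H" using insert by auto
  have fin: "finite ?P" using assms insert by (intro finite_PiE) auto
  have "(\<Sum>w\<in>PiE (J \<union> insert x H) (\<lambda>_. U). \<Prod>l\<in>insert x H. f w (w l))
      = (\<Sum>(u, w)\<in>U \<times> ?P. \<Prod>l\<in>insert x H. f (w(x := u)) ((w(x := u)) l))"
  proof -
    have "PiE (J \<union> insert x H) (\<lambda>_. U) = (\<lambda>(y, g). g(x := y)) ` (U \<times> ?P)"
      by (simp add: PiE_insert_eq)
    moreover have "inj_on (\<lambda>(y, g). g(x := y)) (U \<times> ?P)"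
      using inj_combinator[OF x(3), of "\<lambda>_. U"] by simp
    ultimately show ?thesis
      by (simp add: sum.reindex case_prod_unfold)
  qed
  also have "\<dots> = (\<Sum>(u, w)\<in>U \<times> ?P. f w u * (\<Prod>l\<in>H. f w (w l)))"
  proof (intro sum.cong refl, clarify)
    fix u w
    have "(\<Prod>l\<in>H. f w ((w(x := u)) l)) = (\<Prod>l\<in>H. f w (w l))"
      using x by (intro prod.cong) auto
    then show "(\<Prod>l\<in>insert x H. f (w(x := u)) ((w(x := u)) l)) = f w u * (\<Prod>l\<in>H. f w (w l))"
      using insert.hyps assms(6)[OF x(1)] by simp
  qed
  also have "\<dots> = (\<Sum>w\<in>?P. (\<Sum>u\<in>U. f w u) * (\<Prod>l\<in>H. f w (w l)))"
    by (simp add: sum.cartesian_product[symmetric] sum.swap[of _ ?P U] sum_distrib_right)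
  also have "\<dots> \<le> (\<Sum>w\<in>?P. (\<rho> * card U) * (\<Prod>l\<in>H. f w (w l)))"
    using assms(5,7) by (intro sum_mono mult_right_mono prod_nonneg) (auto simp: PiE_def Pi_def)
  also have "\<dots> = \<rho> * card U * (\<Sum>w\<in>?P. \<Prod>l\<in>H. f w (w l))"
    by (simp add: sum_distrib_left)
  also have "\<dots> \<le> \<rho> * card U * (\<rho> ^ card H * real (card U) ^ card (J \<union> H))"
    using insert assms(8) by (intro mult_left_mono) auto
  also have "\<dots> = \<rho> ^ card (insert x H) * real (card U) ^ card (J \<union> insert x H)"
    using insert.hyps x assms(2) by simp
  finally show ?case .
qed

text \<open>Erdos's theorem on complete multipartite subhypergraphs, by induction on
  \<open>r\<close>. Many values \<open>u\<close> of the last coordinate have a dense link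
  \<open>F u\<close>; among a bounded number of these, some \<open>q\<close> have a dense common
  link, to which the induction hypothesis applies. The sides of the box may overlap.\<close>

lemma dense_contains_box:
  fixes \<delta> :: real
  assumes "\<delta> > 0"
  shows "\<exists>N0. \<forall>(U :: 'u set) G. finite U \<longrightarrow> card U \<ge> N0 \<longrightarrow> G \<subseteq> PiE {..<r} (\<lambda>_. U) \<longrightarrow>
    real (card G) \<ge> \<delta> * real (card U) ^ r \<longrightarrow>
    (\<exists>Q. (\<forall>l<r. Q l \<subseteq> U \<and> card (Q l) = q) \<and> PiE {..<r} Q \<subseteq> G)"
  using assms
proof (induction r arbitrary: \<delta>)
  case 0
  have "PiE {..<0} Q \<subseteq> G" if "G \<subseteq> PiE {..<0} (\<lambda>_. U)" "real (card G) \<ge> \<delta> * real (card U) ^ 0"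
    for U :: "'u set" and G and Q :: "nat \<Rightarrow> 'u set"
  proof -
    have "G \<noteq> {}" using that 0 by auto
    then show ?thesis using that by auto
  qed
  then show ?case by blast
next
  case (Suc r)
  \<comment> \<open>An average tuple of \<open>P\<close> will lie in at least
    \<open>t * \<delta> / 2\<close> of the \<open>t\<close> selected links, which is at least
    \<open>2 * q\<close>. So the tuples in at least \<open>q\<close> links still have density
    \<open>\<delta> / 4\<close>. \<open>Suc q\<close> keeps \<open>t\<close> positive when
    \<open>q = 0\<close>.\<close>
  obtain t :: nat where t: "real t \<ge> 4 * real (Suc q) / \<delta>" using real_arch_simple by blast
  have "4 * real (Suc q) / \<delta> > 0" using Suc.prems by simp
  then have t0: "t > 0" using t by (metis of_nat_0_less_iff less_le_trans)
  have tq: "real t * \<delta> \<ge> 4 * real q" using t Suc.prems by (simp add: field_simps)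
  \<comment> \<open>The factor \<open>2 ^ t\<close> is lost to the pigeonhole principle over the
    subsets of \<open>W\<close>.\<close>
  define \<delta>' where "\<delta>' = \<delta> / 4 / 2 ^ t"
  have "\<delta>' > 0" using Suc.prems by (simp add: \<delta>'_def)
  from Suc.IH[OF this] obtain N1 where N1: "\<And>(U :: 'u set) G. finite U \<Longrightarrow> card U \<ge> N1 \<Longrightarrow>
      G \<subseteq> PiE {..<r} (\<lambda>_. U) \<Longrightarrow> real (card G) \<ge> \<delta>' * real (card U) ^ r \<Longrightarrow>
      \<exists>Q. (\<forall>l<r. Q l \<subseteq> U \<and> card (Q l) = q) \<and> PiE {..<r} Q \<subseteq> G" by meson
  obtain N2 :: nat where N2: "real N2 \<ge> 2 * real t / \<delta>" using real_arch_simple by blast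
  show ?case
  proof (rule exI[of _ "max 1 (max N1 N2)"], intro allI impI)
    fix U :: "'u set" and G
    assume U: "finite U" "max 1 (max N1 N2) \<le> card U" and G: "G \<subseteq> PiE {..<Suc r} (\<lambda>_. U)"
      "\<delta> * real (card U) ^ Suc r \<le> real (card G)"
    define P where "P = PiE {..<r} (\<lambda>_. U)"
    define M where "M = real (card U) ^ r"
    have M: "real (card P) = M" "M > 0" using U by (auto simp: P_def M_def card_PiE)
    have finP: "finite P" unfolding P_def using U by (intro finite_PiE) auto
    define F where "F = (\<lambda>u. {w\<in>P. w(r := u) \<in> G})"
    have FM: "real (card (F u)) \<le> M" for u
      using M(1) finP card_mono[of P "F u"] by (simp add: F_def)
    have r: "r \<notin> {..<r}" by simp
    have cG: "card G = (\<Sum>u\<in>U. card (F u))"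
    proof -
      let ?h = "\<lambda>(y, g). g(r := y)"
      have eq: "PiE {..<Suc r} (\<lambda>_. U) = ?h ` (U \<times> P)"
        unfolding P_def lessThan_Suc by (simp add: PiE_insert_eq)
      have inj: "inj_on ?h (U \<times> P)"
        using inj_combinator[OF r, of "\<lambda>_. U"] by (simp add: P_def)
      have "G = ?h ` (SIGMA u:U. F u)"
        using G(1) unfolding eq F_def by (auto 0 3 simp: image_iff)
      moreover have "inj_on ?h (SIGMA u:U. F u)"
        by (rule inj_on_subset[OF inj]) (auto simp: F_def)
      ultimately have "card G = card (SIGMA u:U. F u)" by (simp add: card_image)
      also have "\<dots> = (\<Sum>u\<in>U. card (F u))"
        using U finP by (intro card_SigmaI) (auto simp: F_def)
      finally show ?thesis .
    qed
    define U' where "U' = {u\<in>U. real (card (F u)) \<ge> \<delta> / 2 * M}"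
    have "\<delta> * real (card U) * M \<le> (\<Sum>u\<in>U. real (card (F u)))"
      using G(2) cG by (simp add: M_def mult.assoc)
    also have "\<dots> \<le> (\<Sum>u\<in>U. (if u \<in> U' then M else 0) + \<delta> / 2 * M)"
    proof (intro sum_mono)
      fix u assume "u \<in> U"
      have "0 \<le> \<delta> / 2 * M" using M Suc.prems by simp
      then show "real (card (F u)) \<le> (if u \<in> U' then M else 0) + \<delta> / 2 * M"
        using FM[of u] \<open>u \<in> U\<close> by (auto simp: U'_def)
    qed
    also have "\<dots> = real (card U') * M + real (card U) * (\<delta> / 2 * M)"
    proof -
      have "U \<inter> {u. u \<in> U'} = U'" by (auto simp: U'_def)
      then show ?thesis using U by (simp add: sum.distrib sum.If_cases)
    qed
    finally have "M * (\<delta> / 2 * real (card U)) \<le> M * real (card U')"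
      by (simp add: algebra_simps)
    then have "\<delta> / 2 * real (card U) \<le> real (card U')" using M by simp
    moreover have "real t \<le> \<delta> / 2 * real (card U)"
    proof -
      have "2 * real t / \<delta> \<le> real (card U)" using N2 U by linarith
      then show ?thesis using Suc.prems by (simp add: field_simps)
    qed
    ultimately have "t \<le> card U'" by linarith
    then obtain W where W: "W \<subseteq> U'" "card W = t" "finite W"
      by (metis obtain_subset_with_card_n)
    define d where "d = (\<lambda>y. card {u\<in>W. y \<in> F u})"
    have "(\<Sum>y\<in>P. d y) = (\<Sum>u\<in>W. card (F u))"
    proof -
      have "(\<Sum>y\<in>P. d y) = (\<Sum>y\<in>P. \<Sum>u\<in>W. if y \<in> F u then 1 else 0)"
        unfolding d_def using W(3) by (intro sum.cong refl) (simp add: sum.If_cases Int_def)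
      also have "\<dots> = (\<Sum>u\<in>W. \<Sum>y\<in>P. if y \<in> F u then 1 else 0)" by (rule sum.swap)
      also have "\<dots> = (\<Sum>u\<in>W. card (F u))"
      proof (intro sum.cong refl)
        fix u
        have "P \<inter> {y. y \<in> F u} = F u" by (auto simp: F_def)
        then show "(\<Sum>y\<in>P. if y \<in> F u then 1 else 0) = card (F u)"
          using finP by (simp add: sum.If_cases)
      qed
      finally show ?thesis .
    qed
    moreover have "(\<Sum>u\<in>W. real (card (F u))) \<ge> (\<Sum>u\<in>W. \<delta> / 2 * M)"
      using W by (intro sum_mono) (auto simp: U'_def)
    ultimately have sd: "real t * (\<delta> / 2 * M) \<le> (\<Sum>y\<in>P. real (d y))"
      using W by (simp flip: of_nat_sum)
    define Y where "Y = {y\<in>P. d y \<ge> q}"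
    have "(\<Sum>y\<in>P. real (d y)) \<le> (\<Sum>y\<in>P. (if y \<in> Y then real t else 0) + real q)"
    proof (intro sum_mono)
      fix y assume "y \<in> P"
      have "d y \<le> t" unfolding d_def W(2)[symmetric] using W(3) by (intro card_mono) auto
      then show "real (d y) \<le> (if y \<in> Y then real t else 0) + real q"
        using \<open>y \<in> P\<close> by (auto simp: Y_def)
    qed
    also have "\<dots> = real t * real (card Y) + real q * M"
    proof -
      have "P \<inter> {y. y \<in> Y} = Y" by (auto simp: Y_def)
      then show ?thesis using finP M by (simp add: sum.distrib sum.If_cases)
    qed
    also have "\<dots> \<le> real t * real (card Y) + real t * \<delta> / 4 * M"
      using tq M by (intro add_left_mono mult_right_mono) auto
    finally have "real t * (\<delta> / 4 * M) \<le> real t * real (card Y)"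
      using sd by (simp add: algebra_simps)
    then have cY: "\<delta> / 4 * M \<le> real (card Y)" using t0 by simp
    define I where "I = (\<lambda>S. {y\<in>P. \<forall>u\<in>S. y \<in> F u})"
    have "Y \<subseteq> (\<Union>S\<in>{S\<in>Pow W. card S = q}. I S)"
    proof
      fix y assume y: "y \<in> Y"
      then have "q \<le> card {u\<in>W. y \<in> F u}" by (simp add: Y_def d_def)
      then obtain S where "S \<subseteq> {u\<in>W. y \<in> F u}" "card S = q"
        by (metis obtain_subset_with_card_n)
      then show "y \<in> (\<Union>S\<in>{S\<in>Pow W. card S = q}. I S)"
        using y by (auto simp: I_def Y_def)
    qed
    then have "card Y \<le> card (\<Union>S\<in>{S\<in>Pow W. card S = q}. I S)"
      using W finP by (intro card_mono) (auto simp: I_def)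
    also have "\<dots> \<le> (\<Sum>S\<in>{S\<in>Pow W. card S = q}. card (I S))"
      using W by (intro card_UN_le) auto
    finally have Ysum: "real (card Y) \<le> (\<Sum>S\<in>{S\<in>Pow W. card S = q}. real (card (I S)))"
      by (metis (no_types) of_nat_mono of_nat_sum)
    have "\<exists>S\<in>{S\<in>Pow W. card S = q}. \<delta>' * M \<le> real (card (I S))"
    proof (rule ccontr)
      let ?SS = "{S\<in>Pow W. card S = q}"
      assume neg: "\<not> ?thesis"
      have finSS: "finite ?SS" using W by auto
      have ne: "?SS \<noteq> {}"
      proof
        assume "?SS = {}"
        then have "real (card Y) \<le> 0" using Ysum by (simp only: sum.empty)
        then show False using cY M Suc.prems by (smt (verit) mult_pos_pos zero_less_divide_iff)
      qed
      have "card ?SS \<le> card (Pow W)" using W by (intro card_mono) auto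
      then have "real (card ?SS) \<le> 2 ^ t" using W by (simp add: card_Pow)
      have "(\<Sum>S\<in>?SS. real (card (I S))) < (\<Sum>S\<in>?SS. \<delta>' * M)"
        using neg finSS ne by (intro sum_strict_mono) auto
      also have "\<dots> = real (card ?SS) * (\<delta>' * M)" by simp
      also have "\<dots> \<le> 2 ^ t * (\<delta>' * M)"
        using \<open>real (card ?SS) \<le> 2 ^ t\<close> \<open>\<delta>' > 0\<close> M by (intro mult_right_mono) auto
      also have "\<dots> = \<delta> / 4 * M" by (simp add: \<delta>'_def)
      finally show False using Ysum cY by linarith
    qed
    then obtain S where S: "S \<subseteq> W" "card S = q" "\<delta>' * M \<le> real (card (I S))" by auto
    have "\<exists>Q. (\<forall>l<r. Q l \<subseteq> U \<and> card (Q l) = q) \<and> PiE {..<r} Q \<subseteq> I S"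
      using U S(3) by (intro N1) (auto simp: I_def P_def M_def)
    then obtain Q where Q: "\<forall>l<r. Q l \<subseteq> U \<and> card (Q l) = q" "PiE {..<r} Q \<subseteq> I S" by blast
    have "PiE {..<Suc r} (Q(r := S)) \<subseteq> G"
    proof
      fix w assume w: "w \<in> PiE {..<Suc r} (Q(r := S))"
      have "w l \<in> Q l" if "l < r" for l
        using PiE_mem[OF w, of l] that by simp
      then have "restrict w {..<r} \<in> PiE {..<r} Q"
        by (simp add: restrict_PiE_iff)
      then have "restrict w {..<r} \<in> I S" using Q by blast
      moreover have "w r \<in> S" using PiE_mem[OF w, of r] by simp
      ultimately have "(restrict w {..<r})(r := w r) \<in> G" by (auto simp: I_def F_def)
      moreover have "(restrict w {..<r})(r := w r) = w"
        using w by (intro ext) (auto simp: PiE_def extensional_def restrict_def)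
      ultimately show "w \<in> G" by simp
    qed
    moreover have "\<forall>l<Suc r. (Q(r := S)) l \<subseteq> U \<and> card ((Q(r := S)) l) = q"
      using Q S W by (auto simp: U'_def less_Suc_eq)
    ultimately show "\<exists>Q. (\<forall>l<Suc r. Q l \<subseteq> U \<and> card (Q l) = q) \<and> PiE {..<Suc r} Q \<subseteq> G" by blast
  qed
qed

section \<open>Rainbow tilings\<close>

definition pairs :: "nat \<Rightarrow> (nat \<times> nat) set" where
  "pairs k = {(i, j). i < j \<and> j < k}"

lemma finite_pairs [simp]: "finite (pairs k)"
  by (rule finite_subset[of _ "{..<k} \<times> {..<k}"]) (auto simp: pairs_def)

lemma card_pairs: "card (pairs k) = k choose 2"
proof (induction k)
  case 0
  then show ?case by (simp add: pairs_def)
next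
  case (Suc k)
  have "pairs (Suc k) = pairs k \<union> (\<lambda>i. (i, k)) ` {..<k}"
    by (auto simp: pairs_def)
  moreover have "card ((\<lambda>i. (i, k)) ` {..<k}) = k"
    by (simp add: card_image inj_on_def)
  moreover have "pairs k \<inter> (\<lambda>i. (i, k)) ` {..<k} = {}"
    by (auto simp: pairs_def)
  ultimately have "card (pairs (Suc k)) = card (pairs k) + k"
    by (simp add: card_Un_disjoint)
  then show ?case using Suc by (simp add: numeral_2_eq_2)
qed

text \<open>
  \<open>rel (i, j) c x y\<close> says that colour \<open>c\<close> may be used on the pattern arc between the roles
  \<open>i < j\<close> when these are played by \<open>x\<close> and \<open>y\<close>; its orientation is hidden in \<open>rel\<close>.
\<close>

definition rainbow_copy ::
  "nat \<Rightarrow> (nat \<times> nat \<Rightarrow> 'c \<Rightarrow> 'v \<Rightarrow> 'v \<Rightarrow> bool) \<Rightarrow> (nat \<Rightarrow> 'v) \<Rightarrow> (nat \<times> nat \<Rightarrow> 'c) \<Rightarrow> bool" where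
  "rainbow_copy k rel f g \<longleftrightarrow> inj_on f {..<k} \<and> inj_on g (pairs k) \<and>
     (\<forall>i j. (i, j) \<in> pairs k \<longrightarrow> rel (i, j) (g (i, j)) (f i) (f j))"

inductive tileable ::
  "nat \<Rightarrow> (nat \<times> nat \<Rightarrow> 'c \<Rightarrow> 'v \<Rightarrow> 'v \<Rightarrow> bool) \<Rightarrow> nat \<Rightarrow> 'v set \<Rightarrow> 'c set \<Rightarrow> bool"
  for k rel where
  empty: "tileable k rel 0 {} {}"
| add: "tileable k rel n X Y \<Longrightarrow> rainbow_copy k rel f g \<Longrightarrow>
    X \<inter> f ` {..<k} = {} \<Longrightarrow> Y \<inter> g ` pairs k = {} \<Longrightarrow>
    tileable k rel (Suc n) (X \<union> f ` {..<k}) (Y \<union> g ` pairs k)"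

section \<open>Combining and splitting tilings\<close>

lemma tileable_Un:
  assumes "tileable k rel n X Y" "tileable k rel n' X' Y'" "X \<inter> X' = {}" "Y \<inter> Y' = {}"
  shows "tileable k rel (n + n') (X \<union> X') (Y \<union> Y')"
  using assms
proof (induction arbitrary: rule: tileable.induct)
  case empty
  then show ?case by simp
next
  case (add n X Y f g)
  have "tileable k rel (Suc (n + n')) ((X \<union> X') \<union> f ` {..<k}) ((Y \<union> Y') \<union> g ` pairs k)"
  proof (rule tileable.add)
    show "tileable k rel (n + n') (X \<union> X') (Y \<union> Y')"
      using add.prems by (intro add.IH) auto
  qed (use add in auto)
  then show ?case by (simp add: ac_simps)
qed

lemma tileable_card:
  "tileable k rel n X Y \<Longrightarrow> finite X \<and> finite Y \<and> card X = k * n \<and> card Y = card (pairs k) * n"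
proof (induction rule: tileable.induct)
  case (add n X Y f g)
  then show ?case by (simp add: rainbow_copy_def card_Un_disjoint card_image)
qed auto

lemma tileable_family:
  assumes "finite J" "\<And>u. u \<in> J \<Longrightarrow> rainbow_copy k rel (F u) (G u)"
    and "inj_on (\<lambda>(u, i). F u i) (J \<times> {..<k})" "inj_on (\<lambda>(u, e). G u e) (J \<times> pairs k)"
  shows "tileable k rel (card J) (\<Union>u\<in>J. F u ` {..<k}) (\<Union>u\<in>J. G u ` pairs k)"
  using assms
proof (induction J rule: finite_induct)
  case empty
  then show ?case by (simp add: tileable.empty)
next
  case (insert n J)
  have "tileable k rel (card J) (\<Union>u\<in>J. F u ` {..<k}) (\<Union>u\<in>J. G u ` pairs k)"
    using insert.prems by (intro insert.IH) (auto intro: inj_on_subset)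
  then have "tileable k rel (Suc (card J)) ((\<Union>u\<in>J. F u ` {..<k}) \<union> F n ` {..<k})
      ((\<Union>u\<in>J. G u ` pairs k) \<union> G n ` pairs k)"
  proof (rule tileable.add)
    show "rainbow_copy k rel (F n) (G n)" using insert by auto
    have "F u i \<noteq> F n j" if "u \<in> J" "i < k" "j < k" for u i j
      using inj_onD[OF insert.prems(2), of "(u, i)" "(n, j)"] that insert.hyps(2) by auto
    then show "(\<Union>u\<in>J. F u ` {..<k}) \<inter> F n ` {..<k} = {}" by blast
    have "G u d \<noteq> G n e" if "u \<in> J" "d \<in> pairs k" "e \<in> pairs k" for u d e
      using inj_onD[OF insert.prems(3), of "(u, d)" "(n, e)"] that insert.hyps(2) by auto
    then show "(\<Union>u\<in>J. G u ` pairs k) \<inter> G n ` pairs k = {}" by blast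
  qed
  then show ?case using insert.hyps by (simp add: ac_simps)
qed

text \<open>Numbering the copies recovers the units: \<open>F u i\<close> is the vertex in role
  \<open>i\<close> of unit \<open>u\<close>. Injectivity in both arguments jointly encodes that
  copies are disjoint.\<close>

lemma tileable_decompose:
  assumes "tileable k rel n X Y"
  shows "\<exists>F G. (\<forall>u<n. rainbow_copy k rel (F u) (G u)) \<and>
    inj_on (\<lambda>(u, i). F u i) ({..<n} \<times> {..<k}) \<and> inj_on (\<lambda>(u, e). G u e) ({..<n} \<times> pairs k) \<and>
    X = (\<Union>u<n. F u ` {..<k}) \<and> Y = (\<Union>u<n. G u ` pairs k)"
  using assms
proof (induction rule: tileable.induct)
  case empty
  then show ?case by auto
next
  case (add n X Y f g)
  then obtain F G where FG: "\<forall>u<n. rainbow_copy k rel (F u) (G u)"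
    "inj_on (\<lambda>(u, i). F u i) ({..<n} \<times> {..<k})" "inj_on (\<lambda>(u, e). G u e) ({..<n} \<times> pairs k)"
    "X = (\<Union>u<n. F u ` {..<k})" "Y = (\<Union>u<n. G u ` pairs k)" by blast
  have *: "inj_on (\<lambda>(u, i). (H(n := h)) u i) ({..<Suc n} \<times> I)"
    if H: "inj_on (\<lambda>(u, i). H u i) ({..<n} \<times> I)" "inj_on h I" "(\<Union>u<n. H u ` I) \<inter> h ` I = {}"
    for H h I
  proof (rule inj_onI)
    fix p p' assume p: "p \<in> {..<Suc n} \<times> I" "p' \<in> {..<Suc n} \<times> I"
      "(\<lambda>(u, i). (H(n := h)) u i) p = (\<lambda>(u, i). (H(n := h)) u i) p'"
    obtain u i v j where uv: "p = (u, i)" "p' = (v, j)" by fastforce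
    with p have a: "u \<in> {..<Suc n}" "v \<in> {..<Suc n}" "i \<in> I" "j \<in> I"
      "(H(n := h)) u i = (H(n := h)) v j"
      by auto
    consider "u < n" "v < n" | "u = n" "v < n" | "u < n" "v = n" | "u = n" "v = n"
      using a by force
    then have "u = v \<and> i = j"
    proof cases
      case 1
      then show ?thesis using a inj_onD[OF H(1), of "(u, i)" "(v, j)"] by auto
    next
      case 2
      then show ?thesis using a H(3) by (auto simp: disjoint_iff image_iff split: if_splits)
    next
      case 3
      then show ?thesis using a H(3) by (auto simp: disjoint_iff image_iff split: if_splits)
    next
      case 4
      then show ?thesis using a inj_onD[OF H(2)] by auto
    qed
    then show "p = p'" using uv by simp
  qed
  have sp: "(\<Union>u<Suc n. (H(n := h)) u ` I) = (\<Union>u<n. H u ` I) \<union> h ` I" for H h and I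
    by (auto simp: less_Suc_eq lessThan_Suc)
  show ?case
  proof (intro exI[of _ "F(n := f)"] exI[of _ "G(n := g)"] conjI)
    show "\<forall>u<Suc n. rainbow_copy k rel ((F(n := f)) u) ((G(n := g)) u)"
      using FG add.hyps by (auto simp: less_Suc_eq)
    show "inj_on (\<lambda>(u, i). (F(n := f)) u i) ({..<Suc n} \<times> {..<k})"
      using add.hyps FG by (intro *) (auto simp: rainbow_copy_def)
    show "inj_on (\<lambda>(u, i). (G(n := g)) u i) ({..<Suc n} \<times> pairs k)"
      using add.hyps FG by (intro *) (auto simp: rainbow_copy_def)
  qed (simp_all only: FG(4,5) sp)
qed

section \<open>Tilings of a blow-up\<close>

lemma select_representatives:
  assumes "finite P" "\<psi> ` P \<subseteq> T"
    and fin: "\<And>t. t \<in> T \<Longrightarrow> finite (Z t)"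
    and disj: "\<And>t t'. t \<in> T \<Longrightarrow> t' \<in> T \<Longrightarrow> t \<noteq> t' \<Longrightarrow> Z t \<inter> Z t' = {}"
    and le: "\<And>t. t \<in> T \<Longrightarrow> card {p\<in>P. \<psi> p = t} \<le> card (Z t)"
  shows "\<exists>g. inj_on g P \<and> (\<forall>p\<in>P. g p \<in> Z (\<psi> p)) \<and>
    (\<forall>t\<in>T. card (Z t - g ` P) = card (Z t) - card {p\<in>P. \<psi> p = t})"
proof -
  have "\<forall>t\<in>T. \<exists>h. h ` {p\<in>P. \<psi> p = t} \<subseteq> Z t \<and> inj_on h {p\<in>P. \<psi> p = t}"
  proof
    fix t assume t: "t \<in> T"
    have "finite {p\<in>P. \<psi> p = t}" using assms(1) by simp
    from card_le_inj[OF this fin[OF t] le[OF t]]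
    show "\<exists>h. h ` {p\<in>P. \<psi> p = t} \<subseteq> Z t \<and> inj_on h {p\<in>P. \<psi> p = t}" .
  qed
  then obtain h where h: "\<And>t. t \<in> T \<Longrightarrow> h t ` {p\<in>P. \<psi> p = t} \<subseteq> Z t"
    "\<And>t. t \<in> T \<Longrightarrow> inj_on (h t) {p\<in>P. \<psi> p = t}" by metis
  define g where "g = (\<lambda>p. h (\<psi> p) p)"
  have mem: "g p \<in> Z (\<psi> p)" if "p \<in> P" for p
    using h(1)[of "\<psi> p"] assms(2) that by (auto simp: g_def)
  have inj: "inj_on g P"
  proof (rule inj_onI)
    fix p p' assume p: "p \<in> P" "p' \<in> P" "g p = g p'"
    have T: "\<psi> p \<in> T" "\<psi> p' \<in> T" using p assms(2) by auto
    have "\<psi> p = \<psi> p'"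
      using disj[OF T] mem[OF p(1)] mem[OF p(2)] p(3) by auto
    then show "p = p'"
      using p inj_onD[OF h(2)[OF T(1)], of p p'] by (auto simp: g_def)
  qed
  have "card (Z t - g ` P) = card (Z t) - card {p\<in>P. \<psi> p = t}" if t: "t \<in> T" for t
  proof -
    have "Z t - g ` P = Z t - g ` {p\<in>P. \<psi> p = t}"
      using mem disj[OF t] assms(2) by blast
    moreover have "g ` {p\<in>P. \<psi> p = t} \<subseteq> Z t" using mem by auto
    moreover have "card (g ` {p\<in>P. \<psi> p = t}) = card {p\<in>P. \<psi> p = t}"
      by (rule card_image) (rule inj_on_subset[OF inj], auto)
    ultimately show ?thesis using assms(1) by (simp add: card_Diff_subset)
  qed
  then show ?thesis using inj mem by blast
qed

text \<open>Classes are completely compatible along each listed copy, so any representatives will do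
  and only the numbers matter. If the list meets every class exactly as often as it has elements,
  removing one copy after another ends with empty classes. \<open>\<phi>\<close> and
  \<open>\<gamma>\<close> need not be injective: a class met several times supplies several
  representatives.\<close>

lemma realize_blowup:
  fixes ZV :: "'t \<Rightarrow> 'v set" and ZC :: "'s \<Rightarrow> 'c set"
  assumes "finite TV" "finite TC"
    and "\<And>t. t \<in> TV \<Longrightarrow> finite (ZV t)" "\<And>t. t \<in> TC \<Longrightarrow> finite (ZC t)"
    and "\<And>t t'. t \<in> TV \<Longrightarrow> t' \<in> TV \<Longrightarrow> t \<noteq> t' \<Longrightarrow> ZV t \<inter> ZV t' = {}"
    and "\<And>t t'. t \<in> TC \<Longrightarrow> t' \<in> TC \<Longrightarrow> t \<noteq> t' \<Longrightarrow> ZC t \<inter> ZC t' = {}"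
    and "\<And>\<phi> \<gamma>. (\<phi>, \<gamma>) \<in> set es \<Longrightarrow> \<phi> ` {..<k} \<subseteq> TV \<and> \<gamma> ` pairs k \<subseteq> TC \<and>
      (\<forall>i j. (i, j) \<in> pairs k \<longrightarrow>
        (\<forall>c\<in>ZC (\<gamma> (i, j)). \<forall>x\<in>ZV (\<phi> i). \<forall>y\<in>ZV (\<phi> j). rel (i, j) c x y))"
    and "\<And>t. t \<in> TV \<Longrightarrow> card (ZV t) = sum_list (map (\<lambda>(\<phi>, \<gamma>). card {i\<in>{..<k}. \<phi> i = t}) es)"
    and "\<And>t. t \<in> TC \<Longrightarrow> card (ZC t) = sum_list (map (\<lambda>(\<phi>, \<gamma>). card {e\<in>pairs k. \<gamma> e = t}) es)"
  shows "tileable k rel (length es) (\<Union>t\<in>TV. ZV t) (\<Union>t\<in>TC. ZC t)"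
  using assms(3-)
proof (induction es arbitrary: ZV ZC)
  case Nil
  then have "(\<Union>t\<in>TV. ZV t) = {}" "(\<Union>t\<in>TC. ZC t) = {}" by auto
  then show ?case by (metis list.size(3) tileable.empty)
next
  case (Cons e es)
  obtain \<phi> \<gamma> where e: "e = (\<phi>, \<gamma>)" by force
  have comp: "\<phi> ` {..<k} \<subseteq> TV" "\<gamma> ` pairs k \<subseteq> TC"
    "\<And>i j c x y. (i, j) \<in> pairs k \<Longrightarrow> c \<in> ZC (\<gamma> (i, j)) \<Longrightarrow> x \<in> ZV (\<phi> i) \<Longrightarrow> y \<in> ZV (\<phi> j) \<Longrightarrow> rel (i, j) c x y"
    using Cons.prems(5)[of \<phi> \<gamma>] by (auto simp: e)
  have "\<exists>f. inj_on f {..<k} \<and> (\<forall>p\<in>{..<k}. f p \<in> ZV (\<phi> p)) \<and>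
      (\<forall>t\<in>TV. card (ZV t - f ` {..<k}) = card (ZV t) - card {p\<in>{..<k}. \<phi> p = t})"
    using comp Cons.prems by (intro select_representatives) (auto simp: e)
  then obtain f where f: "inj_on f {..<k}" "\<And>p. p < k \<Longrightarrow> f p \<in> ZV (\<phi> p)"
    "\<And>t. t \<in> TV \<Longrightarrow> card (ZV t - f ` {..<k}) = card (ZV t) - card {p\<in>{..<k}. \<phi> p = t}" by auto
  have "\<exists>g. inj_on g (pairs k) \<and> (\<forall>p\<in>pairs k. g p \<in> ZC (\<gamma> p)) \<and>
      (\<forall>t\<in>TC. card (ZC t - g ` pairs k) = card (ZC t) - card {p\<in>pairs k. \<gamma> p = t})"
    using comp Cons.prems by (intro select_representatives) (auto simp: e)
  then obtain g where g: "inj_on g (pairs k)" "\<And>p. p \<in> pairs k \<Longrightarrow> g p \<in> ZC (\<gamma> p)"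
    "\<And>t. t \<in> TC \<Longrightarrow> card (ZC t - g ` pairs k) = card (ZC t) - card {p\<in>pairs k. \<gamma> p = t}" by auto
  have "tileable k rel (length es) (\<Union>t\<in>TV. ZV t - f ` {..<k}) (\<Union>t\<in>TC. ZC t - g ` pairs k)"
  proof (rule Cons.IH)
    fix \<phi>' \<gamma>' assume "(\<phi>', \<gamma>') \<in> set es"
    then show "\<phi>' ` {..<k} \<subseteq> TV \<and> \<gamma>' ` pairs k \<subseteq> TC \<and>
      (\<forall>i j. (i, j) \<in> pairs k \<longrightarrow> (\<forall>c\<in>ZC (\<gamma>' (i, j)) - g ` pairs k.
         \<forall>x\<in>ZV (\<phi>' i) - f ` {..<k}. \<forall>y\<in>ZV (\<phi>' j) - f ` {..<k}. rel (i, j) c x y))"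
      using Cons.prems(5)[of \<phi>' \<gamma>'] by auto
  next
    fix t t' assume "t \<in> TV" "t' \<in> TV" "t \<noteq> t'"
    then show "(ZV t - f ` {..<k}) \<inter> (ZV t' - f ` {..<k}) = {}" using Cons.prems(3)[of t t'] by auto
  next
    fix t t' assume "t \<in> TC" "t' \<in> TC" "t \<noteq> t'"
    then show "(ZC t - g ` pairs k) \<inter> (ZC t' - g ` pairs k) = {}" using Cons.prems(4)[of t t'] by auto
  next
    fix t assume t: "t \<in> TV"
    show "card (ZV t - f ` {..<k}) = (\<Sum>(\<phi>, \<gamma>)\<leftarrow>es. card {i\<in>{..<k}. \<phi> i = t})"
      using Cons.prems(6)[OF t] f(3)[OF t] by (simp add: e)
  next
    fix t assume t: "t \<in> TC"
    show "card (ZC t - g ` pairs k) = (\<Sum>(\<phi>, \<gamma>)\<leftarrow>es. card {e\<in>pairs k. \<gamma> e = t})"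
      using Cons.prems(7)[OF t] g(3)[OF t] by (simp add: e)
  next
    fix t assume "t \<in> TV"
    then show "finite (ZV t - f ` {..<k})" by (intro finite_Diff Cons.prems(1))
  next
    fix t assume "t \<in> TC"
    then show "finite (ZC t - g ` pairs k)" by (intro finite_Diff Cons.prems(2))
  qed
  then have T: "tileable k rel (Suc (length es)) ((\<Union>t\<in>TV. ZV t - f ` {..<k}) \<union> f ` {..<k})
      ((\<Union>t\<in>TC. ZC t - g ` pairs k) \<union> g ` pairs k)"
  proof (rule tileable.add)
    show "rainbow_copy k rel f g"
      using f g comp(3) unfolding rainbow_copy_def pairs_def by auto
  qed auto
  have sub: "f ` {..<k} \<subseteq> (\<Union>t\<in>TV. ZV t)" "g ` pairs k \<subseteq> (\<Union>t\<in>TC. ZC t)"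
    using f(2) comp(1) g(2) comp(2) by fast+
  from sub have eq: "(\<Union>t\<in>TV. ZV t - f ` {..<k}) \<union> f ` {..<k} = (\<Union>t\<in>TV. ZV t)"
    "(\<Union>t\<in>TC. ZC t - g ` pairs k) \<union> g ` pairs k = (\<Union>t\<in>TC. ZC t)"
    by fast+
  show ?case using T by (simp only: eq length_Cons)
qed

section \<open>Fractional tilings of the reduced structure\<close>

text \<open>The principle behind all greedy choices: \<open>Q j\<close> reads only the values up to
  position \<open>j\<close>, so later choices cannot destroy it.\<close>

lemma sequential_choice:
  fixes Q :: "nat \<Rightarrow> (nat \<Rightarrow> 'x) \<Rightarrow> bool"
  assumes step: "\<And>j v. j < k \<Longrightarrow> \<forall>i<j. Q i v \<Longrightarrow> \<exists>x. Q j (v(j := x))"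
    and local: "\<And>j v w. \<forall>i\<le>j. v i = w i \<Longrightarrow> Q j v \<Longrightarrow> Q j w"
  shows "\<exists>v. \<forall>j<k. Q j v"
  using step
proof (induction k)
  case 0
  then show ?case by simp
next
  case (Suc k)
  then obtain v where v: "\<forall>j<k. Q j v" by (metis less_SucI)
  with Suc.prems obtain x where x: "Q k (v(k := x))" by blast
  have "Q j (v(k := x))" if "j < k" for j
    using local[of j v "v(k := x)"] v that by auto
  with x show ?case by (intro exI[of _ "v(k := x)"]) (auto simp: less_Suc_eq simp del: fun_upd_apply)
qed

text \<open>
  The mass above the level \<open>a j\<close> is at most \<open>j * \<beta>\<close>; hence \<open>a j\<close> bounds the average of the
  \<open>j\<close>-th of \<open>k\<close> consecutive blocks of mass \<open>\<beta>\<close> in the decreasing rearrangement of \<open>y\<close>.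
\<close>

lemma weighted_sum_le_levels:
  fixes a :: "nat \<Rightarrow> 'q::linordered_field"
  assumes X: "finite X" and b: "\<And>x. x \<in> X \<Longrightarrow> 0 \<le> b x"
    and tot: "(\<Sum>x\<in>X. b x) = of_nat k * \<beta>" and "k > 0"
    and mass: "\<And>j. j < k \<Longrightarrow> (\<Sum>x\<in>{x\<in>X. a j < y x}. b x) \<le> of_nat j * \<beta>"
  shows "(\<Sum>x\<in>X. b x * y x) \<le> \<beta> * (\<Sum>j<k. a j)"
proof -
  obtain K where K: "k = Suc K" using \<open>k > 0\<close> gr0_implies_Suc by blast
  \<comment> \<open>Running minima make the levels decreasing. The mass bound survives, because
    \<open>a' j\<close> is some \<open>a i\<close> with \<open>i \<le> j\<close>.\<close>
  define a' where "a' = (\<lambda>j. Min (a ` {..j}))"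
  have a'_le: "a' j \<le> a j" for j by (simp add: a'_def)
  have a'_mono: "a' (Suc j) \<le> a' j" for j unfolding a'_def by (intro Min_antimono) auto
  have "0 \<le> of_nat k * \<beta>" using tot b by (metis sum_nonneg)
  then have \<beta>: "0 \<le> \<beta>" using \<open>k > 0\<close> by (simp add: zero_le_mult_iff)
  define m where "m = (\<lambda>j. \<Sum>x\<in>{x\<in>X. a' j < y x}. b x)"
  have mass': "m j \<le> of_nat j * \<beta>" if "j < k" for j
  proof -
    have "a' j \<in> a ` {..j}" unfolding a'_def by (intro Min_in) auto
    then obtain i where i: "i \<le> j" "a' j = a i" by auto
    then have "m j \<le> of_nat i * \<beta>" using mass[of i] that by (simp add: m_def)
    also have "\<dots> \<le> of_nat j * \<beta>" using i \<beta> by (intro mult_right_mono) auto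
    finally show ?thesis .
  qed
  \<comment> \<open>A staircase above \<open>t\<close>: start at the lowest level and climb every
    step whose lower edge is below \<open>t\<close>. After summation against \<open>b\<close>, a
    step costs its height times the mass above its lower edge.\<close>
  have point: "t \<le> a' n + (\<Sum>j<n. (a' j - a' (Suc j)) * (if a' (Suc j) < t then 1 else 0))"
    if "t \<le> a' 0" for t n
  proof (induction n)
    case 0
    then show ?case using that by simp
  next
    case (Suc n)
    have nn: "0 \<le> (\<Sum>j<n. (a' j - a' (Suc j)) * (if a' (Suc j) < t then 1 else 0))"
      using a'_mono by (intro sum_nonneg) auto
    show ?case
    proof (cases "a' (Suc n) < t")
      case True
      then show ?thesis using Suc by (simp add: algebra_simps)
    next
      case False
      then show ?thesis using nn by (simp add: add_increasing2)
    qed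
  qed
  \<comment> \<open>The bound for \<open>j = 0\<close> is zero, so no mass lies above the top level
    and the staircase need not go higher.\<close>
  have b0: "b x = 0" if "x \<in> X" "\<not> y x \<le> a' 0" for x
  proof -
    have "m 0 \<le> 0" using mass'[of 0] \<open>k > 0\<close> by simp
    moreover have "b x \<le> m 0" unfolding m_def using that X b
      by (intro member_le_sum) auto
    ultimately show ?thesis using b[OF that(1)] by simp
  qed
  have "(\<Sum>x\<in>X. b x * y x) \<le>
      (\<Sum>x\<in>X. b x * (a' K + (\<Sum>j<K. (a' j - a' (Suc j)) * (if a' (Suc j) < y x then 1 else 0))))"
  proof (intro sum_mono)
    fix x assume x: "x \<in> X"
    show "b x * y x \<le> b x * (a' K + (\<Sum>j<K. (a' j - a' (Suc j)) * (if a' (Suc j) < y x then 1 else 0)))"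
    proof (cases "y x \<le> a' 0")
      case True
      then show ?thesis using point[OF True, of K] b[OF x] by (intro mult_left_mono)
    next
      case False
      then show ?thesis using b0[OF x] by simp
    qed
  qed
  also have "\<dots> = a' K * (\<Sum>x\<in>X. b x) + (\<Sum>j<K. (a' j - a' (Suc j)) * m (Suc j))"
  proof -
    have "m (Suc j) = (\<Sum>x\<in>X. b x * (if a' (Suc j) < y x then 1 else 0))" for j
      unfolding m_def using X by (simp add: sum.inter_filter if_distrib cong: if_cong)
    then have "(\<Sum>j<K. (a' j - a' (Suc j)) * m (Suc j)) =
        (\<Sum>j<K. \<Sum>x\<in>X. b x * ((a' j - a' (Suc j)) * (if a' (Suc j) < y x then 1 else 0)))"
      by (simp add: sum_distrib_left mult_ac)
    also have "\<dots> = (\<Sum>x\<in>X. \<Sum>j<K. b x * ((a' j - a' (Suc j)) * (if a' (Suc j) < y x then 1 else 0)))"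
      by (rule sum.swap)
    finally show ?thesis
      by (simp only: distrib_left sum.distrib sum_distrib_left) (simp add: mult.commute)
  qed
  also have "\<dots> \<le> a' K * (of_nat (Suc K) * \<beta>) + (\<Sum>j<K. (a' j - a' (Suc j)) * (of_nat (Suc j) * \<beta>))"
    using mass' a'_mono unfolding tot unfolding K
    by (intro add_left_mono sum_mono mult_left_mono) (auto simp del: of_nat_Suc)
  also have "\<dots> = \<beta> * (\<Sum>j<Suc K. a' j)"
  proof -
    have "a' n * (of_nat (Suc n) * \<beta>) + (\<Sum>j<n. (a' j - a' (Suc j)) * (of_nat (Suc j) * \<beta>)) = \<beta> * (\<Sum>j<Suc n. a' j)" for n
      by (induction n) (auto simp: algebra_simps)
    then show ?thesis by blast
  qed
  also have "\<dots> \<le> \<beta> * (\<Sum>j<k. a j)"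
    unfolding K using \<beta> a'_le by (intro mult_left_mono sum_mono) auto
  finally show ?thesis .
qed

lemma finite_arg_max:
  fixes f :: "'x \<Rightarrow> 'o::linorder"
  assumes "finite A" "A \<noteq> {}"
  obtains x where "x \<in> A" "\<And>z. z \<in> A \<Longrightarrow> f z \<le> f x"
proof -
  have "Max (f ` A) \<in> f ` A" using assms by (intro Max_in) auto
  then obtain x where "x \<in> A" "Max (f ` A) = f x" by auto
  then show ?thesis using assms that[of x] by (metis Max_ge finite_imageI imageI)
qed

lemma sum_mult_card_fibers:
  fixes y :: "'x \<Rightarrow> 'q::comm_semiring_1"
  assumes "finite P" "finite X" "\<phi> ` P \<subseteq> X"
  shows "(\<Sum>x\<in>X. y x * of_nat (card {i\<in>P. \<phi> i = x})) = (\<Sum>i\<in>P. y (\<phi> i))"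
proof -
  have "(\<Sum>i\<in>P. y (\<phi> i)) = (\<Sum>x\<in>X. \<Sum>i\<in>{i\<in>P. \<phi> i = x}. y (\<phi> i))"
    using assms by (intro sum.group[symmetric])
  also have "\<dots> = (\<Sum>x\<in>X. y x * of_nat (card {i\<in>P. \<phi> i = x}))"
    by (intro sum.cong refl) (simp add: mult.commute)
  finally show ?thesis by simp
qed

text \<open>
  Vertices and colours of the reduced structure are labelled by the unit they come from: units
  \<open>0, \<dots>, 2 * s - 1\<close> are blown up, unit \<open>2 * s\<close> is kept once. The former are split into two
  halves; copies placed on the vertices of one half take colours from the other, which keeps all
  three units met by a coloured arc distinct.
\<close>

definition half :: "nat \<Rightarrow> bool \<Rightarrow> nat set" where
  "half s h = (if h then {s..<2 * s} else {..<s})"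

text \<open>In \<open>dense\<close>, the slack \<open>k\<close> pays for excluding also the vertices
  in the unit of \<open>x\<close>, and the slack 1 makes the bound strict: a forbidden set has at
  most \<open>s - 1\<close> of the \<open>s * k\<close> vertices of a half. The extra unit is
  allowed for \<open>c\<close> and \<open>x\<close>, whereas \<open>y\<close> ranges only over units
  that are blown up.\<close>

locale reduced_structure =
  fixes k s :: nat and \<tau> :: "nat \<times> nat \<Rightarrow> nat \<times> (nat \<times> nat) \<Rightarrow> nat \<times> nat \<Rightarrow> nat \<times> nat \<Rightarrow> bool"
  assumes k2: "2 \<le> k"
    and dense: "\<And>e c x h. e \<in> pairs k \<Longrightarrow> c \<in> {..2 * s} \<times> pairs k \<Longrightarrow> x \<in> {..2 * s} \<times> {..<k} \<Longrightarrow>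
      card {y\<in>half s h \<times> {..<k}. \<not> \<tau> e c x y} + k + 1 \<le> s"
begin

section \<open>Greedy embedding inside one half\<close>

definition VT where "VT h = half s h \<times> {..<k}"
definition CT where "CT h = half s (\<not> h) \<times> pairs k"
definition ok where "ok e c x y \<longleftrightarrow> \<tau> e c x y \<and> fst x \<noteq> fst y"
definition forb where "forb h e c x = {y\<in>VT h. \<not> ok e c x y}"

lemma finite_VT [simp]: "finite (VT h)" and finite_CT [simp]: "finite (CT h)"
  by (auto simp: VT_def CT_def half_def)

lemma VT_sub: "VT h \<subseteq> {..<2 * s} \<times> {..<k}" and CT_sub: "CT h \<subseteq> {..<2 * s} \<times> pairs k"
  by (auto simp: VT_def CT_def half_def)

lemma card_VT: "card (VT h) = s * k" and card_CT: "card (CT h) = s * card (pairs k)"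
  by (auto simp: VT_def CT_def half_def)

lemma VT_Un: "VT False \<union> VT True = {..<2 * s} \<times> {..<k}" and VT_Int: "VT False \<inter> VT True = {}"
  and CT_Un: "CT False \<union> CT True = {..<2 * s} \<times> pairs k" and CT_Int: "CT False \<inter> CT True = {}"
  by (auto simp: VT_def CT_def half_def)

lemma pair01: "(0, 1) \<in> pairs k" using k2 by (auto simp: pairs_def)

lemma card_forb:
  assumes "e \<in> pairs k" "c \<in> {..2 * s} \<times> pairs k" "x \<in> {..2 * s} \<times> {..<k}"
  shows "card (forb h e c x) + 1 \<le> s"
proof -
  have "forb h e c x \<subseteq> {y\<in>half s h \<times> {..<k}. \<not> \<tau> e c x y} \<union> {fst x} \<times> {..<k}"
    by (auto simp: forb_def ok_def VT_def)
  then have "card (forb h e c x) \<le> card ({y\<in>half s h \<times> {..<k}. \<not> \<tau> e c x y} \<union> {fst x} \<times> {..<k})"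
    by (intro card_mono) (auto simp: half_def)
  also have "\<dots> \<le> card {y\<in>half s h \<times> {..<k}. \<not> \<tau> e c x y} + card ({fst x} \<times> {..<k})"
    by (rule card_Un_le)
  finally show ?thesis using dense[OF assms, of h] by (simp add: card_cartesian_product)
qed

lemma s_pos: "0 < s"
proof -
  have "card (forb False (0, 1) (0, (0, 1)) (0, 0)) + 1 \<le> s"
    using pair01 k2 by (intro card_forb) auto
  then show ?thesis by linarith
qed

lemma card_UN_forb_le:
  assumes "c \<in> {..2 * s} \<times> pairs k" "j < k" "\<And>i. i < j \<Longrightarrow> v i \<in> VT h"
  shows "card (\<Union>i<j. forb h (i, j) c (v i)) \<le> j * (s - 1)"
proof -
  have "card (\<Union>i<j. forb h (i, j) c (v i)) \<le> (\<Sum>i<j. card (forb h (i, j) c (v i)))"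
    by (intro card_UN_le) auto
  also have "\<dots> \<le> (\<Sum>i<j. s - 1)"
  proof (intro sum_mono)
    fix i assume i: "i \<in> {..<j}"
    then have "v i \<in> {..2 * s} \<times> {..<k}" using assms(3)[of i] VT_sub[of h] by fastforce
    moreover have "(i, j) \<in> pairs k" using i assms(2) by (auto simp: pairs_def)
    ultimately show "card (forb h (i, j) c (v i)) \<le> s - 1"
      using card_forb[of "(i, j)" c "v i" h] assms(1) by force
  qed
  finally show ?thesis by simp
qed

text \<open>Even at the last step there are at most \<open>k - 1\<close> earlier vertices, and
  \<open>k\<close> sets of size \<open>s - 1\<close> do not cover the \<open>s * k\<close> vertices.
  This leaves room for one further set \<open>extra j\<close>, which the exchanges spend on
  compatibility with a second vertex or a second colour.\<close>

lemma embed_pattern: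
  assumes c: "c \<in> CT h" and x0: "x0 \<in> VT h"
    and extra: "\<forall>j<k. card (extra j) + 1 \<le> s \<and> finite (extra j)"
  shows "\<exists>v. v 0 = x0 \<and> (\<forall>i<k. v i \<in> VT h) \<and> (\<forall>i j. (i, j) \<in> pairs k \<longrightarrow> ok (i, j) c (v i) (v j)) \<and>
    (\<forall>j. 0 < j \<longrightarrow> j < k \<longrightarrow> v j \<notin> extra j)"
proof -
  define Q where "Q = (\<lambda>j v. v j \<in> VT h \<and> (if j = 0 then v 0 = x0 else v j \<notin> extra j) \<and>
    (\<forall>i<j. v j \<notin> forb h (i, j) c (v i)))"
  have c': "c \<in> {..2 * s} \<times> pairs k" using c CT_sub[of h] by fastforce
  have "\<exists>v. \<forall>j<k. Q j v"
  proof (rule sequential_choice)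
    fix j v assume j: "j < k" "\<forall>i<j. Q i v"
    show "\<exists>x. Q j (v(j := x))"
    proof (cases "j = 0")
      case True
      then show ?thesis using x0 by (intro exI[of _ x0]) (auto simp: Q_def)
    next
      case False
      let ?F = "(\<Union>i<j. forb h (i, j) c (v i)) \<union> extra j"
      have "card ?F \<le> card (\<Union>i<j. forb h (i, j) c (v i)) + card (extra j)" by (rule card_Un_le)
      also have "\<dots> \<le> j * (s - 1) + (s - 1)"
        using card_UN_forb_le[OF c' j(1), of v h] j extra[rule_format, OF j(1)] by (intro add_mono) (auto simp: Q_def)
      also have "\<dots> = Suc j * (s - 1)" by simp
      also have "\<dots> \<le> k * (s - 1)" using j by (intro mult_right_mono) auto
      also have "\<dots> < card (VT h)" using s_pos k2 by (simp add: card_VT mult.commute)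
      finally have "card ?F < card (VT h)" .
      moreover have "finite ?F" using extra[rule_format, OF j(1)] by (auto simp: forb_def)
      ultimately have "\<not> VT h \<subseteq> ?F" by (metis card_mono not_less)
      then obtain x where "x \<in> VT h" "x \<notin> ?F" by blast
      then show ?thesis using False by (intro exI[of _ x]) (auto simp: Q_def)
    qed
  next
    fix j and v w :: "nat \<Rightarrow> nat \<times> nat" assume "\<forall>i\<le>j. v i = w i" "Q j v"
    then show "Q j w" by (auto simp: Q_def)
  qed
  then obtain v where v: "\<And>j. j < k \<Longrightarrow> Q j v" by blast
  have "ok (i, j) c (v i) (v j)" if "(i, j) \<in> pairs k" for i j
    using v[of j] that by (auto simp: Q_def forb_def pairs_def)
  moreover have "v 0 = x0" using v[of 0] k2 by (auto simp: Q_def)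
  moreover have "v j \<notin> extra j" if "0 < j" "j < k" for j using v[of j] that by (auto simp: Q_def)
  moreover have "\<forall>i<k. v i \<in> VT h" using v by (auto simp: Q_def)
  ultimately show ?thesis by blast
qed

text \<open>A candidate copy takes all its colours from one class \<open>c\<close>, which is
  therefore charged \<open>card (pairs k)\<close> times; in the blow-up the class provides distinct
  colours. Extensional functions keep the set finite.\<close>

definition edges where
  "edges h = {(\<phi>, c). \<phi> \<in> {..<k} \<rightarrow>\<^sub>E VT h \<and> c \<in> CT h \<and>
     (\<forall>i j. (i, j) \<in> pairs k \<longrightarrow> ok (i, j) c (\<phi> i) (\<phi> j))}"

lemma finite_edges [simp]: "finite (edges h)"
proof -
  have "edges h \<subseteq> ({..<k} \<rightarrow>\<^sub>E VT h) \<times> CT h" by (auto simp: edges_def)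
  then show ?thesis by (rule finite_subset) (intro finite_cartesian_product finite_PiE, auto)
qed

text \<open>This is the dual condition for Farkas' lemma. The demands \<open>bV\<close> and
  \<open>bC\<close> are not assumed constant, because one copy will be subtracted from them. It
  suffices that the demand of a forbidden set, at most \<open>M\<close> times \<open>s - 1\<close>,
  does not exceed the mass \<open>\<beta>\<close> of one block.\<close>

lemma heavy_edge:
  fixes bV yV :: "nat \<times> nat \<Rightarrow> 'q::linordered_field" and bC yC :: "nat \<times> (nat \<times> nat) \<Rightarrow> 'q"
  assumes bV: "\<And>x. x \<in> VT h \<Longrightarrow> 0 \<le> bV x \<and> bV x \<le> M" and bC: "\<And>c. c \<in> CT h \<Longrightarrow> 0 \<le> bC c"
    and sV: "(\<Sum>x\<in>VT h. bV x) = of_nat k * \<beta>"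
    and sC: "(\<Sum>c\<in>CT h. bC c) = of_nat (card (pairs k)) * \<beta>"
    and M: "M * of_nat (s - 1) \<le> \<beta>" "0 < \<beta>"
    and pos: "0 < (\<Sum>x\<in>VT h. bV x * yV x) + (\<Sum>c\<in>CT h. bC c * yC c)"
  shows "\<exists>(\<phi>, c)\<in>edges h. 0 < (\<Sum>i<k. yV (\<phi> i)) + of_nat (card (pairs k)) * yC c"
proof -
  have VTne: "VT h \<noteq> {}" using card_VT[of h] s_pos k2 by auto
  then have "0 \<le> M" using bV by fastforce
  have "card (pairs k) \<noteq> 0" using pair01 by auto
  then have "CT h \<noteq> {}" using card_CT[of h] s_pos by auto
  then obtain c where c: "c \<in> CT h" "\<And>d. d \<in> CT h \<Longrightarrow> yC d \<le> yC c"
    using finite_arg_max[of "CT h" yC] by auto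
  have c': "c \<in> {..2 * s} \<times> pairs k" using c CT_sub[of h] by fastforce
  have sumC: "(\<Sum>d\<in>CT h. bC d * yC d) \<le> \<beta> * (of_nat (card (pairs k)) * yC c)"
  proof -
    have "(\<Sum>d\<in>CT h. bC d * yC d) \<le> (\<Sum>d\<in>CT h. bC d * yC c)"
      using c bC by (intro sum_mono mult_left_mono) auto
    also have "\<dots> = \<beta> * (of_nat (card (pairs k)) * yC c)"
      by (simp add: sum_distrib_right[symmetric] sC ac_simps)
    finally show ?thesis .
  qed
  define A where "A = (\<lambda>j v. VT h - (\<Union>i<j. forb h (i, j) c (v i)))"
  define Q where "Q = (\<lambda>j v. v j \<in> A j v \<and> (\<forall>x\<in>A j v. yV x \<le> yV (v j)))"
  have A_cong: "A j v = A j w" if "\<forall>i<j. v i = w i" for j v w using that by (auto simp: A_def)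
  have "\<exists>v. \<forall>j<k. Q j v"
  proof (rule sequential_choice)
    fix j v assume j: "j < k" "\<forall>i<j. Q i v"
    have "card (\<Union>i<j. forb h (i, j) c (v i)) \<le> j * (s - 1)"
      using j by (intro card_UN_forb_le[OF c' j(1)]) (auto simp: Q_def A_def)
    also have "\<dots> \<le> k * (s - 1)" using j by (intro mult_right_mono) auto
    also have "\<dots> < card (VT h)" using s_pos k2 by (simp add: card_VT mult.commute)
    finally have "card (\<Union>i<j. forb h (i, j) c (v i)) < card (VT h)" .
    moreover have "finite (\<Union>i<j. forb h (i, j) c (v i))" by (auto simp: forb_def)
    ultimately have "\<not> VT h \<subseteq> (\<Union>i<j. forb h (i, j) c (v i))" by (metis card_mono not_less)
    then have "A j v \<noteq> {}" by (auto simp: A_def)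
    moreover have "finite (A j v)" by (auto simp: A_def)
    ultimately obtain x where x: "x \<in> A j v" "\<forall>z\<in>A j v. yV z \<le> yV x"
      by (metis finite_arg_max)
    have "A j (v(j := x)) = A j v" by (intro A_cong) auto
    then show "\<exists>x. Q j (v(j := x))" using x by (intro exI[of _ x]) (simp add: Q_def)
  next
    fix j and v w :: "nat \<Rightarrow> nat \<times> nat" assume a: "\<forall>i\<le>j. v i = w i" "Q j v"
    then have "A j v = A j w" by (intro A_cong) auto
    then show "Q j w" using a by (auto simp: Q_def)
  qed
  then obtain v where v: "\<And>j. j < k \<Longrightarrow> Q j v" by blast
  have vV: "v j \<in> VT h" if "j < k" for j using v[OF that] by (auto simp: Q_def A_def)
  have sumV: "(\<Sum>x\<in>VT h. bV x * yV x) \<le> \<beta> * (\<Sum>j<k. yV (v j))"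
  proof (rule weighted_sum_le_levels)
    fix j assume j: "j < k"
    \<comment> \<open>\<open>v j\<close> is the heaviest admissible vertex, so every heavier one
      lies in one of the \<open>j\<close> forbidden sets.\<close>
    have sub: "{x\<in>VT h. yV (v j) < yV x} \<subseteq> (\<Union>i<j. forb h (i, j) c (v i))"
      using v[OF j] by (auto simp: Q_def A_def not_less[symmetric])
    have "(\<Sum>x\<in>{x\<in>VT h. yV (v j) < yV x}. bV x) \<le> of_nat (card {x\<in>VT h. yV (v j) < yV x}) * M"
      using bV by (intro sum_bounded_above) auto
    also have "\<dots> \<le> of_nat (j * (s - 1)) * M"
    proof (intro mult_right_mono)
      have "card {x\<in>VT h. yV (v j) < yV x} \<le> card (\<Union>i<j. forb h (i, j) c (v i))"
        using sub by (intro card_mono) (auto simp: forb_def)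
      also have "\<dots> \<le> j * (s - 1)"
        using j vV by (intro card_UN_forb_le[OF c' j]) auto
      finally show "of_nat (card {x\<in>VT h. yV (v j) < yV x}) \<le> (of_nat (j * (s - 1)) :: 'q)"
        by (simp only: of_nat_le_iff)
    qed fact
    also have "\<dots> = of_nat j * (M * of_nat (s - 1))" by (simp add: ac_simps)
    also have "\<dots> \<le> of_nat j * \<beta>" using M by (intro mult_left_mono) auto
    finally show "(\<Sum>x\<in>{x\<in>VT h. yV (v j) < yV x}. bV x) \<le> of_nat j * \<beta>" .
  qed (use bV sV k2 in auto)
  define \<phi> where "\<phi> = restrict v {..<k}"
  have "ok (i, j) c (\<phi> i) (\<phi> j)" if "(i, j) \<in> pairs k" for i j
  proof -
    have "j < k" "i < j" using that by (auto simp: pairs_def)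
    then show ?thesis using v[of j] by (auto simp: \<phi>_def Q_def A_def forb_def)
  qed
  then have "(\<phi>, c) \<in> edges h" using c vV by (auto simp: edges_def \<phi>_def)
  moreover have "0 < \<beta> * ((\<Sum>i<k. yV (\<phi> i)) + of_nat (card (pairs k)) * yC c)"
    using pos sumV sumC by (simp add: \<phi>_def distrib_left)
  then have "0 < (\<Sum>i<k. yV (\<phi> i)) + of_nat (card (pairs k)) * yC c"
    using M(2) by (simp add: zero_less_mult_iff)
  ultimately show ?thesis by blast
qed

section \<open>Integral tilings that use every class equally often\<close>

definition nV :: "(nat \<Rightarrow> nat \<times> nat) \<Rightarrow> nat \<times> nat \<Rightarrow> nat" where
  "nV \<phi> x = card {i\<in>{..<k}. \<phi> i = x}"

definition nC :: "(nat \<times> nat \<Rightarrow> nat \<times> (nat \<times> nat)) \<Rightarrow> nat \<times> (nat \<times> nat) \<Rightarrow> nat" where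
  "nC \<gamma> d = card {e\<in>pairs k. \<gamma> e = d}"

lemma nC_const: "nC (\<lambda>_. c) d = (if d = c then card (pairs k) else 0)"
  by (auto simp: nC_def)

text \<open>Farkas' lemma is applied to a constant demand minus the copy
  \<open>(\<phi>0, c0)\<close>. This forces the copy to occur in the tiling, from which it can later
  be withdrawn in favour of an altered one. Listing it apart from \<open>L\<close> avoids
  subtraction.\<close>

lemma uniform_tiling_with_edge:
  assumes e0: "(\<phi>0, c0) \<in> edges False"
  shows "\<exists>q L. 0 < q \<and> set L \<subseteq> edges False \<union> edges True \<and>
    (\<forall>x\<in>{..<2 * s} \<times> {..<k}. nV \<phi>0 x + sum_list (map (\<lambda>(\<phi>, c). nV \<phi> x) L) = q) \<and>
    (\<forall>d\<in>{..<2 * s} \<times> pairs k. nC (\<lambda>_. c0) d + sum_list (map (\<lambda>(\<phi>, c). nC (\<lambda>_. c) d) L) = q)"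
proof -
  let ?V = "{..<2 * s} \<times> {..<k}" and ?C = "{..<2 * s} \<times> pairs k"
  define H where "H = card (pairs k)"
  \<comment> \<open>One copy meets a vertex class at most \<open>k\<close> times and a colour class
    at most \<open>H\<close> times, so the demand \<open>b\<close> stays nonnegative.\<close>
  define M where "M = H + k"
  define E where "E = edges False \<union> edges True"
  define Z where "Z = (Inl ` ?V \<union> Inr ` ?C :: (nat \<times> nat + nat \<times> (nat \<times> nat)) set)"
  define a :: "(nat \<Rightarrow> nat \<times> nat) \<times> (nat \<times> (nat \<times> nat)) \<Rightarrow> _ \<Rightarrow> nat"
    where "a = (\<lambda>(\<phi>, c) z. case z of Inl x \<Rightarrow> nV \<phi> x | Inr d \<Rightarrow> nC (\<lambda>_. c) d)"
  let ?a = "\<lambda>e z. rat_of_nat (a e z)"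
  define b where "b = (\<lambda>z. rat_of_nat M - ?a (\<phi>0, c0) z)"
  have finE: "finite E" and finZ: "finite Z" by (auto simp: E_def Z_def)
  have split_sum: "(\<Sum>z\<in>Z. f z) = (\<Sum>x\<in>VT False. f (Inl x)) + (\<Sum>c\<in>CT False. f (Inr c))
     + (\<Sum>x\<in>VT True. f (Inl x)) + (\<Sum>c\<in>CT True. f (Inr c))" for f :: "_ \<Rightarrow> rat"
  proof -
    have "(\<Sum>z\<in>Z. f z) = (\<Sum>z\<in>Inl ` ?V. f z) + (\<Sum>z\<in>Inr ` ?C. f z)"
      unfolding Z_def by (intro sum.union_disjoint) auto
    also have "(\<Sum>z\<in>Inl ` ?V. f z) = (\<Sum>x\<in>?V. f (Inl x))" by (simp add: sum.reindex)
    also have "\<dots> = (\<Sum>x\<in>VT False. f (Inl x)) + (\<Sum>x\<in>VT True. f (Inl x))"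
      unfolding VT_Un[symmetric] by (intro sum.union_disjoint) (auto simp: VT_Int)
    also have "(\<Sum>z\<in>Inr ` ?C. f z) = (\<Sum>x\<in>?C. f (Inr x))" by (simp add: sum.reindex)
    also have "\<dots> = (\<Sum>x\<in>CT False. f (Inr x)) + (\<Sum>x\<in>CT True. f (Inr x))"
      unfolding CT_Un[symmetric] by (intro sum.union_disjoint) (auto simp: CT_Int)
    finally show ?thesis by simp
  qed
  have edge_sum: "(\<Sum>z\<in>Z. y z * ?a (\<phi>, c) z) = (\<Sum>i<k. y (Inl (\<phi> i))) + of_nat H * y (Inr c)"
    if e: "(\<phi>, c) \<in> E" for \<phi> c and y :: "_ \<Rightarrow> rat"
  proof -
    have sub: "\<phi> ` {..<k} \<subseteq> ?V" "c \<in> ?C"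
      using e VT_sub CT_sub by (fastforce simp: E_def edges_def)+
    have "(\<Sum>z\<in>Z. y z * ?a (\<phi>, c) z) = (\<Sum>z\<in>Inl ` ?V. y z * ?a (\<phi>, c) z) + (\<Sum>z\<in>Inr ` ?C. y z * ?a (\<phi>, c) z)"
      unfolding Z_def by (intro sum.union_disjoint) auto
    also have "(\<Sum>z\<in>Inl ` ?V. y z * ?a (\<phi>, c) z) = (\<Sum>x\<in>?V. y (Inl x) * of_nat (card {i\<in>{..<k}. \<phi> i = x}))"
      by (simp add: sum.reindex a_def nV_def)
    also have "\<dots> = (\<Sum>i<k. y (Inl (\<phi> i)))"
      using sub by (intro sum_mult_card_fibers) auto
    also have "(\<Sum>z\<in>Inr ` ?C. y z * ?a (\<phi>, c) z) = (\<Sum>d\<in>?C. if d = c then of_nat H * y (Inr d) else 0)"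
      by (simp add: sum.reindex a_def nC_const H_def del: sum.delta sum.delta') (intro sum.cong, auto simp: H_def)
    also have "\<dots> = of_nat H * y (Inr c)" using sub by (simp add: sum.delta)
    finally show ?thesis .
  qed
  have Hpos: "0 < H" unfolding H_def using pair01 by (auto simp: card_gt_0_iff)
  have b_range: "0 \<le> b z \<and> b z \<le> of_nat M" for z
  proof -
    have "a (\<phi>0, c0) z \<le> M"
    proof (cases z)
      case (Inl x)
      have "nV \<phi>0 x \<le> card {..<k}" unfolding nV_def by (intro card_mono) auto
      then show ?thesis by (simp add: a_def Inl M_def)
    next
      case (Inr d)
      then show ?thesis by (simp add: a_def nC_const M_def H_def)
    qed
    then have "?a (\<phi>0, c0) z \<le> rat_of_nat M" by (simp only: of_nat_le_iff)
    then show ?thesis unfolding b_def by simp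
  qed
  have e0E: "(\<phi>0, c0) \<in> E" using e0 by (simp add: E_def)
  have \<phi>0: "\<phi>0 ` {..<k} \<subseteq> VT False" "c0 \<in> CT False" using e0 by (auto simp: edges_def)
  \<comment> \<open>The copy \<open>(\<phi>0, c0)\<close> removes \<open>k\<close> from the demand
    on \<open>VT False\<close> and \<open>H\<close> from that on \<open>CT False\<close>; both lower
    the block mass there by one.\<close>
  define \<beta> where "\<beta> = (\<lambda>h. rat_of_nat (M * s) - (if h then 0 else 1))"
  have sV: "(\<Sum>x\<in>VT h. b (Inl x)) = of_nat k * \<beta> h" for h
  proof -
    have "(\<Sum>x\<in>VT h. 1 * rat_of_nat (card {i\<in>{..<k}. \<phi>0 i = x})) = (if h then 0 else of_nat k)"
    proof (cases h)
      case True
      have "{i\<in>{..<k}. \<phi>0 i = x} = {}" if "x \<in> VT True" for x using that \<phi>0 VT_Int by blast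
      then show ?thesis using True by (auto intro!: sum.neutral)
    next
      case False
      then show ?thesis using \<phi>0 by (subst sum_mult_card_fibers) auto
    qed
    then show ?thesis
      by (simp add: b_def a_def nV_def sum_subtractf card_VT \<beta>_def algebra_simps)
  qed
  have sC: "(\<Sum>d\<in>CT h. b (Inr d)) = of_nat H * \<beta> h" for h
  proof -
    have "(\<Sum>d\<in>CT h. rat_of_nat (nC (\<lambda>_. c0) d)) = (if h then 0 else of_nat H)"
    proof -
      have "(\<Sum>d\<in>CT h. rat_of_nat (nC (\<lambda>_. c0) d)) = (\<Sum>d\<in>CT h. if d = c0 then of_nat H else 0)"
        by (intro sum.cong) (auto simp: nC_const H_def)
      also have "\<dots> = (if c0 \<in> CT h then of_nat H else 0)" by (simp add: sum.delta)
      also have "c0 \<in> CT h \<longleftrightarrow> \<not> h" using \<phi>0(2) CT_Int by (cases h) auto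
      finally show ?thesis by simp
    qed
    then show ?thesis
      by (simp add: b_def a_def sum_subtractf card_CT \<beta>_def algebra_simps H_def)
  qed
  have Ms: "M * (s - 1) + 1 \<le> M * s" "2 \<le> M * s"
  proof -
    have "M * s = M * (s - 1) + M" using s_pos by (cases s) auto
    moreover have "2 \<le> M" using k2 Hpos by (simp add: M_def)
    ultimately show "M * (s - 1) + 1 \<le> M * s" "2 \<le> M * s" by auto
  qed
  have \<beta>: "rat_of_nat M * of_nat (s - 1) \<le> \<beta> h" "0 < \<beta> h" for h
  proof -
    have "rat_of_nat (M * (s - 1) + 1) \<le> of_nat (M * s)" "rat_of_nat 2 \<le> of_nat (M * s)"
      using Ms by (simp_all only: of_nat_le_iff)
    then show "rat_of_nat M * of_nat (s - 1) \<le> \<beta> h" "0 < \<beta> h"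
      by (auto simp: \<beta>_def simp del: of_nat_diff)
  qed
  have "\<exists>x. (\<forall>e\<in>E. 0 \<le> x e) \<and> (\<forall>z\<in>Z. b z = (\<Sum>e\<in>E. x e * ?a e z))"
  proof (rule farkas[OF finE finZ], rule ccontr)
    fix y assume y: "\<forall>e\<in>E. (\<Sum>z\<in>Z. y z * ?a e z) \<le> 0" "\<not> (\<Sum>z\<in>Z. y z * b z) \<le> 0"
    then have "0 < (\<Sum>z\<in>Z. b z * y z)" by (simp add: mult.commute)
    \<comment> \<open>A positive total is positive for one \<open>h\<close>, and on
      \<open>VT h\<close> with \<open>CT h\<close> vertex and colour demands have the same block
      mass \<open>\<beta> h\<close>.\<close>
    then have "\<exists>h. 0 < (\<Sum>x\<in>VT h. b (Inl x) * y (Inl x)) + (\<Sum>c\<in>CT h. b (Inr c) * y (Inr c))"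
      unfolding split_sum by (smt (verit) add_less_le_mono ex_bool_eq not_le add.assoc add_nonpos_nonpos)
    then obtain h where h: "0 < (\<Sum>x\<in>VT h. b (Inl x) * y (Inl x)) + (\<Sum>c\<in>CT h. b (Inr c) * y (Inr c))" ..
    have "\<exists>(\<phi>, c)\<in>edges h. 0 < (\<Sum>i<k. y (Inl (\<phi> i))) + of_nat (card (pairs k)) * y (Inr c)"
      by (rule heavy_edge[where bV = "\<lambda>x. b (Inl x)" and bC = "\<lambda>c. b (Inr c)" and M = "of_nat M" and \<beta> = "\<beta> h"])
        (use b_range sV sC \<beta> h in \<open>auto simp: H_def\<close>)
    then obtain \<phi> c where e: "(\<phi>, c) \<in> edges h" "0 < (\<Sum>i<k. y (Inl (\<phi> i))) + of_nat H * y (Inr c)"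
      unfolding H_def by auto
    then have "(\<phi>, c) \<in> E" by (cases h) (auto simp: E_def)
    then show False using e(2) edge_sum y(1) by fastforce
  qed
  then obtain x where x: "\<forall>e\<in>E. 0 \<le> x e" "\<And>z. z \<in> Z \<Longrightarrow> b z = (\<Sum>e\<in>E. x e * ?a e z)" by blast
  obtain p m where pm: "0 < p" "\<forall>e\<in>E. of_nat p * x e = of_nat (m e)"
    using clear_denominators[OF finE x(1)] by blast
  \<comment> \<open>After scaling by \<open>p\<close> the subtracted copy is due \<open>p\<close>
    times: once outside the list and \<open>p - 1\<close> times inside it.\<close>
  define m' where "m' = (\<lambda>e. m e + (if e = (\<phi>0, c0) then p - 1 else 0))"
  obtain L where L: "set L \<subseteq> E" "\<And>f::_ \<Rightarrow> nat. sum_list (map f L) = (\<Sum>e\<in>E. m' e * f e)"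
    using list_with_multiplicities[OF finE, of m'] by blast
  have count: "a (\<phi>0, c0) z + sum_list (map (\<lambda>e. a e z) L) = p * M" if z: "z \<in> Z" for z
  proof -
    have "of_nat p * b z = of_nat (\<Sum>e\<in>E. m e * a e z)"
      unfolding x(2)[OF z] sum_distrib_left of_nat_sum of_nat_mult
      using pm(2) by (intro sum.cong refl) (simp add: mult.assoc[symmetric])
    then have "rat_of_nat (p * M) = of_nat (p * a (\<phi>0, c0) z + (\<Sum>e\<in>E. m e * a e z))"
      by (simp add: b_def algebra_simps)
    then have "p * M = p * a (\<phi>0, c0) z + (\<Sum>e\<in>E. m e * a e z)" by (simp only: of_nat_eq_iff)
    moreover have "(\<Sum>e\<in>E. m' e * a e z) = (\<Sum>e\<in>E. m e * a e z) + (p - 1) * a (\<phi>0, c0) z"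
    proof -
      have "(\<Sum>e\<in>E. m' e * a e z) = (\<Sum>e\<in>E. m e * a e z) + (\<Sum>e\<in>E. if e = (\<phi>0, c0) then (p - 1) * a e z else 0)"
        unfolding sum.distrib[symmetric] by (intro sum.cong refl) (auto simp: m'_def algebra_simps)
      then show ?thesis using finE e0E by (simp add: sum.delta)
    qed
    moreover have "p * a (\<phi>0, c0) z = a (\<phi>0, c0) z + (p - 1) * a (\<phi>0, c0) z"
      using pm(1) by (cases p) auto
    ultimately show ?thesis by (simp add: L(2))
  qed
  show ?thesis
  proof (intro exI[of _ "p * M"] exI[of _ L] conjI ballI)
    show "0 < p * M" using pm Hpos by (simp add: M_def)
    show "set L \<subseteq> edges False \<union> edges True" using L by (simp add: E_def)
    fix x assume "x \<in> ?V"
    then show "nV \<phi>0 x + sum_list (map (\<lambda>(\<phi>, c). nV \<phi> x) L) = p * M"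
      using count[of "Inl x"] by (simp add: Z_def a_def case_prod_unfold)
  next
    fix d assume "d \<in> ?C"
    then show "nC (\<lambda>_. c0) d + sum_list (map (\<lambda>(\<phi>, c). nC (\<lambda>_. c) d) L) = p * M"
      using count[of "Inr d"] by (simp add: Z_def a_def case_prod_unfold)
  qed
qed

end

section \<open>Exchanging vertices and colours\<close>

text \<open>An indicator is added on either side because subtraction of natural numbers would
  truncate.\<close>

lemma card_fiber_upd:
  assumes "finite P" "e \<in> P"
  shows "card {i\<in>P. (f(e := a)) i = x} + of_bool (f e = x) = card {i\<in>P. f i = x} + of_bool (a = x)"
proof -
  have split: "card {i\<in>P. g i = x} = of_bool (g e = x) + card {i\<in>P - {e}. g i = x}" for g
  proof -
    have "{i\<in>P. g i = x} = (if g e = x then {e} else {}) \<union> {i\<in>P - {e}. g i = x}"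
      using assms(2) by auto
    moreover have "(if g e = x then {e} else {}) \<inter> {i\<in>P - {e}. g i = x} = {}" by auto
    ultimately show ?thesis using assms(1) by (simp add: card_Un_disjoint)
  qed
  have "{i\<in>P - {e}. (f(e := a)) i = x} = {i\<in>P - {e}. f i = x}" by auto
  then show ?thesis by (simp add: split[of f] split[of "f(e := a)"] del: fun_upd_apply) simp
qed

lemma sum_list_map_concat:
  "sum_list (map f (concat xss)) = (\<Sum>xs\<leftarrow>xss. sum_list (map f xs))"
  by (induction xss) auto

context reduced_structure
begin

text \<open>A tuple of the box selects one unit per position, so it decides the relation between a
  colour and two vertices of the blow-up only when these belong to three different positions. Hence
  the units met by one arc have to differ, while colours of different arcs may share a unit.\<close>

definition valid where
  "valid \<phi> \<gamma> \<longleftrightarrow> \<phi> ` {..<k} \<subseteq> {..2 * s} \<times> {..<k} \<and> \<gamma> ` pairs k \<subseteq> {..2 * s} \<times> pairs k \<and>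
    (\<forall>i j. (i, j) \<in> pairs k \<longrightarrow> \<tau> (i, j) (\<gamma> (i, j)) (\<phi> i) (\<phi> j) \<and> fst (\<phi> i) \<noteq> fst (\<phi> j) \<and>
      fst (\<gamma> (i, j)) \<noteq> fst (\<phi> i) \<and> fst (\<gamma> (i, j)) \<noteq> fst (\<phi> j))"

lemma VT_CT_fst: "x \<in> VT h \<Longrightarrow> c \<in> CT h \<Longrightarrow> fst c \<noteq> fst x"
  by (auto simp: VT_def CT_def half_def split: if_splits)

lemma VT_fst: "x \<in> VT h \<Longrightarrow> fst x < 2 * s" and CT_fst: "c \<in> CT h \<Longrightarrow> fst c < 2 * s"
  using VT_sub CT_sub by fastforce+

lemma VT_mem: "x \<in> VT h \<Longrightarrow> x \<in> {..2 * s} \<times> {..<k}"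
  and CT_mem: "c \<in> CT h \<Longrightarrow> c \<in> {..2 * s} \<times> pairs k"
  using VT_sub CT_sub by fastforce+

lemma edges_valid:
  assumes "(\<phi>, c) \<in> edges h"
  shows "valid \<phi> (\<lambda>_. c)"
proof -
  have \<phi>: "\<And>i. i < k \<Longrightarrow> \<phi> i \<in> VT h" and c: "c \<in> CT h"
    and arc: "\<And>i j. (i, j) \<in> pairs k \<Longrightarrow> ok (i, j) c (\<phi> i) (\<phi> j)"
    using assms by (auto simp: edges_def)
  have "\<phi> ` {..<k} \<subseteq> {..2 * s} \<times> {..<k}" "c \<in> {..2 * s} \<times> pairs k"
    using \<phi> c VT_mem CT_mem by blast+
  moreover have "fst c \<noteq> fst (\<phi> i)" if "i < k" for i using VT_CT_fst[OF \<phi>[OF that] c] .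
  ultimately show ?thesis using arc by (auto simp: valid_def ok_def pairs_def)
qed

lemma uniform_list_counts:
  assumes e0: "(\<phi>0, c0) \<in> edges False"
  shows "\<exists>q es. 0 < q \<and> (\<forall>(\<phi>, \<gamma>)\<in>set es. valid \<phi> \<gamma>) \<and>
    (\<forall>x\<in>{..2 * s} \<times> {..<k}. nV \<phi>0 x + (\<Sum>(\<phi>, \<gamma>)\<leftarrow>es. nV \<phi> x) = (if fst x < 2 * s then q else 0)) \<and>
    (\<forall>d\<in>{..2 * s} \<times> pairs k. nC (\<lambda>_. c0) d + (\<Sum>(\<phi>, \<gamma>)\<leftarrow>es. nC \<gamma> d) = (if fst d < 2 * s then q else 0))"
proof -
  obtain q L where q: "0 < q" and L: "set L \<subseteq> edges False \<union> edges True"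
    and V: "\<And>x. x \<in> {..<2 * s} \<times> {..<k} \<Longrightarrow> nV \<phi>0 x + sum_list (map (\<lambda>(\<phi>, c). nV \<phi> x) L) = q"
    and C: "\<And>d. d \<in> {..<2 * s} \<times> pairs k \<Longrightarrow> nC (\<lambda>_. c0) d + sum_list (map (\<lambda>(\<phi>, c). nC (\<lambda>_. c) d) L) = q"
    using uniform_tiling_with_edge[OF e0] by meson
  have starV: "nV \<phi> x = 0" if "(\<phi>, c) \<in> edges h" "\<not> fst x < 2 * s" for \<phi> c h x
  proof -
    have "\<phi> i \<noteq> x" if "i < k" for i
      using VT_fst[of "\<phi> i" h] \<open>(\<phi>, c) \<in> edges h\<close> \<open>\<not> fst x < 2 * s\<close> that by (auto simp: edges_def)
    then show ?thesis by (auto simp: nV_def)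
  qed
  have starC: "nC (\<lambda>_. c) d = 0" if "(\<phi>, c) \<in> edges h" "\<not> fst d < 2 * s" for \<phi> c h d
    using CT_fst[of c h] that by (auto simp: edges_def nC_const)
  have starVL: "sum_list (map (\<lambda>(\<phi>, c). nV \<phi> x) L) = 0" if "\<not> fst x < 2 * s" for x
  proof -
    have "nV \<phi> x = 0" if "(\<phi>, c) \<in> set L" for \<phi> c
      using L starV[of \<phi> c False x] starV[of \<phi> c True x] that \<open>\<not> fst x < 2 * s\<close> by blast
    then show ?thesis by (simp only: sum_list_eq_0_iff) auto
  qed
  have starCL: "sum_list (map (\<lambda>(\<phi>, c). nC (\<lambda>_. c) d) L) = 0" if "\<not> fst d < 2 * s" for d
  proof -
    have "nC (\<lambda>_. c) d = 0" if "(\<phi>, c) \<in> set L" for \<phi> c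
      using L starC[of \<phi> c False d] starC[of \<phi> c True d] that \<open>\<not> fst d < 2 * s\<close> by blast
    then show ?thesis by (simp only: sum_list_eq_0_iff) auto
  qed
  define es where "es = map (\<lambda>(\<phi>, c). (\<phi>, \<lambda>_::nat \<times> nat. c)) L"
  have mapV: "(\<Sum>(\<phi>, \<gamma>)\<leftarrow>es. nV \<phi> x) = sum_list (map (\<lambda>(\<phi>, c). nV \<phi> x) L)" for x
    by (simp add: es_def comp_def case_prod_unfold)
  have mapC: "(\<Sum>(\<phi>, \<gamma>)\<leftarrow>es. nC \<gamma> d) = sum_list (map (\<lambda>(\<phi>, c). nC (\<lambda>_. c) d) L)" for d
    by (simp add: es_def comp_def case_prod_unfold)
  show ?thesis
  proof (intro exI[of _ q] exI[of _ es] conjI ballI)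
    show "0 < q" by fact
    fix e assume "e \<in> set es"
    then obtain \<phi> c where "e = (\<phi>, \<lambda>_. c)" "(\<phi>, c) \<in> set L" by (auto simp: es_def)
    moreover from this have "(\<phi>, c) \<in> edges False \<or> (\<phi>, c) \<in> edges True" using L by auto
    ultimately show "case e of (\<phi>, \<gamma>) \<Rightarrow> valid \<phi> \<gamma>"
      using edges_valid[of \<phi> c False] edges_valid[of \<phi> c True] by auto
  next
    fix x assume x: "x \<in> {..2 * s} \<times> {..<k}"
    show "nV \<phi>0 x + (\<Sum>(\<phi>, \<gamma>)\<leftarrow>es. nV \<phi> x) = (if fst x < 2 * s then q else 0)"
    proof (cases "fst x < 2 * s")
      case True
      then have "x \<in> {..<2 * s} \<times> {..<k}" using x by auto
      then show ?thesis using True V mapV by simp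
    next
      case False
      then show ?thesis using starVL[OF False] starV[OF e0 False] mapV by simp
    qed
  next
    fix d assume d: "d \<in> {..2 * s} \<times> pairs k"
    show "nC (\<lambda>_. c0) d + (\<Sum>(\<phi>, \<gamma>)\<leftarrow>es. nC \<gamma> d) = (if fst d < 2 * s then q else 0)"
    proof (cases "fst d < 2 * s")
      case True
      then have "d \<in> {..<2 * s} \<times> pairs k" using d by auto
      then show ?thesis using True C mapC by simp
    next
      case False
      then show ?thesis using starCL[OF False] starC[OF e0 False] mapC by simp
    qed
  qed
qed

lemma restrict_edge:
  assumes "c0 \<in> CT False" "\<forall>i<k. v i \<in> VT False"
    "\<forall>i j. (i, j) \<in> pairs k \<longrightarrow> ok (i, j) c0 (v i) (v j)"
  shows "(restrict v {..<k}, c0) \<in> edges False" and "nV (restrict v {..<k}) = nV v"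
proof -
  have "i < k" "j < k" if "(i, j) \<in> pairs k" for i j using that by (auto simp: pairs_def)
  then show "(restrict v {..<k}, c0) \<in> edges False"
    using assms by (auto simp: edges_def)
  show "nV (restrict v {..<k}) = nV v"
    by (intro ext) (auto simp: nV_def intro!: arg_cong[where f = card])
qed

text \<open>Trades a vertex \<open>x0\<close> of the uniform tiling for the vertex \<open>(2 * s, t)\<close> of the extra unit.\<close>

lemma vertex_swap:
  assumes c0: "c0 \<in> CT False" and x0: "x0 \<in> VT False" and t: "t < k"
  shows "\<exists>q es. (\<forall>(\<phi>, \<gamma>)\<in>set es. valid \<phi> \<gamma>) \<and>
    (\<forall>x\<in>{..2 * s} \<times> {..<k}. (\<Sum>(\<phi>, \<gamma>)\<leftarrow>es. nV \<phi> x) + of_bool (x0 = x)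
      = (if fst x < 2 * s then q else 0) + of_bool ((2 * s, t) = x)) \<and>
    (\<forall>d\<in>{..2 * s} \<times> pairs k. (\<Sum>(\<phi>, \<gamma>)\<leftarrow>es. nC \<gamma> d) = (if fst d < 2 * s then q else 0))"
proof -
  have c0': "c0 \<in> {..2 * s} \<times> pairs k" by (rule CT_mem[OF c0])
  \<comment> \<open>All roles other than 0 are also made compatible with the new vertex in role 0,
    so putting \<open>(2 * s, t)\<close> in place of \<open>x0\<close> keeps the copy valid.\<close>
  define extra where "extra = (\<lambda>j. if j = 0 then {} else forb False (0, j) c0 (2 * s, t))"
  have "card (extra j) + 1 \<le> s \<and> finite (extra j)" if "j < k" for j
  proof (cases "j = 0")
    case True
    then show ?thesis using s_pos by (simp add: extra_def)
  next
    case False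
    then have "(0, j) \<in> pairs k" using that by (auto simp: pairs_def)
    then have "card (forb False (0, j) c0 (2 * s, t)) + 1 \<le> s"
      using c0' t by (intro card_forb) auto
    then show ?thesis using False by (simp add: extra_def) (simp add: forb_def)
  qed
  then have "\<forall>j<k. card (extra j) + 1 \<le> s \<and> finite (extra j)" by blast
  from embed_pattern[OF c0 x0 this] obtain v where v: "v 0 = x0" "\<forall>i<k. v i \<in> VT False"
    "\<forall>i j. (i, j) \<in> pairs k \<longrightarrow> ok (i, j) c0 (v i) (v j)"
    "\<And>j. 0 < j \<Longrightarrow> j < k \<Longrightarrow> v j \<notin> extra j" by blast
  note e = restrict_edge[OF c0 v(2,3)]
  obtain q es where es0: "\<forall>(\<phi>, \<gamma>)\<in>set es. valid \<phi> \<gamma>"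
    "\<forall>x\<in>{..2 * s} \<times> {..<k}. nV v x + (\<Sum>(\<phi>, \<gamma>)\<leftarrow>es. nV \<phi> x) = (if fst x < 2 * s then q else 0)"
    "\<forall>d\<in>{..2 * s} \<times> pairs k. nC (\<lambda>_. c0) d + (\<Sum>(\<phi>, \<gamma>)\<leftarrow>es. nC \<gamma> d) = (if fst d < 2 * s then q else 0)"
    using uniform_list_counts[OF e(1)] unfolding e(2) by (elim exE conjE) (rule that; assumption)
  note es = es0(1) es0(2,3)[rule_format]
  let ?v = "v(0 := (2 * s, t))"
  have val: "valid ?v (\<lambda>_. c0)"
    unfolding valid_def
  proof (intro conjI allI impI)
    show "?v ` {..<k} \<subseteq> {..2 * s} \<times> {..<k}"
    proof (rule image_subsetI)
      fix i assume "i \<in> {..<k}"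
      then show "?v i \<in> {..2 * s} \<times> {..<k}"
        using VT_mem[of "v i" False] v(2) t by (cases "i = 0") auto
    qed
    show "(\<lambda>_. c0) ` pairs k \<subseteq> {..2 * s} \<times> pairs k" using c0' by auto
    fix i j assume ij: "(i, j) \<in> pairs k"
    then have ij': "i < j" "j < k" by (auto simp: pairs_def)
    have vj: "v j \<in> VT False" "v i \<in> VT False" using v(2) ij' by auto
    have "ok (i, j) c0 (?v i) (?v j)"
    proof (cases "i = 0")
      case True
      then show ?thesis using v(4)[of j] ij' vj by (auto simp: extra_def forb_def)
    next
      case False
      then show ?thesis using v(3) ij ij' by auto
    qed
    then show "\<tau> (i, j) c0 (?v i) (?v j)" "fst (?v i) \<noteq> fst (?v j)" unfolding ok_def by blast+
    have "fst c0 < 2 * s" using CT_fst[OF c0] .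
    then show "fst c0 \<noteq> fst (?v i)" "fst c0 \<noteq> fst (?v j)"
      using VT_CT_fst[OF vj(1) c0] VT_CT_fst[OF vj(2) c0] ij' by auto
  qed
  have sw: "nV ?v x + of_bool (x0 = x) = nV v x + of_bool ((2 * s, t) = x)" for x
    unfolding nV_def using card_fiber_upd[of "{..<k}" 0 v "(2 * s, t)" x] k2 v(1) by simp
  show ?thesis
  proof (intro exI[of _ q] exI[of _ "(?v, \<lambda>_. c0) # es"] conjI ballI)
    fix e assume "e \<in> set ((?v, \<lambda>_. c0) # es)"
    then show "case e of (\<phi>, \<gamma>) \<Rightarrow> valid \<phi> \<gamma>" using val es(1) by auto
  next
    fix x assume x: "x \<in> {..2 * s} \<times> {..<k}"
    show "(\<Sum>(\<phi>, \<gamma>)\<leftarrow>(?v, \<lambda>_. c0) # es. nV \<phi> x) + of_bool (x0 = x) = (if fst x < 2 * s then q else 0) + of_bool ((2 * s, t) = x)"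
      using sw[of x] es(2)[OF x] by (simp only: list.map sum_list.Cons prod.case)
  next
    fix d assume d: "d \<in> {..2 * s} \<times> pairs k"
    show "(\<Sum>(\<phi>, \<gamma>)\<leftarrow>(?v, \<lambda>_. c0) # es. nC \<gamma> d) = (if fst d < 2 * s then q else 0)"
      using es(3)[OF d] by (simp only: list.map sum_list.Cons prod.case)
  qed
qed

text \<open>Only the colour of the arc \<open>(0, 1)\<close> is exchanged: the vertex in role 1 is
  chosen compatible with \<open>x0\<close> both in colour \<open>c0\<close> and in colour
  \<open>(2 * s, p)\<close>. Afterwards \<open>c0\<close> is used once too rarely.\<close>

lemma colour_swap:
  assumes c0: "c0 \<in> CT False" and p: "p \<in> pairs k"
  shows "\<exists>q es. (\<forall>(\<phi>, \<gamma>)\<in>set es. valid \<phi> \<gamma>) \<and>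
    (\<forall>x\<in>{..2 * s} \<times> {..<k}. (\<Sum>(\<phi>, \<gamma>)\<leftarrow>es. nV \<phi> x) = (if fst x < 2 * s then q else 0)) \<and>
    (\<forall>d\<in>{..2 * s} \<times> pairs k. (\<Sum>(\<phi>, \<gamma>)\<leftarrow>es. nC \<gamma> d) + of_bool (c0 = d)
      = (if fst d < 2 * s then q else 0) + of_bool ((2 * s, p) = d))"
proof -
  have "VT False \<noteq> {}" using card_VT[of False] s_pos k2 by auto
  then obtain x0 where x0: "x0 \<in> VT False" by blast
  have c0': "c0 \<in> {..2 * s} \<times> pairs k" by (rule CT_mem[OF c0])
  have x0': "x0 \<in> {..2 * s} \<times> {..<k}" by (rule VT_mem[OF x0])
  define extra where "extra = (\<lambda>j::nat. if j = 1 then forb False (0, 1) (2 * s, p) x0 else {})"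
  have "card (extra j) + 1 \<le> s \<and> finite (extra j)" if "j < k" for j
  proof (cases "j = 1")
    case False
    then show ?thesis using s_pos by (simp add: extra_def)
  next
    case True
    have "card (forb False (0, 1) (2 * s, p) x0) + 1 \<le> s"
      using x0' p pair01 by (intro card_forb) auto
    then show ?thesis using True by (simp add: extra_def) (simp add: forb_def)
  qed
  then have "\<forall>j<k. card (extra j) + 1 \<le> s \<and> finite (extra j)" by blast
  from embed_pattern[OF c0 x0 this] obtain v where v: "v 0 = x0" "\<forall>i<k. v i \<in> VT False"
    "\<forall>i j. (i, j) \<in> pairs k \<longrightarrow> ok (i, j) c0 (v i) (v j)"
    "\<And>j. 0 < j \<Longrightarrow> j < k \<Longrightarrow> v j \<notin> extra j" by blast
  note e = restrict_edge[OF c0 v(2,3)]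
  obtain q es where es0: "\<forall>(\<phi>, \<gamma>)\<in>set es. valid \<phi> \<gamma>"
    "\<forall>x\<in>{..2 * s} \<times> {..<k}. nV v x + (\<Sum>(\<phi>, \<gamma>)\<leftarrow>es. nV \<phi> x) = (if fst x < 2 * s then q else 0)"
    "\<forall>d\<in>{..2 * s} \<times> pairs k. nC (\<lambda>_. c0) d + (\<Sum>(\<phi>, \<gamma>)\<leftarrow>es. nC \<gamma> d) = (if fst d < 2 * s then q else 0)"
    using uniform_list_counts[OF e(1)] unfolding e(2) by (elim exE conjE) (rule that; assumption)
  note es = es0(1) es0(2,3)[rule_format]
  let ?c = "(\<lambda>_. c0)((0, 1) := (2 * s, p))"
  have val: "valid v ?c"
    unfolding valid_def
  proof (intro conjI allI impI)
    show "v ` {..<k} \<subseteq> {..2 * s} \<times> {..<k}"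
      using v(2) VT_mem by blast
    show "?c ` pairs k \<subseteq> {..2 * s} \<times> pairs k" using c0' p by auto
    fix i j assume ij: "(i, j) \<in> pairs k"
    then have ij': "i < j" "j < k" by (auto simp: pairs_def)
    have vj: "v j \<in> VT False" "v i \<in> VT False" using v(2) ij' by auto
    show "fst (v i) \<noteq> fst (v j)" using v(3) ij by (auto simp: ok_def)
    show "\<tau> (i, j) (?c (i, j)) (v i) (v j)"
    proof (cases "(i, j) = (0, 1)")
      case True
      then show ?thesis using v(4)[of 1] v(1) ij' vj by (auto simp: extra_def forb_def ok_def)
    next
      case False
      then show ?thesis using v(3) ij by (auto simp: ok_def)
    qed
    have "fst (v i) < 2 * s" "fst (v j) < 2 * s" using VT_fst vj by blast+
    then show "fst (?c (i, j)) \<noteq> fst (v i)" "fst (?c (i, j)) \<noteq> fst (v j)"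
      using VT_CT_fst[OF vj(1) c0] VT_CT_fst[OF vj(2) c0] by auto
  qed
  have sw: "nC ?c d + of_bool (c0 = d) = nC (\<lambda>_. c0) d + of_bool ((2 * s, p) = d)" for d
    unfolding nC_def using card_fiber_upd[of "pairs k" "(0, 1)" "\<lambda>_. c0" "(2 * s, p)" d] pair01 by simp
  show ?thesis
  proof (intro exI[of _ q] exI[of _ "(v, ?c) # es"] conjI ballI)
    fix e assume "e \<in> set ((v, ?c) # es)"
    then show "case e of (\<phi>, \<gamma>) \<Rightarrow> valid \<phi> \<gamma>" using val es(1) by auto
  next
    fix x assume x: "x \<in> {..2 * s} \<times> {..<k}"
    show "(\<Sum>(\<phi>, \<gamma>)\<leftarrow>(v, ?c) # es. nV \<phi> x) = (if fst x < 2 * s then q else 0)"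
      using es(2)[OF x] by (simp only: list.map sum_list.Cons prod.case)
  next
    fix d assume d: "d \<in> {..2 * s} \<times> pairs k"
    show "(\<Sum>(\<phi>, \<gamma>)\<leftarrow>(v, ?c) # es. nC \<gamma> d) + of_bool (c0 = d) = (if fst d < 2 * s then q else 0) + of_bool ((2 * s, p) = d)"
      using sw[of d] es(3)[OF d] by (simp only: list.map sum_list.Cons prod.case)
  qed
qed

text \<open>The deficits of the exchanges are made to add up to a copy. The \<open>k\<close> vertex
  exchanges give up the vertices \<open>v 0\<close>, ..., \<open>v (k - 1)\<close> of one copy, and
  the colour exchanges give up its colour \<open>c0\<close> once for each arc. Adding this copy
  itself restores both.\<close>

lemma exact_tiling:
  "\<exists>q es. (\<forall>(\<phi>, \<gamma>)\<in>set es. valid \<phi> \<gamma>) \<and>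
    (\<forall>x\<in>{..2 * s} \<times> {..<k}. (\<Sum>(\<phi>, \<gamma>)\<leftarrow>es. nV \<phi> x) = (if fst x < 2 * s then q else 1)) \<and>
    (\<forall>d\<in>{..2 * s} \<times> pairs k. (\<Sum>(\<phi>, \<gamma>)\<leftarrow>es. nC \<gamma> d) = (if fst d < 2 * s then q else 1))"
proof -
  have "VT False \<noteq> {}" using card_VT[of False] s_pos k2 by auto
  then obtain x0 where x0: "x0 \<in> VT False" by blast
  have "card (pairs k) \<noteq> 0" using pair01 by auto
  then have "CT False \<noteq> {}" using card_CT[of False] s_pos by auto
  then obtain c0 where c0: "c0 \<in> CT False" by blast
  have "\<forall>j<k. card ((\<lambda>_. {} :: (nat \<times> nat) set) j) + 1 \<le> s \<and> finite ((\<lambda>_. {} :: (nat \<times> nat) set) j)"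
    using s_pos by simp
  from embed_pattern[OF c0 x0 this] obtain v where v: "\<forall>i<k. v i \<in> VT False"
    "\<forall>i j. (i, j) \<in> pairs k \<longrightarrow> ok (i, j) c0 (v i) (v j)" by blast
  have "valid v (\<lambda>_. c0)"
    using edges_valid[OF restrict_edge(1)[OF c0 v]] by (auto simp: valid_def pairs_def)
  define PV where "PV t q es \<longleftrightarrow> (\<forall>(\<phi>, \<gamma>)\<in>set es. valid \<phi> \<gamma>) \<and>
    (\<forall>x\<in>{..2 * s} \<times> {..<k}. (\<Sum>(\<phi>, \<gamma>)\<leftarrow>es. nV \<phi> x) + of_bool (v t = x)
      = (if fst x < 2 * s then q else 0) + of_bool ((2 * s, t) = x)) \<and>
    (\<forall>d\<in>{..2 * s} \<times> pairs k. (\<Sum>(\<phi>, \<gamma>)\<leftarrow>es. nC \<gamma> d) = (if fst d < 2 * s then q else 0))" for t q es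
  have "\<forall>t\<in>{..<k}. \<exists>q es. PV t q es"
    unfolding PV_def using vertex_swap[OF c0] v(1) by blast
  then obtain qv ev where PV: "\<And>t. t < k \<Longrightarrow> PV t (qv t) (ev t)" by (metis lessThan_iff)
  note ev = PV[unfolded PV_def, THEN conjunct1]
    PV[unfolded PV_def, THEN conjunct2, THEN conjunct1, rule_format]
    PV[unfolded PV_def, THEN conjunct2, THEN conjunct2, rule_format]
  define PC where "PC p q es \<longleftrightarrow> (\<forall>(\<phi>, \<gamma>)\<in>set es. valid \<phi> \<gamma>) \<and>
    (\<forall>x\<in>{..2 * s} \<times> {..<k}. (\<Sum>(\<phi>, \<gamma>)\<leftarrow>es. nV \<phi> x) = (if fst x < 2 * s then q else 0)) \<and>
    (\<forall>d\<in>{..2 * s} \<times> pairs k. (\<Sum>(\<phi>, \<gamma>)\<leftarrow>es. nC \<gamma> d) + of_bool (c0 = d)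
      = (if fst d < 2 * s then q else 0) + of_bool ((2 * s, p) = d))" for p q es
  have "\<forall>p\<in>pairs k. \<exists>q es. PC p q es"
    unfolding PC_def using colour_swap[OF c0] by blast
  then obtain qc ec where PC: "\<And>p. p \<in> pairs k \<Longrightarrow> PC p (qc p) (ec p)" by metis
  note ec = PC[unfolded PC_def, THEN conjunct1]
    PC[unfolded PC_def, THEN conjunct2, THEN conjunct1, rule_format]
    PC[unfolded PC_def, THEN conjunct2, THEN conjunct2, rule_format]
  obtain ps where ps: "set ps = pairs k" "distinct ps" using finite_distinct_list[OF finite_pairs] by blast
  define es where "es = (v, \<lambda>_. c0) # concat (map ev [0..<k]) @ concat (map ec ps)"
  define q where "q = (\<Sum>t<k. qv t) + (\<Sum>p\<in>pairs k. qc p)"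
  have sum_es: "sum_list (map f es) = f (v, \<lambda>_. c0) + (\<Sum>t<k. sum_list (map f (ev t))) + (\<Sum>p\<in>pairs k. sum_list (map f (ec p)))"
    for f :: "_ \<Rightarrow> nat"
  proof -
    have "(\<Sum>xs\<leftarrow>map ev [0..<k]. sum_list (map f xs)) = (\<Sum>t<k. sum_list (map f (ev t)))"
      by (simp add: comp_def interv_sum_list_conv_sum_set_nat atLeast0LessThan)
    moreover have "(\<Sum>xs\<leftarrow>map ec ps. sum_list (map f xs)) = (\<Sum>p\<in>pairs k. sum_list (map f (ec p)))"
      using ps by (simp add: comp_def sum_list_distinct_conv_sum_set)
    ultimately show ?thesis by (simp add: es_def sum_list_map_concat)
  qed
  have ifs: "(\<Sum>i\<in>I. if b then f i else 0) = (if b then \<Sum>i\<in>I. f i else 0)" for I b and f :: "_ \<Rightarrow> nat"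
    by simp
  have cardsum: "(\<Sum>i\<in>I. of_bool (g i = x)) = card {i\<in>I. g i = x}" if "finite I" for I g and x :: 'z
    using that by (simp add: of_bool_def sum.If_cases Int_def)
  show ?thesis
  proof (intro exI[of _ q] exI[of _ es] conjI ballI)
    fix e assume "e \<in> set es"
    then consider "e = (v, \<lambda>_. c0)" | t where "t < k" "e \<in> set (ev t)" | p where "p \<in> pairs k" "e \<in> set (ec p)"
      using ps by (auto simp: es_def)
    then show "case e of (\<phi>, \<gamma>) \<Rightarrow> valid \<phi> \<gamma>"
      using \<open>valid v (\<lambda>_. c0)\<close> ev(1) ec(1) by cases auto
  next
    fix x assume x: "x \<in> {..2 * s} \<times> {..<k}"
    have "(\<Sum>t<k. (\<Sum>(\<phi>, \<gamma>)\<leftarrow>ev t. nV \<phi> x) + of_bool (v t = x))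
       = (\<Sum>t<k. (if fst x < 2 * s then qv t else 0) + of_bool ((2 * s, t) = x))"
      using ev(2)[OF _ x] by (intro sum.cong) auto
    moreover have "(\<Sum>t<k. of_bool (v t = x)) = nV v x"
      unfolding nV_def by (rule cardsum) simp
    moreover have "(\<Sum>t<k. of_bool ((2 * s, t) = x)) = (if fst x < 2 * s then 0 else 1 :: nat)"
    proof -
      have "{t\<in>{..<k}. (2 * s, t) = x} = (if fst x < 2 * s then {} else {snd x})" using x by auto
      then show ?thesis unfolding cardsum[OF finite_lessThan] by simp
    qed
    moreover have "(\<Sum>p\<in>pairs k. \<Sum>(\<phi>, \<gamma>)\<leftarrow>ec p. nV \<phi> x) = (\<Sum>p\<in>pairs k. if fst x < 2 * s then qc p else 0)"
      using ec(2)[OF _ x] by (intro sum.cong) auto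
    ultimately show "(\<Sum>(\<phi>, \<gamma>)\<leftarrow>es. nV \<phi> x) = (if fst x < 2 * s then q else 1)"
      by (auto simp: sum_es q_def sum.distrib ifs)
  next
    fix d assume d: "d \<in> {..2 * s} \<times> pairs k"
    have "(\<Sum>p\<in>pairs k. (\<Sum>(\<phi>, \<gamma>)\<leftarrow>ec p. nC \<gamma> d) + of_bool (c0 = d))
       = (\<Sum>p\<in>pairs k. (if fst d < 2 * s then qc p else 0) + of_bool ((2 * s, p) = d))"
      using ec(3)[OF _ d] by (intro sum.cong) auto
    moreover have "(\<Sum>p\<in>pairs k. of_bool (c0 = d)) = nC (\<lambda>_. c0) d"
      unfolding nC_def by (rule cardsum) simp
    moreover have "(\<Sum>p\<in>pairs k. of_bool ((2 * s, p) = d)) = (if fst d < 2 * s then 0 else 1 :: nat)"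
    proof -
      have "{p\<in>pairs k. (2 * s, p) = d} = (if fst d < 2 * s then {} else {snd d})" using d by auto
      then show ?thesis unfolding cardsum[OF finite_pairs] by simp
    qed
    moreover have "(\<Sum>t<k. \<Sum>(\<phi>, \<gamma>)\<leftarrow>ev t. nC \<gamma> d) = (\<Sum>t<k. if fst d < 2 * s then qv t else 0)"
      using ev(3)[OF _ d] by (intro sum.cong) auto
    ultimately show "(\<Sum>(\<phi>, \<gamma>)\<leftarrow>es. nC \<gamma> d) = (if fst d < 2 * s then q else 1)"
      by (auto simp: sum_es q_def sum.distrib ifs)
  qed
qed

end

section \<open>Sampling units\<close>

lemma exp_le_quadratic:
  fixes x :: real
  assumes "\<bar>x\<bar> \<le> 1"
  shows "exp x \<le> 1 + x + x\<^sup>2"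
proof (cases "0 \<le> x")
  case True
  then show ?thesis using assms exp_bound by auto
next
  case False
  have "1 - x \<le> exp (- x)" using exp_ge_add_one_self[of "-x"] by simp
  then have "exp x \<le> 1 / (1 - x)"
    using False by (simp add: exp_minus field_simps)
  also have "\<dots> \<le> 1 + x + x\<^sup>2"
  proof -
    have "(1 + x + x\<^sup>2) * (1 - x) = 1 - x ^ 3" by (simp add: algebra_simps power2_eq_square power3_eq_cube)
    moreover have "x ^ 3 \<le> 0" using False by (simp add: power_le_zero_eq)
    ultimately have "1 \<le> (1 + x + x\<^sup>2) * (1 - x)" by simp
    then show ?thesis using False by (simp add: divide_le_eq)
  qed
  finally show ?thesis .
qed

text \<open>\<open>S\<close> holds the positions of the vertex and the colour under test; once they
  are fixed, the other positions are independent and the exponential moment method applies. The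
  positions of \<open>H\<close> in \<open>S\<close> contribute at most \<open>2 * k\<close>, and the
  slack in the event another \<open>k\<close>, which gives the \<open>3 * k\<close> in
  \<open>T\<close>.\<close>

lemma few_bad_tuples:
  fixes g :: "(nat \<Rightarrow> 'u) \<Rightarrow> 'u \<Rightarrow> nat" and \<eta> :: real
  assumes fin: "finite I" "finite U" and sub: "S \<subseteq> I" "H \<subseteq> I" and card: "card S \<le> 2" "card H = s"
    and k: "1 \<le> k" and \<eta>: "0 < \<eta>" "\<eta> < 1"
    and g_le: "\<And>w u. g w u \<le> k"
    and g_local: "\<And>w l v. l \<notin> S \<Longrightarrow> g (w(l := v)) = g w"
    and avg: "\<And>w. w \<in> S \<rightarrow> U \<Longrightarrow> (\<Sum>u\<in>U. real (g w u)) \<le> (1 - 3 * \<eta> / 4) * card U"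
  shows "real (card {w\<in>PiE I (\<lambda>_. U). s < (\<Sum>l\<in>H. g w (w l)) + k + 1})
    \<le> exp (1 - \<eta>\<^sup>2 * s / (8 * (real k)\<^sup>2)) * real (card U) ^ card I"
proof -
  define H' where "H' = H - S"
  define J where "J = I - H'"
  define \<mu> where "\<mu> = 1 - 3 * \<eta> / 4"
  \<comment> \<open>Small enough for the quadratic bound on \<open>exp\<close>, and such that the
    quadratic loss per sampled unit is a third of the linear gain.\<close>
  define \<theta> where "\<theta> = \<eta> / (4 * (real k)\<^sup>2)"
  define T where "T = \<theta> * (3 * \<eta> * s / 4 - 3 * k)"
  define f where "f = (\<lambda>w u. exp (\<theta> * (real (g w u) - \<mu>)))"
  let ?W = "PiE I (\<lambda>_. U)"
  let ?B = "{w\<in>?W. s < (\<Sum>l\<in>H. g w (w l)) + k + 1}"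
  have finS: "finite S" "finite H" "finite H'" "finite J"
    using finite_subset[OF sub(1) fin(1)] finite_subset[OF sub(2) fin(1)] fin(1)
    by (simp_all add: H'_def J_def)
  have finW: "finite ?W" using fin by (intro finite_PiE) auto
  have JH: "J \<union> H' = I" "H' \<inter> J = {}" "S \<subseteq> J" using sub by (auto simp: J_def H'_def)
  have \<mu>: "0 \<le> \<mu>" "\<mu> \<le> 1" using \<eta> by (auto simp: \<mu>_def)
  have \<theta>0: "0 < \<theta>" using \<eta> k by (simp add: \<theta>_def)
  have \<theta>k: "\<theta> * k \<le> 1"
  proof -
    have "\<theta> * k = \<eta> / (4 * k)" using k by (simp add: \<theta>_def power2_eq_square)
    also have "\<dots> \<le> 1" using \<eta> k by (simp add: divide_le_eq)
    finally show ?thesis .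
  qed
  have f_le: "f w u \<le> 1 + \<theta> * (real (g w u) - \<mu>) + (\<theta> * k)\<^sup>2" for w u
  proof -
    have "\<bar>real (g w u) - \<mu>\<bar> \<le> real k" using g_le[of w u] \<mu> k by auto
    then have *: "\<bar>\<theta> * (real (g w u) - \<mu>)\<bar> \<le> \<theta> * k"
      using \<theta>0 by (simp add: abs_mult)
    then have "f w u \<le> 1 + \<theta> * (real (g w u) - \<mu>) + (\<theta> * (real (g w u) - \<mu>))\<^sup>2"
      unfolding f_def using \<theta>k by (intro exp_le_quadratic) linarith
    also have "(\<theta> * (real (g w u) - \<mu>))\<^sup>2 \<le> (\<theta> * k)\<^sup>2"
      using * by (metis abs_le_square_iff abs_of_nonneg abs_ge_zero order_trans)
    finally show ?thesis by simp
  qed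
  have sumf: "(\<Sum>u\<in>U. f w u) \<le> exp ((\<theta> * k)\<^sup>2) * card U" if w: "w \<in> J \<rightarrow> U" for w
  proof -
    have "(\<Sum>u\<in>U. f w u) \<le> (\<Sum>u\<in>U. 1 + \<theta> * (real (g w u) - \<mu>) + (\<theta> * k)\<^sup>2)"
      by (intro sum_mono f_le)
    also have "\<dots> = card U + \<theta> * ((\<Sum>u\<in>U. real (g w u)) - \<mu> * card U) + (\<theta> * k)\<^sup>2 * card U"
      by (simp add: sum.distrib sum_subtractf sum_distrib_left[symmetric] mult.commute)
    also have "\<dots> \<le> card U + \<theta> * 0 + (\<theta> * k)\<^sup>2 * card U"
    proof -
      have "w \<in> S \<rightarrow> U" using w JH by auto
      from avg[OF this] show ?thesis using \<theta>0 by (intro add_mono mult_left_mono) (auto simp: \<mu>_def)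
    qed
    also have "\<dots> = (1 + (\<theta> * k)\<^sup>2) * card U" by (simp add: algebra_simps)
    also have "\<dots> \<le> exp ((\<theta> * k)\<^sup>2) * card U"
      by (intro mult_right_mono exp_ge_add_one_self) auto
    finally show ?thesis .
  qed
  have low: "exp T \<le> (\<Prod>l\<in>H'. f w (w l))" if "w \<in> ?B" for w
  proof -
    have "(\<Sum>l\<in>H. g w (w l)) \<le> (\<Sum>l\<in>H'. g w (w l)) + 2 * k"
    proof -
      have "(\<Sum>l\<in>H. g w (w l)) = (\<Sum>l\<in>H'. g w (w l)) + (\<Sum>l\<in>H \<inter> S. g w (w l))"
        unfolding H'_def by (metis add.commute finS(2) sum.Int_Diff)
      also have "(\<Sum>l\<in>H \<inter> S. g w (w l)) \<le> card (H \<inter> S) * k"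
        using g_le sum_bounded_above[of "H \<inter> S" "\<lambda>l. g w (w l)" k] by simp
      also have "\<dots> \<le> 2 * k"
        using card(1) card_mono[OF finS(1), of "H \<inter> S"] by (intro mult_right_mono) auto
      finally show ?thesis by simp
    qed
    then have "s \<le> (\<Sum>l\<in>H'. g w (w l)) + 3 * k" using that by simp
    then have s: "real s \<le> real (\<Sum>l\<in>H'. g w (w l)) + 3 * k" by (metis (mono_tags) of_nat_add of_nat_mono of_nat_mult of_nat_numeral)
    have "card H' \<le> s" unfolding H'_def card(2)[symmetric] using finS by (intro card_mono) auto
    then have "\<mu> * card H' \<le> \<mu> * s" using \<mu> by (intro mult_left_mono) auto
    moreover have "(\<Sum>l\<in>H'. real (g w (w l)) - \<mu>) = real (\<Sum>l\<in>H'. g w (w l)) - \<mu> * card H'"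
      by (simp add: sum_subtractf)
    moreover have "\<mu> * s = s - 3 * \<eta> * s / 4" by (simp add: \<mu>_def algebra_simps)
    ultimately have "3 * \<eta> * s / 4 - 3 * k \<le> (\<Sum>l\<in>H'. real (g w (w l)) - \<mu>)"
      using s by linarith
    then have "T \<le> \<theta> * (\<Sum>l\<in>H'. real (g w (w l)) - \<mu>)"
      unfolding T_def using \<theta>0 by (intro mult_left_mono) auto
    then have "exp T \<le> exp (\<Sum>l\<in>H'. \<theta> * (real (g w (w l)) - \<mu>))"
      by (simp add: sum_distrib_left)
    also have "\<dots> = (\<Prod>l\<in>H'. f w (w l))" unfolding f_def using finS by (simp add: exp_sum)
    finally show ?thesis .
  qed
  have "real (card ?B) * exp T = (\<Sum>w\<in>?B. exp T)" by simp
  also have "\<dots> \<le> (\<Sum>w\<in>?B. \<Prod>l\<in>H'. f w (w l))" by (intro sum_mono low)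
  also have "\<dots> \<le> (\<Sum>w\<in>?W. \<Prod>l\<in>H'. f w (w l))"
    using finW by (intro sum_mono2) (auto simp: f_def intro!: prod_nonneg)
  also have "\<dots> \<le> exp ((\<theta> * k)\<^sup>2) ^ card H' * real (card U) ^ card I"
  proof -
    have "(\<Sum>w\<in>PiE (J \<union> H') (\<lambda>_. U). \<Prod>l\<in>H'. f w (w l))
        \<le> exp ((\<theta> * k)\<^sup>2) ^ card H' * real (card U) ^ card (J \<union> H')"
    proof (rule sum_PiE_prod_le[OF finS(3,4) fin(2) JH(2)])
      show "0 \<le> f w u" for w u by (simp add: f_def)
      show "f (w(l := v)) = f w" if "l \<notin> J" for w l v
      proof -
        have "l \<notin> S" using that JH(3) by blast
        from g_local[OF this] show ?thesis by (simp only: f_def)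
      qed
    qed (use sumf in auto)
    then show ?thesis unfolding JH(1) .
  qed
  also have "\<dots> \<le> exp ((\<theta> * k)\<^sup>2) ^ s * real (card U) ^ card I"
  proof -
    have "card H' \<le> s" unfolding H'_def card(2)[symmetric] using finS by (intro card_mono) auto
    then show ?thesis by (intro mult_right_mono power_increasing) auto
  qed
  finally have "real (card ?B) * exp T \<le> exp ((\<theta> * k)\<^sup>2 * s) * real (card U) ^ card I"
    by (simp add: exp_of_nat_mult[symmetric] mult.commute)
  then have "real (card ?B) \<le> exp ((\<theta> * k)\<^sup>2 * s - T) * real (card U) ^ card I"
    by (simp add: exp_diff field_simps)
  also have "\<dots> \<le> exp (1 - \<eta>\<^sup>2 * s / (8 * (real k)\<^sup>2)) * real (card U) ^ card I"
  proof -
    have "(\<theta> * k)\<^sup>2 * s - T = 3 * \<eta> / (4 * k) - \<eta>\<^sup>2 * s / (8 * (real k)\<^sup>2)"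
      using k by (simp add: T_def \<theta>_def field_simps power2_eq_square)
    moreover have "3 * \<eta> / (4 * k) \<le> 1" using \<eta> k by (simp add: divide_le_eq)
    ultimately show ?thesis by (intro mult_right_mono) auto
  qed
  finally show ?thesis .
qed

text \<open>Needed for a union bound: the number of events grows only quadratically in
  \<open>s\<close>.\<close>

lemma sample_size_exists:
  fixes A c :: real
  assumes "0 < c"
  shows "\<exists>s::nat. A * (2 * real s + 1)\<^sup>2 * exp (1 - c * s) \<le> 1 / 2"
proof -
  have "((\<lambda>s::nat. A * (2 * real s + 1)\<^sup>2 * exp (1 - c * s)) \<longlongrightarrow> 0) sequentially"
    using assms by real_asymp
  then have "eventually (\<lambda>s::nat. A * (2 * real s + 1)\<^sup>2 * exp (1 - c * s) < 1 / 2) sequentially"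
    by (rule order_tendstoD) simp
  then show ?thesis by (metis (lifting) eventually_sequentially less_imp_le order_refl)
qed

text \<open>The sides of a box may overlap; sides \<open>r\<close> times larger than needed can be
  thinned greedily to disjoint ones.\<close>

lemma disjoint_subsets_of_card:
  assumes "\<And>l. l < r \<Longrightarrow> finite (Q l) \<and> r * q \<le> card (Q l)"
  shows "\<exists>P. \<forall>l<r. P l \<subseteq> Q l \<and> card (P l) = q \<and> (\<forall>i<l. P i \<inter> P l = {})"
proof (rule sequential_choice)
  fix j P assume j: "j < r" "\<forall>l<j. P l \<subseteq> Q l \<and> card (P l) = q \<and> (\<forall>i<l. P i \<inter> P l = {})"
  have "card (\<Union>i<j. P i) \<le> (\<Sum>i<j. card (P i))" by (intro card_UN_le) auto
  also have "\<dots> = j * q" using j by simp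
  finally have "card (\<Union>i<j. P i) + q \<le> Suc j * q" by simp
  also have "\<dots> \<le> r * q" using j by (intro mult_right_mono) auto
  also have "\<dots> \<le> card (Q j)" using assms j by blast
  finally have "q \<le> card (Q j) - card (\<Union>i<j. P i)" by simp
  also have "\<dots> \<le> card (Q j - (\<Union>i<j. P i))"
  proof (rule diff_card_le_card_Diff)
    have "finite (P i)" if "i < j" for i
      using j(2) assms[of i] that j(1) by (meson finite_subset order_less_trans)
    then show "finite (\<Union>i<j. P i)" by blast
  qed
  finally obtain R where "R \<subseteq> Q j - (\<Union>i<j. P i)" "card R = q"
    using obtain_subset_with_card_n by blast
  then show "\<exists>x. (P(j := x)) j \<subseteq> Q j \<and> card ((P(j := x)) j) = q \<and> (\<forall>i<j. (P(j := x)) i \<inter> (P(j := x)) j = {})"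
    by (intro exI[of _ R]) auto
next
  fix j and P P' :: "nat \<Rightarrow> 'a set"
  assume "\<forall>i\<le>j. P i = P' i" "P j \<subseteq> Q j \<and> card (P j) = q \<and> (\<forall>i<j. P i \<inter> P j = {})"
  then show "P' j \<subseteq> Q j \<and> card (P' j) = q \<and> (\<forall>i<j. P' i \<inter> P' j = {})" by auto
qed

section \<open>Augmenting a tiling\<close>

text \<open>\<open>P l\<close> collects the units that replace position \<open>l\<close>; the extra
  position keeps the single unit \<open>N - 1\<close>, whence the count 1 there. Validity of a copy
  supplies precisely the three different positions that \<open>compat\<close> asks for.\<close>

lemma realize_box:
  fixes N :: nat
  assumes red: "reduced_structure k s \<tau>"
    and injF: "inj_on (\<lambda>(u, i). F u i) ({..<N} \<times> {..<k})"
    and injG: "inj_on (\<lambda>(u, e). G u e) ({..<N} \<times> pairs k)" and N: "0 < N"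
    and P: "\<And>l. l < 2 * s \<Longrightarrow> P l \<subseteq> {..<N - 1} \<and> card (P l) = q"
    and disj: "\<And>l i. l < 2 * s \<Longrightarrow> i < l \<Longrightarrow> P i \<inter> P l = {}"
    and extra: "P (2 * s) = {N - 1}"
    and valid: "\<forall>(\<phi>, \<gamma>)\<in>set es. reduced_structure.valid k s \<tau> \<phi> \<gamma>"
    and cV: "\<And>x. x \<in> {..2 * s} \<times> {..<k} \<Longrightarrow>
      (\<Sum>(\<phi>, \<gamma>)\<leftarrow>es. reduced_structure.nV k \<phi> x) = (if fst x < 2 * s then q else 1)"
    and cC: "\<And>d. d \<in> {..2 * s} \<times> pairs k \<Longrightarrow>
      (\<Sum>(\<phi>, \<gamma>)\<leftarrow>es. reduced_structure.nC k \<gamma> d) = (if fst d < 2 * s then q else 1)"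
    and compat: "\<And>e c x y u v z. e \<in> pairs k \<Longrightarrow> c \<in> {..2 * s} \<times> pairs k \<Longrightarrow>
      x \<in> {..2 * s} \<times> {..<k} \<Longrightarrow> y \<in> {..2 * s} \<times> {..<k} \<Longrightarrow> \<tau> e c x y \<Longrightarrow>
      fst x \<noteq> fst y \<Longrightarrow> fst c \<noteq> fst x \<Longrightarrow> fst c \<noteq> fst y \<Longrightarrow>
      z \<in> P (fst c) \<Longrightarrow> u \<in> P (fst x) \<Longrightarrow> v \<in> P (fst y) \<Longrightarrow>
      rel e (G z (snd c)) (F u (snd x)) (F v (snd y))"
  shows "\<exists>J\<subseteq>{..<N - 1}. tileable k rel (card J + 1)
    (\<Union>u\<in>insert (N - 1) J. F u ` {..<k}) (\<Union>u\<in>insert (N - 1) J. G u ` pairs k)"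
proof -
  interpret reduced_structure k s \<tau> by (fact red)
  define J where "J = (\<Union>l<2 * s. P l)"
  have J: "J \<subseteq> {..<N - 1}" using P by (auto simp: J_def)
  have finJ: "finite J" using J by (rule finite_subset) simp
  have P_lt: "P l \<subseteq> {..<N}" if "l \<le> 2 * s" for l
    using P[of l] that extra N by (cases "l < 2 * s") fastforce+
  have P_card: "card (P l) = (if l < 2 * s then q else 1)" if "l \<le> 2 * s" for l
    using P[of l] that extra by auto
  have P_disj: "P l \<inter> P i = {}" if "l \<le> 2 * s" "i < l" for l i
  proof (cases "l < 2 * s")
    case True
    then show ?thesis using disj[OF True that(2)] by auto
  next
    case False
    then have "l = 2 * s" using that by simp
    then show ?thesis using P[of i] that extra by auto
  qed
  have P_disj': "l = i" if "l \<le> 2 * s" "i \<le> 2 * s" "u \<in> P l" "u \<in> P i" for l i u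
    using P_disj[of l i] P_disj[of i l] that by (cases l i rule: linorder_cases) auto
  have PJ: "(\<Union>l\<le>2 * s. P l) = insert (N - 1) J"
  proof -
    have "{..2 * s} = insert (2 * s) {..<2 * s}" by auto
    then show ?thesis using extra by (simp add: J_def)
  qed
  have inj_F: "u = v \<and> i = j" if "F u i = F v j" "u < N" "v < N" "i < k" "j < k" for u v i j
    using inj_onD[OF injF, of "(u, i)" "(v, j)"] that by auto
  have inj_G: "u = v \<and> i = j" if "G u i = G v j" "u < N" "v < N" "i \<in> pairs k" "j \<in> pairs k" for u v i j
    using inj_onD[OF injG, of "(u, i)" "(v, j)"] that by auto
  define ZV where "ZV = (\<lambda>x. (\<lambda>u. F u (snd x)) ` P (fst x))"
  define ZC where "ZC = (\<lambda>c. (\<lambda>u. G u (snd c)) ` P (fst c))"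
  let ?V = "{..2 * s} \<times> {..<k}" and ?C = "{..2 * s} \<times> pairs k"
  have finP: "finite (P l)" if "l \<le> 2 * s" for l
    using P_lt[OF that] by (rule finite_subset) simp
  have "tileable k rel (length es) (\<Union>x\<in>?V. ZV x) (\<Union>c\<in>?C. ZC c)"
  proof (rule realize_blowup)
    fix x y assume x: "x \<in> ?V" "y \<in> ?V" "x \<noteq> y"
    show "ZV x \<inter> ZV y = {}"
    proof (rule ccontr)
      assume "ZV x \<inter> ZV y \<noteq> {}"
      then obtain u v where uv: "u \<in> P (fst x)" "v \<in> P (fst y)" "F u (snd x) = F v (snd y)"
        by (auto simp: ZV_def)
      have "u < N" "v < N" using uv P_lt[of "fst x"] P_lt[of "fst y"] x by auto
      then have "u = v \<and> snd x = snd y" using inj_F[OF uv(3)] x by auto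
      then show False using P_disj'[of "fst x" "fst y" u] uv x by (auto simp: prod_eq_iff)
    qed
  next
    fix x y assume x: "x \<in> ?C" "y \<in> ?C" "x \<noteq> y"
    show "ZC x \<inter> ZC y = {}"
    proof (rule ccontr)
      assume "ZC x \<inter> ZC y \<noteq> {}"
      then obtain u v where uv: "u \<in> P (fst x)" "v \<in> P (fst y)" "G u (snd x) = G v (snd y)"
        by (auto simp: ZC_def)
      have "u < N" "v < N" using uv P_lt[of "fst x"] P_lt[of "fst y"] x by auto
      then have "u = v \<and> snd x = snd y" using inj_G[OF uv(3)] x by auto
      then show False using P_disj'[of "fst x" "fst y" u] uv x by (auto simp: prod_eq_iff)
    qed
  next
    fix \<phi> \<gamma> assume "(\<phi>, \<gamma>) \<in> set es"
    then have val: "valid \<phi> \<gamma>" using valid by auto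
    then have sub: "\<phi> ` {..<k} \<subseteq> ?V" "\<gamma> ` pairs k \<subseteq> ?C" by (auto simp: valid_def)
    have arc: "rel (i, j) c x y" if ij: "(i, j) \<in> pairs k" and m: "c \<in> ZC (\<gamma> (i, j))" "x \<in> ZV (\<phi> i)" "y \<in> ZV (\<phi> j)"
      for i j c x y
    proof -
      have "i < k" "j < k" using ij by (auto simp: pairs_def)
      then have t: "\<phi> i \<in> ?V" "\<phi> j \<in> ?V" "\<gamma> (i, j) \<in> ?C" using sub ij by blast+
      from m obtain z u v where z: "z \<in> P (fst (\<gamma> (i, j)))" "c = G z (snd (\<gamma> (i, j)))"
        "u \<in> P (fst (\<phi> i))" "x = F u (snd (\<phi> i))" "v \<in> P (fst (\<phi> j))" "y = F v (snd (\<phi> j))"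
        unfolding ZV_def ZC_def by blast
      have "\<tau> (i, j) (\<gamma> (i, j)) (\<phi> i) (\<phi> j)" "fst (\<phi> i) \<noteq> fst (\<phi> j)"
        "fst (\<gamma> (i, j)) \<noteq> fst (\<phi> i)" "fst (\<gamma> (i, j)) \<noteq> fst (\<phi> j)"
        using val ij unfolding valid_def by blast+
      from compat[OF ij t(3,1,2) this z(1,3,5)] show ?thesis using z by simp
    qed
    show "\<phi> ` {..<k} \<subseteq> ?V \<and> \<gamma> ` pairs k \<subseteq> ?C \<and>
      (\<forall>i j. (i, j) \<in> pairs k \<longrightarrow>
        (\<forall>c\<in>ZC (\<gamma> (i, j)). \<forall>x\<in>ZV (\<phi> i). \<forall>y\<in>ZV (\<phi> j). rel (i, j) c x y))"
    proof (intro conjI allI impI ballI)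
      show "\<phi> ` {..<k} \<subseteq> ?V" by (rule sub(1))
      show "\<gamma> ` pairs k \<subseteq> ?C" by (rule sub(2))
    qed (rule arc; assumption)
  next
    fix x assume x: "x \<in> ?V"
    have "inj_on (\<lambda>u. F u (snd x)) (P (fst x))"
      using inj_F P_lt[of "fst x"] x by (intro inj_onI) (auto simp: subset_iff)
    then have "card (ZV x) = card (P (fst x))" unfolding ZV_def by (rule card_image)
    then show "card (ZV x) = (\<Sum>(\<phi>, \<gamma>)\<leftarrow>es. card {i\<in>{..<k}. \<phi> i = x})"
      using P_card[of "fst x"] cV[OF x] x by (auto simp: nV_def)
  next
    fix x assume x: "x \<in> ?C"
    have "inj_on (\<lambda>u. G u (snd x)) (P (fst x))"
      using inj_G P_lt[of "fst x"] x by (intro inj_onI) (auto simp: subset_iff)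
    then have "card (ZC x) = card (P (fst x))" unfolding ZC_def by (rule card_image)
    then show "card (ZC x) = (\<Sum>(\<phi>, \<gamma>)\<leftarrow>es. card {e\<in>pairs k. \<gamma> e = x})"
      using P_card[of "fst x"] cC[OF x] x by (auto simp: nC_def)
  next
    fix x assume "x \<in> ?V"
    then show "finite (ZV x)" using finP[of "fst x"] by (auto simp: ZV_def)
  next
    fix x assume "x \<in> ?C"
    then show "finite (ZC x)" using finP[of "fst x"] by (auto simp: ZC_def)
  qed auto
  moreover have "(\<Union>x\<in>?V. ZV x) = (\<Union>u\<in>insert (N - 1) J. F u ` {..<k})"
    unfolding PJ[symmetric] ZV_def by fastforce
  moreover have "(\<Union>c\<in>?C. ZC c) = (\<Union>u\<in>insert (N - 1) J. G u ` pairs k)"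
    unfolding PJ[symmetric] ZC_def by fastforce
  ultimately have T: "tileable k rel (length es) (\<Union>u\<in>insert (N - 1) J. F u ` {..<k}) (\<Union>u\<in>insert (N - 1) J. G u ` pairs k)"
    by simp
  \<comment> \<open>The number of copies is recovered by counting the covered vertices.\<close>
  have "length es = card J + 1"
  proof -
    have "(\<Union>u\<in>insert (N - 1) J. F u ` {..<k}) = (\<lambda>(u, i). F u i) ` (insert (N - 1) J \<times> {..<k})" by auto
    moreover have "card ((\<lambda>(u, i). F u i) ` (insert (N - 1) J \<times> {..<k})) = card (insert (N - 1) J \<times> {..<k})"
      by (rule card_image, rule inj_on_subset[OF injF]) (use J N in auto)
    moreover have "card (insert (N - 1) J) = card J + 1"
      using J finJ by (subst card_insert_disjoint) auto
    ultimately have "k * length es = (card J + 1) * k"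
      using tileable_card[OF T] by (simp add: card_cartesian_product)
    then have "k * length es = k * (card J + 1)" by (simp only: mult.commute)
    then show ?thesis using k2 by (simp only: mult_cancel1) auto
  qed
  then show ?thesis using T J by (intro exI[of _ J]) simp
qed

text \<open>Unit \<open>N - 1\<close> is the exceptional one. Its relations to a sampled tuple are
  part of the structure of that tuple, hence constant along a box of tuples with equal structure.
  The size of the box is fixed before \<open>N\<close>: \<open>s\<close> depends only on
  \<open>k\<close> and \<open>\<eta>\<close>, and there are finitely many structures on
  \<open>2 * s + 1\<close> units.\<close>

lemma augmenting_units:
  fixes k :: nat and \<eta> :: real
  assumes k: "2 \<le> k" and \<eta>: "0 < \<eta>" "\<eta> < 1"
  shows "\<exists>N0. \<forall>N\<ge>N0. \<forall>(F :: nat \<Rightarrow> nat \<Rightarrow> 'v) (G :: nat \<Rightarrow> nat \<times> nat \<Rightarrow> 'c) rel.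
    inj_on (\<lambda>(u, i). F u i) ({..<N} \<times> {..<k}) \<longrightarrow> inj_on (\<lambda>(u, e). G u e) ({..<N} \<times> pairs k) \<longrightarrow>
    (\<forall>e\<in>pairs k. \<forall>w<N. \<forall>p\<in>pairs k. \<forall>u<N. \<forall>i<k.
      real (card {y\<in>{..<N} \<times> {..<k}. \<not> rel e (G w p) (F u i) (F (fst y) (snd y))}) \<le> (1 - \<eta>) * N) \<longrightarrow>
    (\<exists>J\<subseteq>{..<N - 1}. tileable k rel (card J + 1)
      (\<Union>u\<in>insert (N - 1) J. F u ` {..<k}) (\<Union>u\<in>insert (N - 1) J. G u ` pairs k))"
proof -
  define c where "c = \<eta>\<^sup>2 / (8 * (real k)\<^sup>2)"
  have "0 < c" using \<eta> k by (simp add: c_def)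
  define H where "H = card (pairs k)"
  obtain s :: nat where s: "(2 * real k * (real H)\<^sup>2) * (2 * real s + 1)\<^sup>2 * exp (1 - c * s) \<le> 1 / 2"
    using sample_size_exists[OF \<open>0 < c\<close>] by blast
  let ?V = "{..2 * s} \<times> {..<k}" and ?C = "{..2 * s} \<times> pairs k"
  define \<Omega> where "\<Omega> = pairs k \<times> ?C \<times> ?V \<times> ?V"
  have fin\<Omega>: "finite \<Omega>" by (simp add: \<Omega>_def)
  \<comment> \<open>A structure is stored as a set of compatible quadruples, so there are at most
    \<open>2 ^ card \<Omega>\<close> of them.\<close>
  define st where "st = (\<lambda>\<Theta> e c x y. (e, c, x, y) \<in> (\<Theta> :: ((nat \<times> nat) \<times> (nat \<times> (nat \<times> nat)) \<times> (nat \<times> nat) \<times> (nat \<times> nat)) set))"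
  define good where "good = {\<Theta>\<in>Pow \<Omega>. reduced_structure k s (st \<Theta>)}"
  have fingood: "finite good" using fin\<Omega> by (simp add: good_def)
  have "\<forall>\<Theta>\<in>good. \<exists>q es. (\<forall>(\<phi>, \<gamma>)\<in>set es. reduced_structure.valid k s (st \<Theta>) \<phi> \<gamma>) \<and>
    (\<forall>x\<in>?V. (\<Sum>(\<phi>, \<gamma>)\<leftarrow>es. reduced_structure.nV k \<phi> x) = (if fst x < 2 * s then q else 1)) \<and>
    (\<forall>d\<in>?C. (\<Sum>(\<phi>, \<gamma>)\<leftarrow>es. reduced_structure.nC k \<gamma> d) = (if fst d < 2 * s then q else 1))"
    using reduced_structure.exact_tiling by (auto simp: good_def)
  then obtain qf where qf: "\<forall>\<Theta>\<in>good. \<exists>es. (\<forall>(\<phi>, \<gamma>)\<in>set es. reduced_structure.valid k s (st \<Theta>) \<phi> \<gamma>) \<and>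
    (\<forall>x\<in>?V. (\<Sum>(\<phi>, \<gamma>)\<leftarrow>es. reduced_structure.nV k \<phi> x) = (if fst x < 2 * s then qf \<Theta> else 1)) \<and>
    (\<forall>d\<in>?C. (\<Sum>(\<phi>, \<gamma>)\<leftarrow>es. reduced_structure.nC k \<gamma> d) = (if fst d < 2 * s then qf \<Theta> else 1))"
    by (rule bchoice[THEN exE])
  \<comment> \<open>Bounds the multiplicities of all structures at once. \<open>Suc\<close> makes
    the sides of the box nonempty.\<close>
  define Q where "Q = Suc (\<Sum>\<Theta>\<in>good. qf \<Theta>)"
  have qfQ: "qf \<Theta> \<le> Q" if "\<Theta> \<in> good" for \<Theta>
    using member_le_sum[OF that, of qf] fingood by (simp add: Q_def)
  \<comment> \<open>At least half of the tuples are good, and the pigeonhole principle over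
    structures costs the power of two.\<close>
  define \<delta> :: real where "\<delta> = 1 / 2 / 2 ^ card \<Omega>"
  have "0 < \<delta>" by (simp add: \<delta>_def)
  from dense_contains_box[OF this, where 'u = nat and r = "2 * s" and q = "2 * s * Q"]
  obtain N1 where N1: "\<And>U G. finite U \<Longrightarrow> N1 \<le> card U \<Longrightarrow> G \<subseteq> PiE {..<2 * s} (\<lambda>_. U) \<Longrightarrow>
      \<delta> * real (card U) ^ (2 * s) \<le> real (card G) \<Longrightarrow>
      \<exists>Qb::nat \<Rightarrow> nat set. (\<forall>l<2 * s. Qb l \<subseteq> U \<and> card (Qb l) = 2 * s * Q) \<and> PiE {..<2 * s} Qb \<subseteq> G" by meson
  \<comment> \<open>Sampling avoids unit \<open>N - 1\<close>; for such \<open>N\<close> this costs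
    at most a quarter of \<open>\<eta>\<close>.\<close>
  obtain N2 :: nat where N2: "4 / \<eta> \<le> real N2" using real_arch_simple by blast
  show ?thesis
  proof (rule exI[of _ "N1 + N2 + 2"], intro allI impI)
    fix N :: nat and F :: "nat \<Rightarrow> nat \<Rightarrow> 'v" and G :: "nat \<Rightarrow> nat \<times> nat \<Rightarrow> 'c" and rel
    assume N: "N1 + N2 + 2 \<le> N" and injF: "inj_on (\<lambda>(u, i). F u i) ({..<N} \<times> {..<k})"
      and injG: "inj_on (\<lambda>(u, e). G u e) ({..<N} \<times> pairs k)"
      and deg: "\<forall>e\<in>pairs k. \<forall>w<N. \<forall>p\<in>pairs k. \<forall>u<N. \<forall>i<k.
      real (card {y\<in>{..<N} \<times> {..<k}. \<not> rel e (G w p) (F u i) (F (fst y) (snd y))}) \<le> (1 - \<eta>) * N"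
    define U where "U = {..<N - 1}"
    have U: "finite U" "card U = N - 1" by (auto simp: U_def)
    \<comment> \<open>Position \<open>2 * s\<close> always denotes the exceptional unit; the other
      positions are sampled.\<close>
    define ext where "ext = (\<lambda>w l. if l < 2 * s then w l else N - 1 :: nat)"
    define cl where "cl = (\<lambda>w c. G (ext w (fst c)) (snd c))"
    define vx where "vx = (\<lambda>w x. F (ext w (fst x)) (snd x))"
    define W where "W = PiE {..<2 * s} (\<lambda>_. U)"
    have finW: "finite W" unfolding W_def using U by (intro finite_PiE) auto
    define M where "M = real (card U) ^ (2 * s)"
    have cW: "real (card W) = M" by (simp add: W_def M_def card_PiE)
    have "0 < M" using N U by (simp add: M_def)
    define non where "non = (\<lambda>e c x w u. card {a\<in>{..<k}. \<not> rel e (cl w c) (vx w x) (F u a)})"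
    define Bad where "Bad = (\<lambda>(e, c, x, h). {w\<in>W. s < (\<Sum>l\<in>half s h. non e c x w (w l)) + k + 1})"
    define Idx where "Idx = pairs k \<times> ?C \<times> ?V \<times> (UNIV :: bool set)"
    have finIdx: "finite Idx" by (simp add: Idx_def)
    have extU: "ext w l < N" if "w \<in> {l} \<inter> {..<2 * s} \<rightarrow> U" for w l
      using that N by (auto simp: ext_def U_def)
    have bad: "real (card (Bad i)) \<le> exp (1 - c * s) * M" if i: "i \<in> Idx" for i
    proof -
      obtain e d x h where i_eq: "i = (e, d, x, h)" and e: "e \<in> pairs k" and d: "d \<in> ?C" and x: "x \<in> ?V"
        using i by (auto simp: Idx_def)
      have "real (card {w\<in>PiE {..<2 * s} (\<lambda>_. U). s < (\<Sum>l\<in>half s h. non e d x w (w l)) + k + 1})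
        \<le> exp (1 - \<eta>\<^sup>2 * s / (8 * (real k)\<^sup>2)) * real (card U) ^ card {..<2 * s}"
      proof (rule few_bad_tuples)
        show "{fst x, fst d} \<inter> {..<2 * s} \<subseteq> {..<2 * s}" "half s h \<subseteq> {..<2 * s}" "card (half s h) = s"
          by (auto simp: half_def)
        have "card ({fst x, fst d} \<inter> {..<2 * s}) \<le> card {fst x, fst d}" by (intro card_mono) auto
        also have "\<dots> \<le> 2" by (simp add: card_insert_le_m1)
        finally show "card ({fst x, fst d} \<inter> {..<2 * s}) \<le> 2" .
        show "non e d x w u \<le> k" for w u
        proof -
          have "non e d x w u \<le> card {..<k}" unfolding non_def by (intro card_mono) auto
          then show ?thesis by simp
        qed
      next
        fix w :: "nat \<Rightarrow> nat" and l v assume "l \<notin> {fst x, fst d} \<inter> {..<2 * s}"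
        then have "cl (w(l := v)) d = cl w d" "vx (w(l := v)) x = vx w x"
          by (auto simp: cl_def vx_def ext_def)
        then show "non e d x (w(l := v)) = non e d x w" unfolding non_def by (simp only:)
      next
        fix w assume w: "w \<in> {fst x, fst d} \<inter> {..<2 * s} \<rightarrow> U"
        then have lt: "ext w (fst x) < N" "ext w (fst d) < N" by (auto intro!: extU)
        have "(\<Sum>u\<in>U. non e d x w u) = card (SIGMA u:U. {a\<in>{..<k}. \<not> rel e (cl w d) (vx w x) (F u a)})"
          unfolding non_def using U by (subst card_SigmaI) auto
        also have "\<dots> \<le> card {y\<in>{..<N} \<times> {..<k}. \<not> rel e (cl w d) (vx w x) (F (fst y) (snd y))}"
          by (intro card_mono) (auto simp: U_def)
        finally have "real (\<Sum>u\<in>U. non e d x w u)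
            \<le> real (card {y\<in>{..<N} \<times> {..<k}. \<not> rel e (cl w d) (vx w x) (F (fst y) (snd y))})"
          by (simp only: of_nat_le_iff)
        also have "\<dots> \<le> (1 - \<eta>) * N"
          using deg[rule_format, OF e lt(2), of "snd d" "ext w (fst x)" "snd x"] d x lt(1)
          by (auto simp: cl_def vx_def)
        also have "\<dots> \<le> (1 - 3 * \<eta> / 4) * card U"
        proof -
          have "4 / \<eta> \<le> real N" using N N2 by linarith
          then have "4 \<le> \<eta> * N" using \<eta> by (simp add: field_simps)
          moreover have "real (card U) = real N - 1" using U N by (simp add: of_nat_diff)
          moreover have "(1 - 3 * \<eta> / 4) * (real N - 1) = (1 - \<eta>) * N + \<eta> * N / 4 - (1 - 3 * \<eta> / 4)"
            by (simp add: field_simps)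
          ultimately show ?thesis using \<eta> by simp
        qed
        finally show "(\<Sum>u\<in>U. real (non e d x w u)) \<le> (1 - 3 * \<eta> / 4) * card U" by simp
      qed (use U \<eta> k in auto)
      then show ?thesis by (simp add: Bad_def i_eq W_def M_def c_def)
    qed
    define Gd where "Gd = W - (\<Union>i\<in>Idx. Bad i)"
    have Gd: "M / 2 \<le> real (card Gd)"
    proof -
      have "card (\<Union>i\<in>Idx. Bad i) \<le> (\<Sum>i\<in>Idx. card (Bad i))" by (rule card_UN_le[OF finIdx])
      then have "real (card (\<Union>i\<in>Idx. Bad i)) \<le> (\<Sum>i\<in>Idx. real (card (Bad i)))"
        by (simp only: of_nat_sum[symmetric] of_nat_le_iff)
      also have "\<dots> \<le> (\<Sum>i\<in>Idx. exp (1 - c * s) * M)" by (intro sum_mono bad)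
      also have "\<dots> = real (card Idx) * exp (1 - c * s) * M" by simp
      also have "real (card Idx) = (2 * real k * (real H)\<^sup>2) * (2 * real s + 1)\<^sup>2"
        by (simp add: Idx_def H_def power2_eq_square algebra_simps)
      also have "\<dots> * exp (1 - c * s) * M \<le> 1 / 2 * M"
        using s \<open>0 < M\<close> by (intro mult_right_mono) auto
      finally have "real (card (\<Union>i\<in>Idx. Bad i)) \<le> M / 2" by simp
      moreover have "card W - card (\<Union>i\<in>Idx. Bad i) \<le> card Gd"
        unfolding Gd_def by (rule diff_card_le_card_Diff, rule finite_subset[OF _ finW]) (auto simp: Bad_def)
      then have "real (card W) - real (card (\<Union>i\<in>Idx. Bad i)) \<le> real (card Gd)" by linarith
      ultimately show ?thesis using cW by simp
    qed
    define \<theta> where "\<theta> = (\<lambda>w. {(e, c, x, y). (e, c, x, y) \<in> \<Omega> \<and> rel e (cl w c) (vx w x) (vx w y)})"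
    have \<theta>_good: "\<theta> w \<in> good" if w: "w \<in> Gd" for w
    proof -
      have "reduced_structure k s (st (\<theta> w))"
      proof
        show "2 \<le> k" by fact
        fix e d x h assume m: "e \<in> pairs k" "d \<in> ?C" "x \<in> ?V"
        then have "(e, d, x, h) \<in> Idx" by (simp add: Idx_def)
        then have "w \<notin> Bad (e, d, x, h)" "w \<in> W" using w by (auto simp: Gd_def)
        then have le: "(\<Sum>l\<in>half s h. non e d x w (w l)) + k + 1 \<le> s" by (simp add: Bad_def)
        have "{y\<in>half s h \<times> {..<k}. \<not> st (\<theta> w) e d x y}
          = (SIGMA l:half s h. {a\<in>{..<k}. \<not> rel e (cl w d) (vx w x) (F (w l) a)})"
          using m by (auto simp: st_def \<theta>_def \<Omega>_def half_def vx_def ext_def split: if_splits)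
        then have "card {y\<in>half s h \<times> {..<k}. \<not> st (\<theta> w) e d x y} = (\<Sum>l\<in>half s h. non e d x w (w l))"
          unfolding non_def by (simp only:) (subst card_SigmaI, auto simp: half_def)
        then show "card {y\<in>half s h \<times> {..<k}. \<not> st (\<theta> w) e d x y} + k + 1 \<le> s" using le by simp
      qed
      moreover have "\<theta> w \<subseteq> \<Omega>" by (auto simp: \<theta>_def)
      ultimately show ?thesis by (simp add: good_def)
    qed
    have "\<exists>\<Theta>\<in>good. \<delta> * M \<le> real (card {w\<in>W. \<theta> w = \<Theta>})"
    proof (rule ccontr)
      assume neg: "\<not> ?thesis"
      have "0 < real (card Gd)" using Gd \<open>0 < M\<close> by linarith
      then have "Gd \<noteq> {}" by auto
      then have ne: "good \<noteq> {}" using \<theta>_good by blast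
      have "Gd \<subseteq> (\<Union>\<Theta>\<in>good. {w\<in>W. \<theta> w = \<Theta>})" using \<theta>_good by (auto simp: Gd_def)
      then have "card Gd \<le> card (\<Union>\<Theta>\<in>good. {w\<in>W. \<theta> w = \<Theta>})"
        using fingood finW by (intro card_mono) auto
      also have "\<dots> \<le> (\<Sum>\<Theta>\<in>good. card {w\<in>W. \<theta> w = \<Theta>})" by (rule card_UN_le[OF fingood])
      finally have "real (card Gd) \<le> (\<Sum>\<Theta>\<in>good. real (card {w\<in>W. \<theta> w = \<Theta>}))"
        by (simp only: of_nat_sum[symmetric] of_nat_le_iff)
      also have "\<dots> < (\<Sum>\<Theta>\<in>good. \<delta> * M)" using neg fingood ne by (intro sum_strict_mono) auto
      also have "\<dots> = real (card good) * (\<delta> * M)" by simp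
      also have "\<dots> \<le> 2 ^ card \<Omega> * (\<delta> * M)"
      proof (intro mult_right_mono)
        have "card good \<le> card (Pow \<Omega>)" using fin\<Omega> by (intro card_mono) (auto simp: good_def)
        then have "card good \<le> 2 ^ card \<Omega>" by (simp add: card_Pow fin\<Omega>)
        then have "real (card good) \<le> real (2 ^ card \<Omega>)" by (simp only: of_nat_le_iff)
        then show "real (card good) \<le> 2 ^ card \<Omega>" by simp
      qed (use \<open>0 < \<delta>\<close> \<open>0 < M\<close> in auto)
      also have "\<dots> = M / 2" by (simp add: \<delta>_def)
      finally show False using Gd by linarith
    qed
    then obtain \<Theta> where \<Theta>: "\<Theta> \<in> good" "\<delta> * M \<le> real (card {w\<in>W. \<theta> w = \<Theta>})" by blast
    have "\<exists>Qb::nat \<Rightarrow> nat set. (\<forall>l<2 * s. Qb l \<subseteq> U \<and> card (Qb l) = 2 * s * Q) \<and> PiE {..<2 * s} Qb \<subseteq> {w\<in>W. \<theta> w = \<Theta>}"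
      using \<Theta>(2) U N by (intro N1) (auto simp: W_def M_def)
    then obtain Qb where Qb: "\<And>l. l < 2 * s \<Longrightarrow> Qb l \<subseteq> U \<and> card (Qb l) = 2 * s * Q"
      "PiE {..<2 * s} Qb \<subseteq> {w\<in>W. \<theta> w = \<Theta>}" by blast
    have Qb_ne: "Qb l \<noteq> {}" if "l < 2 * s" for l
      using Qb(1)[OF that] that by (auto simp: Q_def)
    define q where "q = qf \<Theta>"
    have "finite (Qb l) \<and> 2 * s * q \<le> card (Qb l)" if "l < 2 * s" for l
    proof -
      have "2 * s * q \<le> 2 * s * Q" using qfQ[OF \<Theta>(1)] by (simp add: q_def)
      then show ?thesis using Qb(1)[OF that] finite_subset[OF _ U(1)] by auto
    qed
    then have "\<exists>P. \<forall>l<2 * s. P l \<subseteq> Qb l \<and> card (P l) = q \<and> (\<forall>i<l. P i \<inter> P l = {})"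
      by (rule disjoint_subsets_of_card)
    then obtain P where P: "\<And>l. l < 2 * s \<Longrightarrow> P l \<subseteq> Qb l \<and> card (P l) = q"
      "\<And>l i. l < 2 * s \<Longrightarrow> i < l \<Longrightarrow> P i \<inter> P l = {}" by blast
    define P' where "P' = P(2 * s := {N - 1})"
    obtain es where es: "\<forall>(\<phi>, \<gamma>)\<in>set es. reduced_structure.valid k s (st \<Theta>) \<phi> \<gamma>"
      "\<forall>x\<in>?V. (\<Sum>(\<phi>, \<gamma>)\<leftarrow>es. reduced_structure.nV k \<phi> x) = (if fst x < 2 * s then q else 1)"
      "\<forall>d\<in>?C. (\<Sum>(\<phi>, \<gamma>)\<leftarrow>es. reduced_structure.nC k \<gamma> d) = (if fst d < 2 * s then q else 1)"
      using bspec[OF qf \<Theta>(1), folded q_def] by (elim exE conjE) (rule that; assumption)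
    show "\<exists>J\<subseteq>{..<N - 1}. tileable k rel (card J + 1)
      (\<Union>u\<in>insert (N - 1) J. F u ` {..<k}) (\<Union>u\<in>insert (N - 1) J. G u ` pairs k)"
    proof (rule realize_box[OF _ injF injG, where P = P' and es = es and q = q])
      show "reduced_structure k s (st \<Theta>)" using \<Theta>(1) by (simp add: good_def)
      show "0 < N" using N by simp
      show "P' l \<subseteq> {..<N - 1} \<and> card (P' l) = q" if "l < 2 * s" for l
        using P(1)[OF that] Qb(1)[OF that] that by (auto simp: P'_def U_def)
      show "P' i \<inter> P' l = {}" if "l < 2 * s" "i < l" for l i
        using P(2)[OF that] that by (auto simp: P'_def)
      show "P' (2 * s) = {N - 1}" by (simp add: P'_def)
      show "\<forall>(\<phi>, \<gamma>)\<in>set es. reduced_structure.valid k s (st \<Theta>) \<phi> \<gamma>" by (rule es(1))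
    next
      fix e d x y u v z
      assume m: "e \<in> pairs k" "d \<in> ?C" "x \<in> ?V" "y \<in> ?V" "st \<Theta> e d x y"
        and ne: "fst x \<noteq> fst y" "fst d \<noteq> fst x" "fst d \<noteq> fst y"
        and z: "z \<in> P' (fst d)" "u \<in> P' (fst x)" "v \<in> P' (fst y)"
      \<comment> \<open>Units from sides at three different positions extend to a tuple of the box,
        filled up arbitrarily elsewhere, and this tuple has structure \<open>\<Theta>\<close>. An
        entry for position \<open>2 * s\<close> is dropped here, as \<open>ext\<close> supplies
        it.\<close>
      define w where "w = restrict (\<lambda>l. if l = fst d then z else if l = fst x then u
        else if l = fst y then v else (SOME t. t \<in> Qb l)) {..<2 * s}"
      have PQ: "t \<in> Qb l" if "t \<in> P' l" "l < 2 * s" for t l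
        using P(1)[OF that(2)] that by (auto simp: P'_def)
      have "w \<in> PiE {..<2 * s} Qb"
        unfolding w_def restrict_PiE_iff using z PQ Qb_ne by (auto intro: some_in_eq[THEN iffD2])
      then have "\<theta> w = \<Theta>" using Qb(2) by auto
      then have "rel e (cl w d) (vx w x) (vx w y)" using m(5) by (auto simp: st_def \<theta>_def)
      moreover have "ext w (fst d) = z" "ext w (fst x) = u" "ext w (fst y) = v"
        using z ne m(2-4) by (auto simp: ext_def w_def P'_def split: if_splits)
      ultimately show "rel e (G z (snd d)) (F u (snd x)) (F v (snd y))"
        by (simp add: cl_def vx_def)
    qed (use es(2,3) in auto)
  qed
qed

section \<open>Enlarging a maximal tiling\<close>

lemma disjoint_unions_of_units:
  assumes "inj_on (\<lambda>(u, i). F u i) (A \<times> I)" "B \<subseteq> A" "B' \<subseteq> A" "B \<inter> B' = {}"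
  shows "(\<Union>u\<in>B. F u ` I) \<inter> (\<Union>u\<in>B'. F u ` I) = {}"
proof -
  have "F u i \<noteq> F v j" if "u \<in> B" "v \<in> B'" "i \<in> I" "j \<in> I" for u v i j
    using inj_onD[OF assms(1), of "(u, i)" "(v, j)"] that assms(2-4) by auto
  then show ?thesis by blast
qed

text \<open>What the first \<open>p\<close> units leave over is distributed arbitrarily, since the
  augmentation asks nothing of the individual units.\<close>

lemma extend_units:
  fixes F0 :: "nat \<Rightarrow> 'i \<Rightarrow> 'x"
  assumes inj: "inj_on (\<lambda>(u, i). F0 u i) ({..<p} \<times> I)" and X: "X = (\<Union>u<p. F0 u ` I)"
    and V: "X \<subseteq> V" "finite V" "card V = card I * N" and I: "finite I" and p: "p \<le> N"
  shows "\<exists>F. (\<forall>u<p. F u = F0 u) \<and> inj_on (\<lambda>(u, i). F u i) ({..<N} \<times> I) \<and> (\<lambda>(u, i). F u i) ` ({..<N} \<times> I) = V"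
proof -
  have X': "X = (\<lambda>(u, i). F0 u i) ` ({..<p} \<times> I)" unfolding X by auto
  have "card X = p * card I"
    unfolding X' by (subst card_image[OF inj]) (simp add: card_cartesian_product)
  then have "card (V - X) = card ({p..<N} \<times> I)"
    using V finite_subset[OF V(1,2)] p
    by (simp add: card_Diff_subset card_cartesian_product diff_mult_distrib2 mult.commute)
  then obtain f where f: "bij_betw f ({p..<N} \<times> I) (V - X)"
    using finite_same_card_bij[of "{p..<N} \<times> I" "V - X"] I V by auto
  define F where "F = (\<lambda>u i. if u < p then F0 u i else f (u, i))"
  have split: "{..<N} \<times> I = ({..<p} \<times> I) \<union> ({p..<N} \<times> I)" using p by auto
  have 1: "bij_betw (\<lambda>(u, i). F u i) ({..<p} \<times> I) X"
  proof -
    have "bij_betw (\<lambda>(u, i). F0 u i) ({..<p} \<times> I) X" using inj X' by (simp add: bij_betw_def)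
    then show ?thesis by (rule bij_betw_cong[THEN iffD1, rotated]) (auto simp: F_def)
  qed
  have 2: "bij_betw (\<lambda>(u, i). F u i) ({p..<N} \<times> I) (V - X)"
    using f by (rule bij_betw_cong[THEN iffD1, rotated]) (auto simp: F_def)
  have "bij_betw (\<lambda>(u, i). F u i) ({..<N} \<times> I) (X \<union> (V - X))"
    unfolding split by (rule bij_betw_combine[OF 1 2]) auto
  moreover have "X \<union> (V - X) = V" using V(1) by auto
  ultimately show ?thesis by (intro exI[of _ F]) (auto simp: bij_betw_def F_def)
qed

lemma perfect_rainbow_tiling:
  fixes k :: nat and \<eta> :: real
  assumes k: "2 \<le> k" and \<eta>: "0 < \<eta>" "\<eta> < 1"
  shows "\<exists>N0. \<forall>N\<ge>N0. \<forall>(V :: 'v set) (C :: 'c set) rel.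
    finite V \<longrightarrow> card V = k * N \<longrightarrow> finite C \<longrightarrow> card C = card (pairs k) * N \<longrightarrow>
    (\<forall>e\<in>pairs k. \<forall>c\<in>C. \<forall>x\<in>V. real (card {y\<in>V. \<not> rel e c x y}) \<le> (1 - \<eta>) * N) \<longrightarrow>
    tileable k rel N V C"
proof -
  obtain N0 where N0: "\<forall>N\<ge>N0. \<forall>(F :: nat \<Rightarrow> nat \<Rightarrow> 'v) (G :: nat \<Rightarrow> nat \<times> nat \<Rightarrow> 'c) rel.
    inj_on (\<lambda>(u, i). F u i) ({..<N} \<times> {..<k}) \<longrightarrow> inj_on (\<lambda>(u, e). G u e) ({..<N} \<times> pairs k) \<longrightarrow>
    (\<forall>e\<in>pairs k. \<forall>w<N. \<forall>p\<in>pairs k. \<forall>u<N. \<forall>i<k.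
      real (card {y\<in>{..<N} \<times> {..<k}. \<not> rel e (G w p) (F u i) (F (fst y) (snd y))}) \<le> (1 - \<eta>) * N) \<longrightarrow>
    (\<exists>J\<subseteq>{..<N - 1}. tileable k rel (card J + 1)
      (\<Union>u\<in>insert (N - 1) J. F u ` {..<k}) (\<Union>u\<in>insert (N - 1) J. G u ` pairs k))"
    using augmenting_units[OF k \<eta>] by (rule exE)
  show ?thesis
  proof (rule exI[of _ N0], intro allI impI)
    fix N :: nat and V :: "'v set" and C :: "'c set" and rel
    assume N: "N0 \<le> N" and V: "finite V" "card V = k * N" and C: "finite C" "card C = card (pairs k) * N"
      and deg: "\<forall>e\<in>pairs k. \<forall>c\<in>C. \<forall>x\<in>V. real (card {y\<in>V. \<not> rel e c x y}) \<le> (1 - \<eta>) * N"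
    define tl where "tl = (\<lambda>p. \<exists>X\<subseteq>V. \<exists>Y\<subseteq>C. tileable k rel p X Y)"
    have tl_le: "p \<le> N" if "tl p" for p
    proof -
      from that obtain X Y where "X \<subseteq> V" "tileable k rel p X Y" by (auto simp: tl_def)
      then have "k * p \<le> k * N" using tileable_card[of k rel p X Y] card_mono[of V X] V by auto
      then show ?thesis using k by simp
    qed
    have "tl 0" unfolding tl_def using tileable.empty by blast
    then obtain p where p: "tl p" "\<And>p'. tl p' \<Longrightarrow> p' \<le> p"
      using Greatest_le_nat[of tl _ N] GreatestI_nat[of tl 0 N] tl_le by blast
    obtain X Y where XY: "X \<subseteq> V" "Y \<subseteq> C" "tileable k rel p X Y" using p by (auto simp: tl_def)
    have "p = N"
    proof (rule ccontr)
      assume "p \<noteq> N"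
      then have pN: "p < N" using tl_le[OF p(1)] by simp
      obtain F0 G0 where FG0: "\<forall>u<p. rainbow_copy k rel (F0 u) (G0 u)"
        "inj_on (\<lambda>(u, i). F0 u i) ({..<p} \<times> {..<k})" "inj_on (\<lambda>(u, e). G0 u e) ({..<p} \<times> pairs k)"
        "X = (\<Union>u<p. F0 u ` {..<k})" "Y = (\<Union>u<p. G0 u ` pairs k)"
        using tileable_decompose[OF XY(3)] by blast
      obtain F where F: "\<forall>u<p. F u = F0 u" "inj_on (\<lambda>(u, i). F u i) ({..<N} \<times> {..<k})"
        "(\<lambda>(u, i). F u i) ` ({..<N} \<times> {..<k}) = V"
        using extend_units[OF FG0(2,4) XY(1) V(1), of N] V(2) pN by auto
      obtain G where G: "\<forall>u<p. G u = G0 u" "inj_on (\<lambda>(u, e). G u e) ({..<N} \<times> pairs k)"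
        "(\<lambda>(u, e). G u e) ` ({..<N} \<times> pairs k) = C"
        using extend_units[OF FG0(3,5) XY(2) C(1), of N] C(2) pN by auto
      have "\<exists>J\<subseteq>{..<N - 1}. tileable k rel (card J + 1)
        (\<Union>u\<in>insert (N - 1) J. F u ` {..<k}) (\<Union>u\<in>insert (N - 1) J. G u ` pairs k)"
      proof (rule N0[rule_format, OF N F(2) G(2)])
        fix e w q u i assume m: "e \<in> pairs k" "w < N" "q \<in> pairs k" "u < N" "i < k"
        have x: "F u i \<in> V" using m F(3) by auto
        have c: "G w q \<in> C" using m G(3) by auto
        have "card {y\<in>{..<N} \<times> {..<k}. \<not> rel e (G w q) (F u i) (F (fst y) (snd y))}
          = card ((\<lambda>(u, i). F u i) ` {y\<in>{..<N} \<times> {..<k}. \<not> rel e (G w q) (F u i) (F (fst y) (snd y))})"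
          by (rule card_image[symmetric], rule inj_on_subset[OF F(2)]) auto
        also have "\<dots> \<le> card {y\<in>V. \<not> rel e (G w q) (F u i) y}"
          using V F(3) by (intro card_mono) auto
        finally have "real (card {y\<in>{..<N} \<times> {..<k}. \<not> rel e (G w q) (F u i) (F (fst y) (snd y))})
          \<le> real (card {y\<in>V. \<not> rel e (G w q) (F u i) y})" by (simp only: of_nat_le_iff)
        also have "\<dots> \<le> (1 - \<eta>) * N" using deg m(1) c x by blast
        finally show "real (card {y\<in>{..<N} \<times> {..<k}. \<not> rel e (G w q) (F u i) (F (fst y) (snd y))}) \<le> (1 - \<eta>) * N" .
      qed
      then obtain J where J: "J \<subseteq> {..<N - 1}" and T: "tileable k rel (card J + 1)
        (\<Union>u\<in>insert (N - 1) J. F u ` {..<k}) (\<Union>u\<in>insert (N - 1) J. G u ` pairs k)" by blast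
      \<comment> \<open>Units in \<open>J\<close> may be copies of the old tiling. They are
        dissolved and retiled together with unit \<open>N - 1\<close>, so \<open>card J + 1\<close>
        new copies replace at most \<open>card J\<close> old ones.\<close>
      define K where "K = {..<p} - J"
      have K: "K \<subseteq> {..<N}" "insert (N - 1) J \<subseteq> {..<N}" "K \<inter> insert (N - 1) J = {}"
        using J pN by (auto simp: K_def)
      have TK: "tileable k rel (card K) (\<Union>u\<in>K. F u ` {..<k}) (\<Union>u\<in>K. G u ` pairs k)"
      proof (rule tileable_family)
        show "finite K" by (simp add: K_def)
        show "rainbow_copy k rel (F u) (G u)" if "u \<in> K" for u
          using that FG0(1) F(1) G(1) by (auto simp: K_def)
        show "inj_on (\<lambda>(u, i). F u i) (K \<times> {..<k})"
          by (rule inj_on_subset[OF F(2)]) (use K in auto)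
        show "inj_on (\<lambda>(u, e). G u e) (K \<times> pairs k)"
          by (rule inj_on_subset[OF G(2)]) (use K in auto)
      qed
      have "tileable k rel (card K + (card J + 1))
        ((\<Union>u\<in>K. F u ` {..<k}) \<union> (\<Union>u\<in>insert (N - 1) J. F u ` {..<k}))
        ((\<Union>u\<in>K. G u ` pairs k) \<union> (\<Union>u\<in>insert (N - 1) J. G u ` pairs k))"
        by (rule tileable_Un[OF TK T disjoint_unions_of_units[OF F(2) K] disjoint_unions_of_units[OF G(2) K]])
      moreover have "F u ` {..<k} \<subseteq> V" "G u ` pairs k \<subseteq> C" if "u < N" for u
        using that F(3) G(3) by auto
      then have "(\<Union>u\<in>K. F u ` {..<k}) \<union> (\<Union>u\<in>insert (N - 1) J. F u ` {..<k}) \<subseteq> V"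
        "(\<Union>u\<in>K. G u ` pairs k) \<union> (\<Union>u\<in>insert (N - 1) J. G u ` pairs k) \<subseteq> C"
        using K by blast+
      ultimately have "tl (card K + (card J + 1))" unfolding tl_def by blast
      moreover have "p \<le> card K + card J"
      proof -
        have "finite J" using J by (rule finite_subset) simp
        then have "card {..<p} - card J \<le> card K" unfolding K_def by (rule diff_card_le_card_Diff)
        then show ?thesis by simp
      qed
      ultimately show False using p(2) by fastforce
    qed
    moreover from this have "X = V" "Y = C"
      using tileable_card[OF XY(3)] card_subset_eq[OF V(1) XY(1)] card_subset_eq[OF C(1) XY(2)] V(2) C(2)
      by simp_all
    ultimately show "tileable k rel N V C" using XY(3) by simp
  qed
qed

section \<open>Tournament factors\<close>

lemma card_non_neighbours:
  fixes D :: "'b pair_pre_digraph" and d :: real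
  assumes "pair_digraph D" "x \<in> pverts D" "d \<le> real (min_semi_degree (with_proj D))"
  shows "real (card {y\<in>pverts D. (x, y) \<notin> parcs D}) \<le> card (pverts D) - d"
    and "real (card {y\<in>pverts D. (y, x) \<notin> parcs D}) \<le> card (pverts D) - d"
proof -
  interpret pair_digraph D by fact
  have fin: "finite (pverts D)" using finite_verts by simp
  have sub: "parcs D \<subseteq> pverts D \<times> pverts D" using in_arcsD1 in_arcsD2 by auto
  let ?O = "{y\<in>pverts D. (x, y) \<in> parcs D}" and ?I = "{y\<in>pverts D. (y, x) \<in> parcs D}"
  have "min_out_degree (with_proj D) \<le> out_degree (with_proj D) x"
    unfolding min_out_degree_def using fin assms(2) by (intro Min_le) auto
  also have "out_arcs (with_proj D) x = Pair x ` ?O"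
    using sub by (auto simp: out_arcs_def)
  then have "out_degree (with_proj D) x = card ?O"
    by (simp add: out_degree_def card_image inj_on_def)
  finally have o: "min_out_degree (with_proj D) \<le> card ?O" .
  have "min_in_degree (with_proj D) \<le> in_degree (with_proj D) x"
    unfolding min_in_degree_def using fin assms(2) by (intro Min_le) auto
  also have "in_arcs (with_proj D) x = (\<lambda>y. (y, x)) ` ?I"
    using sub by (auto simp: in_arcs_def)
  then have "in_degree (with_proj D) x = card ?I"
    by (simp add: in_degree_def card_image inj_on_def)
  finally have i: "min_in_degree (with_proj D) \<le> card ?I" .
  have "card (pverts D) = card ?O + card {y\<in>pverts D. (x, y) \<notin> parcs D}"
    using fin by (subst card_Un_disjoint[symmetric]) (auto intro: arg_cong[where f = card])
  then show "real (card {y\<in>pverts D. (x, y) \<notin> parcs D}) \<le> card (pverts D) - d"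
    using o assms(3) by (simp add: min_semi_degree_def)
  have "card (pverts D) = card ?I + card {y\<in>pverts D. (y, x) \<notin> parcs D}"
    using fin by (subst card_Un_disjoint[symmetric]) (auto intro: arg_cong[where f = card])
  then show "real (card {y\<in>pverts D. (y, x) \<notin> parcs D}) \<le> card (pverts D) - d"
    using i assms(3) by (simp add: min_semi_degree_def)
qed

lemma copy_of_map_prod:
  assumes "pair_digraph T" "inj_on f (pverts T)"
  shows "copy_of T \<lparr> pverts = f ` pverts T, parcs = map_prod f f ` parcs T \<rparr>"
proof -
  interpret pair_digraph T by fact
  have sub: "parcs T \<subseteq> pverts T \<times> pverts T" using in_arcsD1 in_arcsD2 by auto
  let ?iso = "\<lparr> iso_verts = f, iso_arcs = map_prod f f, iso_head = snd, iso_tail = fst \<rparr>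
    :: ('a, 'a \<times> 'a, 'b, 'b \<times> 'b) digraph_isomorphism"
  have "inj_on (map_prod f f) (parcs T)"
    by (rule inj_on_subset[OF map_prod_inj_on[OF assms(2,2)] sub])
  then have "pre_digraph.digraph_isomorphism (with_proj T) ?iso"
    using assms(2) wf_digraph_axioms by (auto simp: pre_digraph.digraph_isomorphism_def)
  moreover have "with_proj \<lparr> pverts = f ` pverts T, parcs = map_prod f f ` parcs T \<rparr> = app_iso ?iso (with_proj T)"
    by (simp add: app_iso_def with_proj_def)
  ultimately show ?thesis unfolding copy_of_def digraph_iso_def by blast
qed

lemma rainbow_factor_of_tiling:
  fixes T :: "'a pair_pre_digraph" and D :: "nat \<Rightarrow> 'b pair_pre_digraph"
  assumes T: "tournament T" and t: "bij_betw t {..<k} (pverts T)"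
    and tl: "tileable k (\<lambda>(i, j) c x y. if (t i, t j) \<in> parcs T then (x, y) \<in> parcs (D c) else (y, x) \<in> parcs (D c)) N V C"
  shows "\<exists>\<F>. rainbow_factor T V C D \<F>"
proof -
  interpret pair_digraph T using T by (simp add: tournament_def)
  have sub: "parcs T \<subseteq> pverts T \<times> pverts T" using in_arcsD1 in_arcsD2 by auto
  have noloop: "(a, a) \<notin> parcs T" for a using no_loops' by auto
  define rel where "rel = (\<lambda>(i, j) c x y. if (t i, t j) \<in> parcs T then (x, y) \<in> parcs (D c) else (y, x) \<in> parcs (D c))"
  obtain F G where FG: "\<And>u. u < N \<Longrightarrow> rainbow_copy k rel (F u) (G u)"
    "inj_on (\<lambda>(u, i). F u i) ({..<N} \<times> {..<k})" "inj_on (\<lambda>(u, e). G u e) ({..<N} \<times> pairs k)"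
    "V = (\<Union>u<N. F u ` {..<k})" "C = (\<Union>u<N. G u ` pairs k)"
    using tileable_decompose[OF tl[folded rel_def]] by blast
  define r where "r = the_inv_into {..<k} t"
  have r: "t i \<in> pverts T" "r (t i) = i" if "i < k" for i
    using t that by (auto simp: r_def bij_betw_def the_inv_into_f_f)
  have tr: "r a < k" "t (r a) = a" if "a \<in> pverts T" for a
    using t that by (auto simp: r_def bij_betw_def f_the_inv_into_f dest: the_inv_into_into[OF _ _ subset_refl])
  have r_img: "r ` pverts T = {..<k}"
  proof
    show "r ` pverts T \<subseteq> {..<k}" using tr by auto
    show "{..<k} \<subseteq> r ` pverts T"
    proof
      fix i assume "i \<in> {..<k}"
      then show "i \<in> r ` pverts T" using r[of i] by (metis imageI lessThan_iff)
    qed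
  qed
  define f where "f = (\<lambda>u. F u \<circ> r)"
  define H where "H = (\<lambda>u. \<lparr> pverts = f u ` pverts T, parcs = map_prod (f u) (f u) ` parcs T \<rparr>)"
  have pvH: "pverts (H u) = F u ` {..<k}" for u
  proof -
    have "f u ` pverts T = F u ` {..<k}"
      unfolding f_def r_img[symmetric] by (rule image_comp[symmetric])
    then show ?thesis by (simp add: H_def)
  qed
  have inj_F: "u = v \<and> i = j" if "F u i = F v j" "u < N" "v < N" "i < k" "j < k" for u v i j
    using inj_onD[OF FG(2), of "(u, i)" "(v, j)"] that by auto
  have inj_G: "u = v \<and> i = j" if "G u i = G v j" "u < N" "v < N" "i \<in> pairs k" "j \<in> pairs k" for u v i j
    using inj_onD[OF FG(3), of "(u, i)" "(v, j)"] that by auto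
  have "copy_of T (H u)" if u: "u < N" for u
    unfolding H_def
  proof (rule copy_of_map_prod)
    show "inj_on (f u) (pverts T)"
    proof (rule inj_onI)
      fix a b assume ab: "a \<in> pverts T" "b \<in> pverts T" "f u a = f u b"
      then have "r a = r b" using inj_F[of u "r a" u "r b"] u tr by (auto simp: f_def)
      then show "a = b" using tr(2) ab by metis
    qed
  qed (rule pair_digraph_axioms)
  moreover have "pairwise (\<lambda>G H. disjnt (pverts G) (pverts H)) (H ` {..<N})"
  proof (rule pairwiseI)
    fix A B assume AB: "A \<in> H ` {..<N}" "B \<in> H ` {..<N}" "A \<noteq> B"
    then obtain u v where "A = H u" "B = H v" "u < N" "v < N" "u \<noteq> v" by auto
    then show "disjnt (pverts A) (pverts B)" using inj_F by (auto simp: disjnt_def pvH)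
  qed
  moreover have "(\<Union>H\<in>H ` {..<N}. pverts H) = V" by (simp add: FG(4) pvH)
  ultimately have factor: "factor T V (H ` {..<N})" by (auto simp: factor_def)
  define \<kappa> where "\<kappa> = the_inv_into ({..<N} \<times> {..<k}) (\<lambda>(u, i). F u i)"
  have \<kappa>: "\<kappa> (F u i) = (u, i)" if "u < N" "i < k" for u i
    using the_inv_into_f_f[OF FG(2), of "(u, i)"] that by (simp add: \<kappa>_def)
  \<comment> \<open>Units are disjoint, so a vertex determines its unit and its role, and an arc can
    be given the colour that its unit assigns to its pair of roles. Ordering the pair by
    \<open>min\<close> and \<open>max\<close> forgets the direction.\<close>
  define col where "col = (\<lambda>(x, y). G (fst (\<kappa> x)) (min (snd (\<kappa> x)) (snd (\<kappa> y)), max (snd (\<kappa> x)) (snd (\<kappa> y))))"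
  have arcE: "\<exists>u i j. u < N \<and> i < k \<and> j < k \<and> i \<noteq> j \<and> e = (F u i, F u j) \<and> (t i, t j) \<in> parcs T \<and>
      col e = G u (min i j, max i j) \<and> (min i j, max i j) \<in> pairs k"
    if e: "e \<in> parcs (digraph_Union (H ` {..<N}))" for e
  proof -
    obtain u a b where u: "u < N" "(a, b) \<in> parcs T" "e = (F u (r a), F u (r b))"
      using e by (auto simp: digraph_Union_def H_def f_def)
    have ab: "a \<in> pverts T" "b \<in> pverts T" using u(2) sub by auto
    have "a \<noteq> b" using u(2) noloop by auto
    then have "r a \<noteq> r b" using tr(2) ab by metis
    then show ?thesis using u tr[OF ab(1)] tr[OF ab(2)]
      by (intro exI[of _ u] exI[of _ "r a"] exI[of _ "r b"]) (auto simp: col_def \<kappa> pairs_def min_def max_def)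
  qed
  \<comment> \<open>A tournament never has both arcs on a pair of roles. This makes
    \<open>col\<close> injective although it forgets directions, and it settles which branch of
    \<open>rel\<close> applies.\<close>
  have orient: "(t j, t i) \<notin> parcs T" if "(t i, t j) \<in> parcs T" "i < k" "j < k" for i j
    using T that r(1)[of i] r(1)[of j] noloop unfolding tournament_def by metis
  have "inj_on col (parcs (digraph_Union (H ` {..<N})))"
  proof (rule inj_onI)
    fix e e' assume e: "e \<in> parcs (digraph_Union (H ` {..<N}))" "e' \<in> parcs (digraph_Union (H ` {..<N}))" "col e = col e'"
    obtain u i j where u: "u < N" "i < k" "j < k" "i \<noteq> j" "e = (F u i, F u j)" "(t i, t j) \<in> parcs T"
      "col e = G u (min i j, max i j)" "(min i j, max i j) \<in> pairs k" using arcE[OF e(1)] by blast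
    obtain v i' j' where v: "v < N" "i' < k" "j' < k" "i' \<noteq> j'" "e' = (F v i', F v j')" "(t i', t j') \<in> parcs T"
      "col e' = G v (min i' j', max i' j')" "(min i' j', max i' j') \<in> pairs k" using arcE[OF e(2)] by blast
    have "u = v \<and> (min i j, max i j) = (min i' j', max i' j')"
      using e(3) u v by (intro inj_G) auto
    then have "u = v" "(i = i' \<and> j = j') \<or> (i = j' \<and> j = i')" by (auto simp: min_def max_def split: if_splits)
    moreover have "\<not> (i = j' \<and> j = i')" using orient[OF u(6)] u v by auto
    ultimately show "e = e'" using u v by simp
  qed
  moreover have "col e \<in> C \<and> e \<in> parcs (D (col e))" if e: "e \<in> parcs (digraph_Union (H ` {..<N}))" for e
  proof -
    obtain u i j where u: "u < N" "i < k" "j < k" "i \<noteq> j" "e = (F u i, F u j)" "(t i, t j) \<in> parcs T"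
      "col e = G u (min i j, max i j)" "(min i j, max i j) \<in> pairs k" using arcE[OF e] by blast
    have "rel (min i j, max i j) (col e) (F u (min i j)) (F u (max i j))"
      using FG(1)[OF u(1)] u(7,8) by (simp add: rainbow_copy_def)
    then have "e \<in> parcs (D (col e))"
      using u orient[OF u(6)] by (cases "i < j") (auto simp: rel_def min_def max_def split: if_splits)
    moreover have "col e \<in> C" using u FG(5) by auto
    ultimately show ?thesis by blast
  qed
  ultimately have "rainbow C D (digraph_Union (H ` {..<N}))" by (auto simp: rainbow_def)
  with factor show ?thesis by (auto simp: rainbow_factor_def)
qed

theorem theorem1p4:
  fixes k :: nat and T :: "'a pair_pre_digraph" and \<epsilon> :: real
  assumes "k \<ge> 3"
    and "tournament T" and "card (pverts T) = k"
    and "\<epsilon> > 0"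
  shows "\<exists>n0::nat. \<forall>n>n0. k dvd n \<longrightarrow>
    (let m = n div k * (k choose 2) in
      \<forall>(V :: 'b set) (D :: nat \<Rightarrow> 'b pair_pre_digraph).
        finite V \<longrightarrow> card V = n \<longrightarrow>
        (\<forall>i\<in>{1..m}. pair_digraph (D i) \<and> pverts (D i) = V \<and>
           real (min_semi_degree (with_proj (D i))) \<ge> (1 - 1 / real k + \<epsilon>) * real n) \<longrightarrow>
        (\<exists>\<F>. rainbow_factor T V {1..m} D \<F>))"
proof -
  interpret pair_digraph T using assms(2) by (simp add: tournament_def)
  have "finite (pverts T)" using finite_verts by simp
  then obtain t where t: "bij_betw t {..<k} (pverts T)"
    using finite_same_card_bij[of "{..<k}" "pverts T"] assms(3) by auto
  \<comment> \<open>Depending on the arc of \<open>T\<close>, the candidates for the later role are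
    out-neighbours or in-neighbours of \<open>x\<close>; the semi-degree controls both.\<close>
  define rel :: "(nat \<Rightarrow> 'b pair_pre_digraph) \<Rightarrow> nat \<times> nat \<Rightarrow> nat \<Rightarrow> 'b \<Rightarrow> 'b \<Rightarrow> bool" where
    "rel = (\<lambda>D (i, j) c x y. if (t i, t j) \<in> parcs T then (x, y) \<in> parcs (D c) else (y, x) \<in> parcs (D c))"
  \<comment> \<open>For \<open>n = k * N\<close> the degree condition leaves at most
    \<open>n / k - \<epsilon> * n = (1 - k * \<epsilon>) * N\<close> non-neighbours. The cap keeps
    \<open>\<eta>\<close> below 1.\<close>
  define \<eta> where "\<eta> = min (k * \<epsilon>) (1 / 2)"
  have \<eta>: "0 < \<eta>" "\<eta> < 1" "\<eta> \<le> k * \<epsilon>" using assms by (auto simp: \<eta>_def)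
  have "2 \<le> k" using assms(1) by simp
  then obtain N0 where N0: "\<forall>N\<ge>N0. \<forall>(V :: 'b set) (C :: nat set) rel.
    finite V \<longrightarrow> card V = k * N \<longrightarrow> finite C \<longrightarrow> card C = card (pairs k) * N \<longrightarrow>
    (\<forall>e\<in>pairs k. \<forall>c\<in>C. \<forall>x\<in>V. real (card {y\<in>V. \<not> rel e c x y}) \<le> (1 - \<eta>) * N) \<longrightarrow>
    tileable k rel N V C"
    using perfect_rainbow_tiling[OF _ \<eta>(1,2)] by blast
  show ?thesis
    unfolding Let_def
  proof (rule exI[of _ "k * N0"], intro allI impI)
    fix n and V :: "'b set" and D :: "nat \<Rightarrow> 'b pair_pre_digraph"
    let ?m = "n div k * (k choose 2)"
    assume n: "k * N0 < n" "k dvd n" and V: "finite V" "card V = n"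
      and D: "\<forall>i\<in>{1..?m}. pair_digraph (D i) \<and> pverts (D i) = V \<and>
           real (min_semi_degree (with_proj (D i))) \<ge> (1 - 1 / real k + \<epsilon>) * real n"
    obtain N where N: "n = k * N" using n(2) by auto
    have "tileable k (rel D) N V {1..?m}"
    proof (rule N0[rule_format])
      show "N0 \<le> N" using n N by simp
      show "card {1..?m} = card (pairs k) * N" using N assms(1) by (simp add: card_pairs)
      show "real (card {y\<in>V. \<not> rel D e c x y}) \<le> (1 - \<eta>) * N"
        if e: "e \<in> pairs k" and c: "c \<in> {1..?m}" and x: "x \<in> V" for e c x
      proof -
        have Dc: "pair_digraph (D c)" "pverts (D c) = V"
          "(1 - 1 / real k + \<epsilon>) * real n \<le> real (min_semi_degree (with_proj (D c)))" using D c by auto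
        obtain i j where ij: "e = (i, j)" by force
        have "real (card {y\<in>V. \<not> rel D e c x y}) \<le> n - (1 - 1 / real k + \<epsilon>) * real n"
          using card_non_neighbours[OF Dc(1) _ Dc(3), of x] x Dc(2) V(2)
          by (cases "(t i, t j) \<in> parcs T") (auto simp: rel_def ij)
        also have "\<dots> = (1 - k * \<epsilon>) * N" using assms(1) by (simp add: N field_simps)
        also have "\<dots> \<le> (1 - \<eta>) * N" using \<eta> by (intro mult_right_mono) auto
        finally show ?thesis .
      qed
    qed (use V N in auto)
    then show "\<exists>\<F>. rainbow_factor T V {1..?m} D \<F>"
      unfolding rel_def by (rule rainbow_factor_of_tiling[OF assms(2) t])
  qed
qed

end
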